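(* Consider the dynamical system $\frac{d}{dt}\boldsymbol y(t)=f(\boldsymbol y(t))$, $\boldsymbol y(0)=\boldsymbol x$, with state in $\mathbb{R}^D$ and time-$t$ flow $\phi_{t,f}$, a consistent implicit Runge–Kutta scheme $\Phi_h$, and its unrolled approximation $\Phi_h^L$ obtained by $L$ steps of either fixed-point iteration or Newton–Raphson iteration. Put $L^*=L$ for fixed-point iteration and $L^*=2^{L+1}-2$ for Newton–Raphson iteration. Let $f_\theta$ be the network vector field learned by minimizing the loss $\mathcal{L}_{unrolled}$. Let $s\ge 1$ be the number of compositions and $\Delta t=sh$. For $\boldsymbol x\in\mathbb{R}^D$ and $r_1,r_2>0$ denote $$\mathcal{L}=\big\|(\Phi^L_{h,f_\theta})^s-\phi_{sh,f}\big\|_{\mathcal{B}(\boldsymbol x,r_1)}/\Delta t ,$$ and suppose that $f$ and $f_\theta$ are analytic and satisfy $\|f\|_{\mathcal{B}(\boldsymbol x,r_1+r_2)}\le m$ and $\|f_\theta\|_{\mathcal{B}(\boldsymbol x,r_1+r_2)}\le m$. Suppose that $\Phi_h$ is of order $p$, i.e. $\Phi_h(\boldsymbol x)=\phi_h(\boldsymbol x)+\mathcal{O}(h^{p+1})$, and that $L^*+1\ge p$. Then there are constants $\Delta t_0>0$ and $c_2$, depending only on $m/r_1$, $m/r_2$, $s$, the scheme $\Phi_h$ and the choice of implicit solver, such that, if $0<\Delta t<\Delta t_0$, $$\|f_\theta(\boldsymbol x)-f(\boldsymbol x)\|\le c_2\,m\,h^p+\frac{e}{e-1}\,\mathcal{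L}.$$
   Context: Norms: $\|\cdot\|=\|\cdot\|_\infty$ on $\mathbb{C}^D$; $\mathcal{B}(\boldsymbol x,r)\subset\mathbb{C}^D$ is the complex ball of radius $r$ centered at $\boldsymbol x$ for this norm; for a set $\mathcal{K}\subset\mathbb{C}^D$ and a map $g$, $\|g\|_{\mathcal{K}}=\sup_{\boldsymbol x\in\mathcal{K}}\|g(\boldsymbol x)\|$. Vector fields analytic near a real point are extended to complex arguments. Runge–Kutta scheme: with coefficients $a_{ij},b_i$ ($1\le i,j\le I$), for a vector field $g$, $\boldsymbol v_i=\boldsymbol x+h\sum_{j=1}^I a_{ij}g(\boldsymbol v_j)$ $(i=1,\dots,I)$, $\Phi_{h,g}(\boldsymbol x)=\boldsymbol x+h\sum_{i=1}^I b_ig(\boldsymbol v_i)$. It is explicit only if $a_{ij}=0$ for $i\le j$, otherwise implicit. Consistent means $\sum_i b_i=1$. In the definition of order, $\Phi_h$ and $\phi_h$ are the numerical and exact solution maps of the same differential equation. Unrolled approximation $\Phi^L_{h,g}$: set $\boldsymbol v_i^0=\boldsymbol x$, and for $l=1,\dots,L$, either (fixed-point iteration) $\boldsymbol v_i^l=\boldsymbol x+h\sum_j a_{ij}g(\boldsymbol v_j^{l-1})$, or (Newton–Raphson iteration) $\boldsymbol v_i^l=\boldsymbol x+h\sum_j a_{ij}\big(g(\boldsymbol v_j^{l-1})+g'(\boldsymbol v_j^{l-1})(\boldsymbol v_j^l-\boldsymbol v_j^{l-1})\big)$ (a linear system for $(\boldsymbol v_j^l)_j$); then $\Phi^L_{h,g}(\boldsymbol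 x)=\boldsymbol x+h\sum_i b_ig(\boldsymbol v_i^L)$. "Implicit solver" refers to the choice between these two iterations. A power $(\cdot)^s$ of a map is $s$-fold composition. Loss: for data $\phi_{m\Delta t,f}(\boldsymbol x_n)$, $1\le n\le N$, $0\le m\le M$, $\mathcal{L}_{unrolled}=\sum_{n=1}^N\sum_{m=1}^M\|(\Phi^L_{h,f_\theta})^{ms}(\boldsymbol x_n)-\phi_{m\Delta t,f}(\boldsymbol x_n)\|_2^2/(m\Delta t)^2$ (in this formula $m$ is a summation index, unrelated to the bound $m$ in the claim). *)

theory Defs
  imports "HOL-Analysis.Analysis"
begin

text \<open>
  The constants of the theorem must not depend on the dimension D, so D is a natural number that
  can be quantified over, not a type. A vector of C^D is a function \<open>nat \<Rightarrow> complex\<close> that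
  vanishes from index D on; in this way equality of vectors is equality of functions.
\<close>

type_synonym cvec = "nat \<Rightarrow> complex"

definition cspace :: "nat \<Rightarrow> cvec set" where
  "cspace D = {z. \<forall>k\<ge>D. z k = 0}"

definition rspace :: "nat \<Rightarrow> cvec set" where
  "rspace D = {z \<in> cspace D. \<forall>k. z k \<in> \<real>}"

definition vnorm :: "nat \<Rightarrow> cvec \<Rightarrow> real" where
  "vnorm D z = Max (insert 0 ((\<lambda>k. cmod (z k)) ` {..<D}))"

definition vball :: "nat \<Rightarrow> cvec \<Rightarrow> real \<Rightarrow> cvec set" where
  "vball D x r = {z \<in> cspace D. vnorm D (\<lambda>k. z k - x k) < r}"

text \<open>The supremum is taken in the extended reals, so that it is infinite, and not an unspecified
  real number, for an unbounded map.\<close>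

definition sup_norm :: "nat \<Rightarrow> cvec set \<Rightarrow> (cvec \<Rightarrow> cvec) \<Rightarrow> ereal" where
  "sup_norm D K g = (SUP z\<in>K. ereal (vnorm D (g z)))"

text \<open>
  A vector field on R^D and its extension to complex arguments are one function
  \<open>g :: cvec \<Rightarrow> cvec\<close>, which maps real vectors to real vectors; its values at complex points
  matter only where it is assumed to be analytic.
\<close>

definition real_field :: "nat \<Rightarrow> (cvec \<Rightarrow> cvec) \<Rightarrow> bool" where
  "real_field D g \<longleftrightarrow> g ` rspace D \<subseteq> rspace D"

text \<open>Around every point of S, each component is the sum of a convergent power series in D complex
  variables; \<open>\<alpha>\<close> ranges over the multi-indices of length D.\<close>

definition field_analytic_on :: "nat \<Rightarrow> (cvec \<Rightarrow> cvec) \<Rightarrow> cvec set \<Rightarrow> bool" where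
  "field_analytic_on D g S \<longleftrightarrow>
     (\<forall>z\<in>S. \<exists>\<rho>>0. \<exists>c :: nat \<Rightarrow> (nat \<Rightarrow> nat) \<Rightarrow> complex. \<forall>w \<in> vball D z \<rho>.
        g w \<in> cspace D \<and>
        (\<forall>k<D. ((\<lambda>\<alpha>. c k \<alpha> * (\<Prod>j<D. (w j - z j) ^ \<alpha> j)) has_sum g w k)
                {\<alpha>. \<forall>j\<ge>D. \<alpha> j = 0}))"

definition partial_deriv :: "(cvec \<Rightarrow> cvec) \<Rightarrow> cvec \<Rightarrow> nat \<Rightarrow> nat \<Rightarrow> complex" where
  "partial_deriv g z k l = deriv (\<lambda>t. g (z(l := t)) k) (z l)"

definition ode_solution :: "nat \<Rightarrow> (cvec \<Rightarrow> cvec) \<Rightarrow> real \<Rightarrow> (real \<Rightarrow> cvec) \<Rightarrow> bool" where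
  "ode_solution D g T u \<longleftrightarrow>
     (\<forall>t\<in>{0..T}. u t \<in> cspace D \<and>
        (\<forall>k<D. ((\<lambda>\<tau>. u \<tau> k) has_vector_derivative g (u t) k) (at t within {0..T})))"

text \<open>The value is meaningful where the initial value problem has a unique solution up to time t.
  The time is real, the initial value may be complex.\<close>

definition flow :: "nat \<Rightarrow> (cvec \<Rightarrow> cvec) \<Rightarrow> real \<Rightarrow> cvec \<Rightarrow> cvec" where
  "flow D g t y = (THE z. \<exists>u. ode_solution D g t u \<and> u 0 = y \<and> u t = z)"

text \<open>A Runge--Kutta scheme with I stages has coefficients \<open>a i j\<close> and \<open>b i\<close>, where
  the indices i and j run from 0 to I - 1.\<close>

definition rk_consistent :: "nat \<Rightarrow> (nat \<Rightarrow> real) \<Rightarrow> bool" where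
  "rk_consistent I b \<longleftrightarrow> (\<Sum>i<I. b i) = 1"

definition rk_explicit :: "nat \<Rightarrow> (nat \<Rightarrow> nat \<Rightarrow> real) \<Rightarrow> bool" where
  "rk_explicit I a \<longleftrightarrow> (\<forall>i<I. \<forall>j<I. i \<le> j \<longrightarrow> a i j = 0)"

definition rk_stages ::
    "nat \<Rightarrow> (nat \<Rightarrow> nat \<Rightarrow> real) \<Rightarrow> nat \<Rightarrow> real \<Rightarrow> (cvec \<Rightarrow> cvec) \<Rightarrow> cvec \<Rightarrow> (nat \<Rightarrow> cvec) \<Rightarrow> bool" where
  "rk_stages I a D h g x v \<longleftrightarrow>
     (\<forall>i<I. v i \<in> cspace D \<and> (\<forall>k<D. v i k = x k + h * (\<Sum>j<I. a i j * g (v j) k)))"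

definition rk_update ::
    "nat \<Rightarrow> (nat \<Rightarrow> real) \<Rightarrow> real \<Rightarrow> (cvec \<Rightarrow> cvec) \<Rightarrow> cvec \<Rightarrow> (nat \<Rightarrow> cvec) \<Rightarrow> cvec" where
  "rk_update I b h g x v = (\<lambda>k. x k + h * (\<Sum>i<I. b i * g (v i) k))"

text \<open>
  The order is a property of the scheme: \<open>\<Phi>\<^sub>h(x) = \<phi>\<^sub>h(x) + O(h\<^sup>p\<^sup>+\<^sup>1)\<close> as h tends to 0, for
  every dimension, every real vector field g and every real point x near which g is analytic; the
  O-constant may depend on all of these. The implicit stage equations may have several solutions;
  \<open>\<Phi>\<^sub>h(x)\<close> is given by the one near x, which exists and is unique for small \<open>\<delta>\<close> and then small h.
\<close>

definition rk_order ::
    "nat \<Rightarrow> (nat \<Rightarrow> nat \<Rightarrow> real) \<Rightarrow> (nat \<Rightarrow> real) \<Rightarrow> nat \<Rightarrow> bool" where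
  "rk_order I a b p \<longleftrightarrow>
     (\<forall>D g x. real_field D g \<and> x \<in> rspace D \<and> field_analytic_on D g {x} \<longrightarrow>
        (\<exists>\<delta>>0. \<exists>h0>0. \<exists>C. \<forall>h v.
           0 < h \<and> h < h0 \<and> rk_stages I a D h g x v \<and> (\<forall>i<I. v i \<in> vball D x \<delta>) \<longrightarrow>
           vnorm D (\<lambda>k. rk_update I b h g x v k - flow D g h x k) \<le> C * h ^ (p + 1)))"

datatype implicit_solver = Fixed_Point | Newton_Raphson

text \<open>One Newton--Raphson step maps the stages v to the solution w of a linear system. Stage families
  are restricted to the indices below I, so that w is unique if the system is nonsingular; otherwise
  the value is unspecified.\<close>

definition newton_next ::
    "nat \<Rightarrow> (nat \<Rightarrow> nat \<Rightarrow> real) \<Rightarrow> nat \<Rightarrow> real \<Rightarrow> (cvec \<Rightarrow> cvec) \<Rightarrow> cvec \<Rightarrow> (nat \<Rightarrow> cvec) \<Rightarrow> (nat \<Rightarrow> cvec)" where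
  "newton_next I a D h g x v =
     (THE w. w \<in> {..<I} \<rightarrow>\<^sub>E cspace D \<and>
        (\<forall>i<I. \<forall>k<D. w i k = x k + h * (\<Sum>j<I. a i j *
            (g (v j) k + (\<Sum>l<D. partial_deriv g (v j) k l * (w j l - v j l))))))"

primrec unrolled_stages ::
    "implicit_solver \<Rightarrow> nat \<Rightarrow> (nat \<Rightarrow> nat \<Rightarrow> real) \<Rightarrow> nat \<Rightarrow> real \<Rightarrow> (cvec \<Rightarrow> cvec) \<Rightarrow> cvec \<Rightarrow> nat
       \<Rightarrow> (nat \<Rightarrow> cvec)" where
  "unrolled_stages sol I a D h g x 0 = (\<lambda>i. x)"
| "unrolled_stages sol I a D h g x (Suc l) =
     (case sol of
        Fixed_Point \<Rightarrow> (\<lambda>i k. x k + h * (\<Sum>j<I. a i j * g (unrolled_stages sol I a D h g x l j) k))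
      | Newton_Raphson \<Rightarrow> newton_next I a D h g x (unrolled_stages sol I a D h g x l))"

definition unrolled_step ::
    "implicit_solver \<Rightarrow> nat \<Rightarrow> (nat \<Rightarrow> nat \<Rightarrow> real) \<Rightarrow> (nat \<Rightarrow> real) \<Rightarrow> nat \<Rightarrow> nat \<Rightarrow> real
       \<Rightarrow> (cvec \<Rightarrow> cvec) \<Rightarrow> cvec \<Rightarrow> cvec" where
  "unrolled_step sol I a b L D h g x = rk_update I b h g x (unrolled_stages sol I a D h g x L)"

definition Lstar :: "implicit_solver \<Rightarrow> nat \<Rightarrow> nat" where
  "Lstar sol L = (case sol of Fixed_Point \<Rightarrow> L | Newton_Raphson \<Rightarrow> 2 ^ (L + 1) - 2)"

text \<open>The training loss of the vector field g for the data generated by f from the initial values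
  \<open>X 1, \<dots>, X N\<close>, with \<open>\<Delta>t = s h\<close>. It uses the Euclidean norm.\<close>

definition unrolled_loss ::
    "implicit_solver \<Rightarrow> nat \<Rightarrow> (nat \<Rightarrow> nat \<Rightarrow> real) \<Rightarrow> (nat \<Rightarrow> real) \<Rightarrow> nat \<Rightarrow> nat \<Rightarrow> real \<Rightarrow> nat
       \<Rightarrow> (cvec \<Rightarrow> cvec) \<Rightarrow> nat \<Rightarrow> nat \<Rightarrow> (nat \<Rightarrow> cvec) \<Rightarrow> (cvec \<Rightarrow> cvec) \<Rightarrow> real" where
  "unrolled_loss sol I a b L D h s f N M X g =
     (\<Sum>n=1..N. \<Sum>m=1..M.
        (\<Sum>k<D. (cmod ((unrolled_step sol I a b L D h g ^^ (m * s)) (X n) k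
                        - flow D f (m * (s * h)) (X n) k))\<^sup>2) / (m * (s * h))\<^sup>2)"

end

theory Submission
  imports Defs "HOL-Complex_Analysis.Complex_Analysis"
begin

text \<open>
  Write \<open>g\<close> for the learned field, \<open>\<Psi>\<close> for the s-fold unrolled step with \<open>g\<close> and \<open>T\<close> for the
  flow of \<open>f\<close> over the time \<open>\<Delta>t = s h\<close>. If \<open>\<Sum>\<^sub>k w\<^sub>k k\<^sup>j\<close> is 1 for \<open>j = 1\<close> and 0 for
  \<open>2 \<le> j \<le> p\<close>, then \<open>g(x) - f(x)\<close> is \<open>\<Sum>\<^sub>k w\<^sub>k (\<phi>\<^bsub>k \<Delta>t,g\<^esub>(x) - \<phi>\<^bsub>k \<Delta>t,f\<^esub>(x)) / \<Delta>t\<close> up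
  to a numerical differentiation error of order p. Here \<open>\<phi>\<^bsub>k \<Delta>t,g\<^esub>(x)\<close> may be replaced by
  \<open>\<Psi>\<^sup>k(x)\<close>, because the unrolled scheme has order p, and \<open>\<Psi>\<^sup>k(x) - T\<^sup>k(x)\<close> is
  \<open>k (\<Psi>(x) - T(x))\<close> up to a relative error \<open>O(\<Delta>t)\<close>, because the loss bounds \<open>\<Psi> - T\<close> on a complex
  ball and therefore also its variation. As \<open>\<Sum>\<^sub>k w\<^sub>k k = 1\<close>, the loss enters with a factor
  \<open>1 + O(\<Delta>t)\<close>, which is at most \<open>e / (e - 1)\<close> for small \<open>\<Delta>t\<close>.

  All constants are independent of the dimension, of L and of the fields because every estimate is the
  one-variable Schwarz lemma applied along a holomorphic curve. In particular the order hypothesis,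
  whose O-constant depends on the field and the point, becomes uniform: the exact scheme and the flow
  extend to complex h in a disc of fixed radius, their difference is bounded there, and it vanishes at
  0 to order p + 1.
\<close>

section \<open>Vectors and one-variable estimates\<close>

text \<open>The scale behind all estimates is a radius H for complex step sizes with
  \<open>16 * H * A * m <= \<rho>\<close>, where A bounds the coefficients of the scheme. Below it
  the stage equations, the Newton systems and the integral equation of the flow are contractions
  with factor 1/2, and every error is a power of h/H with explicit constants.

  The margin \<rho> is r2/4 because four needs are nested: the iterated steps move away from the
  ball of radius r1, the Schwarz lemma for the step map needs room, the stages move away from the
  base point, and the Schwarz lemma for the field needs room around the stages.

  One obstacle shapes the argument: the order hypothesis speaks of real points only, while the loss
  lives on a complex ball. The scheme is therefore compared with the flow of g only along the real
  orbit of x, and the complex ball serves to control the variation of \<Psi> - T. Only multiples of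
  \<Delta>t are sampled, so the derivative of the flow at time 0 has to be recovered from finitely
  many iterates; this is the task of the weights.\<close>

lemma vnorm_le_iff: "0 \<le> B \<Longrightarrow> vnorm D z \<le> B \<longleftrightarrow> (\<forall>k<D. cmod (z k) \<le> B)"
  by (auto simp: vnorm_def)

lemma vnorm_less_iff: "0 < B \<Longrightarrow> vnorm D z < B \<longleftrightarrow> (\<forall>k<D. cmod (z k) < B)"
  by (auto simp: vnorm_def)

lemma vnorm_nonneg [simp]: "0 \<le> vnorm D z"
  by (auto simp: vnorm_def)

lemma cmod_le_vnorm: "k < D \<Longrightarrow> cmod (z k) \<le> vnorm D z"
  by (auto simp: vnorm_def intro!: Max_ge)

lemma vnorm_leI: "0 \<le> B \<Longrightarrow> (\<And>k. k < D \<Longrightarrow> cmod (z k) \<le> B) \<Longrightarrow> vnorm D z \<le> B"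
  by (simp add: vnorm_le_iff)

lemma vnorm_lessI: "0 < B \<Longrightarrow> (\<And>k. k < D \<Longrightarrow> cmod (z k) < B) \<Longrightarrow> vnorm D z < B"
  by (simp add: vnorm_less_iff)

lemma vnorm_cong: "(\<And>k. k < D \<Longrightarrow> cmod (z k) = cmod (w k)) \<Longrightarrow> vnorm D z = vnorm D w"
  unfolding vnorm_def by (metis (mono_tags, lifting) image_cong lessThan_iff)

definition vdist :: "nat \<Rightarrow> cvec \<Rightarrow> cvec \<Rightarrow> real" where
  "vdist D x y = vnorm D (\<lambda>k. x k - y k)"

lemma vdist_nonneg [simp]: "0 \<le> vdist D x y"
  by (simp add: vdist_def)

lemma vdist_refl [simp]: "vdist D x x = 0"
  by (rule antisym) (auto simp: vdist_def intro!: vnorm_leI)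

lemma vdist_commute: "vdist D x y = vdist D y x"
  unfolding vdist_def by (rule vnorm_cong) (simp add: norm_minus_commute)

lemma cmod_le_vdist: "k < D \<Longrightarrow> cmod (x k - y k) \<le> vdist D x y"
  unfolding vdist_def by (rule cmod_le_vnorm)

lemma vdist_leI: "0 \<le> B \<Longrightarrow> (\<And>k. k < D \<Longrightarrow> cmod (x k - y k) \<le> B) \<Longrightarrow> vdist D x y \<le> B"
  unfolding vdist_def by (rule vnorm_leI)

lemma vdist_triangle: "vdist D x z \<le> vdist D x y + vdist D y z"
proof (rule vdist_leI)
  fix k assume k: "k < D"
  have "cmod (x k - z k) \<le> cmod (x k - y k) + cmod (y k - z k)"
    using norm_triangle_ineq [of "x k - y k" "y k - z k"] by simp
  also have "\<dots> \<le> vdist D x y + vdist D y z"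
    by (intro add_mono cmod_le_vdist k)
  finally show "cmod (x k - z k) \<le> vdist D x y + vdist D y z" .
qed simp

lemma vball_iff: "z \<in> vball D x r \<longleftrightarrow> z \<in> cspace D \<and> vdist D z x < r"
  by (auto simp: vball_def vdist_def)

text \<open>The maximum modulus principle is applied to the cofactor \<open>H\<close> and not to
  \<open>t ^ n * H t\<close>: on the circle of radius r it is at most \<open>M / r ^ n\<close>, and
  r tends to R. The factored form serves every order of vanishing.\<close>

lemma schwarz_factor:
  assumes H: "H holomorphic_on ball 0 R" and bd: "\<And>t. cmod t < R \<Longrightarrow> cmod (t ^ n * H t) \<le> M"
    and t: "cmod t < R"
  shows "cmod (t ^ n * H t) \<le> M * (cmod t / R) ^ n"
proof -
  have R: "0 < R" using t by (meson norm_ge_zero le_less_trans)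
  have *: "cmod (H t) * r ^ n \<le> M" if r: "cmod t < r" "r < R" for r
  proof -
    have r0: "0 < r" using r by (meson norm_ge_zero le_less_trans)
    have "cmod (H t) \<le> M / r ^ n"
    proof (rule maximum_modulus_frontier [where S = "cball 0 r" and f = H])
      show "H holomorphic_on interior (cball 0 r)"
        using H by (rule holomorphic_on_subset) (use r in auto)
      show "continuous_on (closure (cball 0 r)) H"
        by (rule holomorphic_on_imp_continuous_on, rule holomorphic_on_subset [OF H]) (use r in auto)
      show "cmod (H w) \<le> M / r ^ n" if "w \<in> frontier (cball 0 r)" for w
      proof -
        have w: "cmod w = r" using that by (simp add: dist_norm)
        then show ?thesis using bd [of w] r r0 by (simp add: norm_mult norm_power field_simps)
      qed
    qed (use r in auto)
    then show ?thesis using r0 by (simp add: field_simps)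
  qed
  have "cmod (H t) * R ^ n \<le> M"
  proof (rule tendsto_upperbound)
    show "((\<lambda>r. cmod (H t) * r ^ n) \<longlongrightarrow> cmod (H t) * R ^ n) (at_left R)"
      by (intro tendsto_intros)
    show "\<forall>\<^sub>F r in at_left R. cmod (H t) * r ^ n \<le> M"
      unfolding eventually_at_left_field using * t by blast
  qed simp
  then have "cmod t ^ n * (cmod (H t) * R ^ n) \<le> cmod t ^ n * M"
    by (rule mult_left_mono) simp
  then show ?thesis using R by (simp add: norm_mult norm_power power_divide field_simps)
qed

text \<open>Repeated division by t. The cofactor of the remainder is holomorphic on the whole disc
  and not only near 0, as \<open>schwarz_factor\<close> requires.\<close>

lemma taylor_factor:
  assumes "F holomorphic_on ball 0 R"
  shows "\<exists>c H. H holomorphic_on ball 0 R \<and>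
    (\<forall>t. cmod t < R \<longrightarrow> F t = (\<Sum>j<n. c j * t ^ j) + t ^ n * H t)"
proof (induction n)
  case 0
  then show ?case using assms by auto
next
  case (Suc n)
  then obtain c H where H: "H holomorphic_on ball 0 R"
    and F: "\<And>t. cmod t < R \<Longrightarrow> F t = (\<Sum>j<n. c j * t ^ j) + t ^ n * H t"
    by blast
  have "(\<lambda>t. H t - H 0) holomorphic_on ball 0 R"
    using H by (intro holomorphic_intros)
  then obtain K where K: "K holomorphic_on ball 0 R"
    and HK: "\<And>t. cmod t < R \<Longrightarrow> H t - H 0 = t * K t"
    using Schwarz3 [of "\<lambda>t. H t - H 0" R] by auto
  have "F t = (\<Sum>j<Suc n. (c(n := H 0)) j * t ^ j) + t ^ Suc n * K t" if "cmod t < R" for t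
  proof -
    have "H t = H 0 + t * K t" using HK [OF that] by (simp add: algebra_simps)
    then show ?thesis using F [OF that] by (simp add: algebra_simps)
  qed
  then show ?case using K by blast
qed

text \<open>A bound on an arbitrarily short real interval with an arbitrary constant forces F(0) =
  0; dividing by t lowers n, and induction yields a zero of order n. The conclusion mentions neither
  \<open>C\<close> nor \<open>\<epsilon>\<close>: this is how the field-dependent constants of the
  order hypothesis drop out.\<close>

lemma vanishing_factor:
  assumes "F holomorphic_on ball 0 R" "0 < R"
    and "0 < \<epsilon>" "\<And>t::real. 0 < t \<Longrightarrow> t < \<epsilon> \<Longrightarrow> cmod (F (of_real t)) \<le> C * t ^ n"
  shows "\<exists>H. H holomorphic_on ball 0 R \<and> (\<forall>t. cmod t < R \<longrightarrow> F t = t ^ n * H t)"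
  using assms
proof (induction n arbitrary: F \<epsilon>)
  case 0
  then show ?case by auto
next
  case (Suc n)
  have cont: "isCont F 0"
    using Suc.prems(1,2)
    by (metis centre_in_ball continuous_on_eq_continuous_at holomorphic_on_imp_continuous_on open_ball)
  have lim1: "((\<lambda>t::real. F (of_real t)) \<longlongrightarrow> F 0) (at_right 0)"
  proof -
    have "((\<lambda>t::real. complex_of_real t) \<longlongrightarrow> of_real 0) (at_right 0)"
      by (intro tendsto_intros)
    then show ?thesis
      using isCont_tendsto_compose [OF cont, of "\<lambda>t::real. complex_of_real t" "at_right 0"] by simp
  qed
  have lim2: "((\<lambda>t::real. C * t ^ Suc n) \<longlongrightarrow> C * 0 ^ Suc n) (at_right 0)"
    by (intro tendsto_intros)
  have "((\<lambda>t::real. F (of_real t)) \<longlongrightarrow> 0) (at_right 0)"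
  proof (rule tendsto_norm_zero_cancel, rule tendsto_sandwich [where f = "\<lambda>_. 0"])
    show "\<forall>\<^sub>F t in at_right 0. cmod (F (complex_of_real t)) \<le> C * t ^ Suc n"
      unfolding eventually_at_right_field using Suc.prems(3,4) by auto
  qed (use lim2 in auto)
  then have F0: "F 0 = 0"
    using lim1 tendsto_unique trivial_limit_at_right_real by blast
  obtain G where G: "G holomorphic_on ball 0 R" and FG: "\<And>z. cmod z < R \<Longrightarrow> F z = z * G z"
    using Schwarz3 [OF Suc.prems(1) F0] by metis
  \<comment> \<open>The new interval is cut at R because the factorisation
    \<open>F z = z * G z\<close> is available only there.\<close>
  have "cmod (G (of_real s)) \<le> C * s ^ n" if s: "0 < s" "s < min \<epsilon> R" for s :: real
    using Suc.prems(4) [of s] FG [of "of_real s"] s by (simp add: norm_mult field_simps)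
  then obtain H where "H holomorphic_on ball 0 R" "\<And>t. cmod t < R \<Longrightarrow> G t = t ^ n * H t"
    using Suc.IH [OF G Suc.prems(2), of "min \<epsilon> R"] Suc.prems(2,3) by auto
  then show ?case using FG by (auto intro!: exI [of _ H])
qed

lemma schwarz_first_order:
  assumes F: "F holomorphic_on ball 0 R" and bd: "\<And>t. cmod t < R \<Longrightarrow> cmod (F t) \<le> M"
    and "F 0 = 0" and t: "cmod t < R"
  shows "cmod (F t) \<le> M * (cmod t / R)"
proof -
  obtain H where H: "H holomorphic_on ball 0 R" "\<And>t. cmod t < R \<Longrightarrow> F t = t * H t"
    using Schwarz3 [OF F \<open>F 0 = 0\<close>] by metis
  show ?thesis
    using schwarz_factor [OF H(1), of 1 M t] bd t by (simp add: H(2))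
qed

lemma schwarz_second_order:
  assumes F: "F holomorphic_on ball 0 R" and bd: "\<And>t. cmod t < R \<Longrightarrow> cmod (F t) \<le> M"
    and "F 0 = 0" "(F has_field_derivative 0) (at 0)" and t: "cmod t < R"
  shows "cmod (F t) \<le> M * (cmod t / R)\<^sup>2"
proof -
  obtain H where H: "H holomorphic_on ball 0 R" "\<And>t. cmod t < R \<Longrightarrow> F t = t * H t"
    and H0: "deriv F 0 = H 0"
    using Schwarz3 [OF F \<open>F 0 = 0\<close>] by metis
  have "H 0 = 0" using assms(4) H0 by (simp add: DERIV_imp_deriv)
  then obtain K where K: "K holomorphic_on ball 0 R" "\<And>t. cmod t < R \<Longrightarrow> H t = t * K t"
    using Schwarz3 [OF H(1)] by metis
  show ?thesis
    using schwarz_factor [OF K(1), of 2 M t] bd t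
    by (simp add: H(2) K(2) power2_eq_square mult.assoc)
qed

section \<open>Analytic fields along holomorphic curves\<close>

definition holo_curve :: "complex set \<Rightarrow> (complex \<Rightarrow> cvec) \<Rightarrow> bool" where
  "holo_curve U c \<longleftrightarrow> (\<forall>k. (\<lambda>\<tau>. c \<tau> k) holomorphic_on U)"

lemma power_series_term_bound:
  fixes w z :: cvec
  assumes "\<And>j. j < D \<Longrightarrow> cmod (w j - z j) \<le> r" "0 \<le> r"
  shows "cmod (c * (\<Prod>j<D. (w j - z j) ^ \<alpha> j)) \<le> cmod (c * (\<Prod>j<D. of_real r ^ \<alpha> j))"
  using assms
  by (auto simp: norm_mult norm_power prod_norm [symmetric] intro!: mult_left_mono prod_mono power_mono)

text \<open>The series converges at the corner z + r(1, ..., 1) of the polydisc, and for complex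
  families unconditional summability is absolute summability. The terms at this corner dominate
  those on the closed polydisc of radius r.\<close>

lemma power_series_abs_summable:
  fixes c :: "(nat \<Rightarrow> nat) \<Rightarrow> complex"
  assumes "z \<in> cspace D" "0 < r" "r < \<rho>"
    and "\<And>w. w \<in> vball D z \<rho> \<Longrightarrow>
      ((\<lambda>\<alpha>. c \<alpha> * (\<Prod>j<D. (w j - z j) ^ \<alpha> j)) has_sum G w) {\<alpha>. \<forall>j\<ge>D. \<alpha> j = 0}"
  shows "(\<lambda>\<alpha>. cmod (c \<alpha> * (\<Prod>j<D. of_real r ^ \<alpha> j))) summable_on {\<alpha>. \<forall>j\<ge>D. \<alpha> j = 0}"
proof -
  define w where "w = (\<lambda>j. if j < D then z j + of_real r else 0)"
  have "w \<in> vball D z \<rho>"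
    using assms(1-3) by (auto simp: vball_def w_def cspace_def intro!: vnorm_lessI)
  from assms(4) [OF this]
  have "(\<lambda>\<alpha>. c \<alpha> * (\<Prod>j<D. (w j - z j) ^ \<alpha> j)) summable_on {\<alpha>. \<forall>j\<ge>D. \<alpha> j = 0}"
    by (rule has_sum_imp_summable)
  also have "(\<lambda>\<alpha>. c \<alpha> * (\<Prod>j<D. (w j - z j) ^ \<alpha> j)) = (\<lambda>\<alpha>. c \<alpha> * (\<Prod>j<D. of_real r ^ \<alpha> j))"
    by (auto simp: w_def intro!: ext prod.cong)
  finally show ?thesis
    by (subst (asm) summable_on_iff_abs_summable_on_complex)
qed

lemma holo_curve_near:
  assumes "open U" "\<tau>0 \<in> U" "holo_curve U c" "0 < r"
  obtains \<epsilon> where "0 < \<epsilon>" "cball \<tau>0 \<epsilon> \<subseteq> U"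
    "\<And>\<tau> j. \<tau> \<in> cball \<tau>0 \<epsilon> \<Longrightarrow> j < D \<Longrightarrow> cmod (c \<tau> j - c \<tau>0 j) \<le> r"
proof -
  have "\<forall>\<^sub>F \<tau> in nhds \<tau>0. \<forall>j\<in>{..<D}. dist (c \<tau> j) (c \<tau>0 j) < r"
  proof (rule eventually_ball_finite)
    show "\<forall>j\<in>{..<D}. \<forall>\<^sub>F \<tau> in nhds \<tau>0. dist (c \<tau> j) (c \<tau>0 j) < r"
    proof
      fix j
      have "isCont (\<lambda>\<tau>. c \<tau> j) \<tau>0"
        using assms unfolding holo_curve_def
        by (metis continuous_on_eq_continuous_at holomorphic_on_imp_continuous_on)
      then have "((\<lambda>\<tau>. c \<tau> j) \<longlongrightarrow> c \<tau>0 j) (nhds \<tau>0)"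
        unfolding continuous_at by (subst (asm) tendsto_at_iff_tendsto_nhds)
      then show "\<forall>\<^sub>F \<tau> in nhds \<tau>0. dist (c \<tau> j) (c \<tau>0 j) < r"
        using assms(4) by (rule tendstoD)
    qed
  qed simp
  moreover have "\<forall>\<^sub>F \<tau> in nhds \<tau>0. \<tau> \<in> U"
    using assms(1,2) by (rule eventually_nhds_in_open)
  ultimately have "\<forall>\<^sub>F \<tau> in nhds \<tau>0. \<tau> \<in> U \<and> (\<forall>j\<in>{..<D}. dist (c \<tau> j) (c \<tau>0 j) < r)"
    by eventually_elim auto
  then obtain e where "0 < e" and
    e: "\<And>\<tau>. dist \<tau> \<tau>0 < e \<Longrightarrow> \<tau> \<in> U \<and> (\<forall>j\<in>{..<D}. dist (c \<tau> j) (c \<tau>0 j) < r)"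
    unfolding eventually_nhds_metric by blast
  show thesis
  proof (rule that [of "e / 2"])
    show "cball \<tau>0 (e / 2) \<subseteq> U"
      using e \<open>0 < e\<close> by (auto simp: dist_commute)
    show "cmod (c \<tau> j - c \<tau>0 j) \<le> r" if "\<tau> \<in> cball \<tau>0 (e / 2)" "j < D" for \<tau> j
    proof -
      have "dist \<tau> \<tau>0 < e" using that \<open>0 < e\<close> by (simp add: dist_commute)
      then show ?thesis using e that(2) by (force simp: dist_norm)
    qed
  qed (use \<open>0 < e\<close> in auto)
qed

text \<open>Along the curve the partial sums of the power series are holomorphic. The absolutely
  convergent series at half the radius majorises them, so the Weierstrass test gives a locally
  uniform limit.\<close>

lemma analytic_holo_curve:
  assumes g: "field_analytic_on D g S" and S: "S \<subseteq> cspace D" and U: "open U"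
    and cS: "\<And>\<tau>. \<tau> \<in> U \<Longrightarrow> c \<tau> \<in> S" and c: "holo_curve U c"
  shows "holo_curve U (\<lambda>\<tau>. g (c \<tau>))"
  unfolding holo_curve_def
proof
  fix k
  have "(\<lambda>\<tau>. g (c \<tau>) k) field_differentiable at \<tau>0" if \<tau>0: "\<tau>0 \<in> U" for \<tau>0
  proof -
    obtain \<rho> C where "0 < \<rho>" and C: "\<And>w. w \<in> vball D (c \<tau>0) \<rho> \<Longrightarrow> g w \<in> cspace D \<and>
        (\<forall>k<D. ((\<lambda>\<alpha>. C k \<alpha> * (\<Prod>j<D. (w j - c \<tau>0 j) ^ \<alpha> j)) has_sum g w k) {\<alpha>. \<forall>j\<ge>D. \<alpha> j = 0})"
      using bspec [OF g [unfolded field_analytic_on_def] cS [OF \<tau>0]] by blast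
    obtain \<epsilon> where \<epsilon>: "0 < \<epsilon>" "cball \<tau>0 \<epsilon> \<subseteq> U"
      and near: "\<And>\<tau> j. \<tau> \<in> cball \<tau>0 \<epsilon> \<Longrightarrow> j < D \<Longrightarrow> cmod (c \<tau> j - c \<tau>0 j) \<le> \<rho> / 2"
      using holo_curve_near [OF U \<tau>0 c, of "\<rho> / 2" D] \<open>0 < \<rho>\<close> by auto
    have in_ball: "c \<tau> \<in> vball D (c \<tau>0) \<rho>" if "\<tau> \<in> cball \<tau>0 \<epsilon>" for \<tau>
    proof -
      have "c \<tau> \<in> cspace D" using cS \<epsilon> that S by blast
      moreover have "cmod (c \<tau> j - c \<tau>0 j) < \<rho>" if "j < D" for j
        using near [OF \<open>\<tau> \<in> cball \<tau>0 \<epsilon>\<close> that] \<open>0 < \<rho>\<close> by linarith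
      ultimately show ?thesis using \<open>0 < \<rho>\<close> by (simp add: vball_def vnorm_less_iff)
    qed
    have "(\<lambda>\<tau>. g (c \<tau>) k) holomorphic_on ball \<tau>0 \<epsilon>"
    proof (cases "k < D")
      case False
      have "(\<lambda>\<tau>. 0) holomorphic_on ball \<tau>0 \<epsilon>" by simp
      then show ?thesis
        proof (rule holomorphic_transform)
          fix \<tau> assume "\<tau> \<in> ball \<tau>0 \<epsilon>"
          then have "\<tau> \<in> cball \<tau>0 \<epsilon>" using ball_subset_cball by blast
          then show "0 = g (c \<tau>) k" using C [OF in_ball] False by (simp add: cspace_def)
        qed
    next
      case True
      define f where "f = (\<lambda>\<alpha> \<tau>. C k \<alpha> * (\<Prod>j<D. (c \<tau> j - c \<tau>0 j) ^ \<alpha> j))"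
      have f_hol: "f \<alpha> holomorphic_on U" for \<alpha>
        using c unfolding f_def holo_curve_def by (auto intro!: holomorphic_intros)
      have ul: "uniform_limit (cball \<tau>0 \<epsilon>) (\<lambda>X \<tau>. \<Sum>\<alpha>\<in>X. f \<alpha> \<tau>) (\<lambda>\<tau>. g (c \<tau>) k)
          (finite_subsets_at_top {\<alpha>. \<forall>j\<ge>D. \<alpha> j = 0})"
      proof (rule Weierstrass_m_test_general')
        show "(\<lambda>\<alpha>. cmod (C k \<alpha> * (\<Prod>j<D. of_real (\<rho> / 2) ^ \<alpha> j))) summable_on {\<alpha>. \<forall>j\<ge>D. \<alpha> j = 0}"
          by (rule power_series_abs_summable [where G = "\<lambda>w. g w k" and z = "c \<tau>0" and \<rho> = \<rho>])
             (use C True \<open>0 < \<rho>\<close> cS [OF \<tau>0] S in auto)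
        show "((\<lambda>\<alpha>. f \<alpha> \<tau>) has_sum g (c \<tau>) k) {\<alpha>. \<forall>j\<ge>D. \<alpha> j = 0}" if "\<tau> \<in> cball \<tau>0 \<epsilon>" for \<tau>
          using C [OF in_ball [OF that]] True by (simp add: f_def)
        show "norm (f \<alpha> \<tau>) \<le> cmod (C k \<alpha> * (\<Prod>j<D. of_real (\<rho> / 2) ^ \<alpha> j))"
          if "\<tau> \<in> cball \<tau>0 \<epsilon>" for \<alpha> \<tau>
          unfolding f_def by (rule power_series_term_bound) (use near that \<open>0 < \<rho>\<close> in auto)
      qed
      have "\<forall>\<^sub>F X in finite_subsets_at_top {\<alpha>. \<forall>j\<ge>D. \<alpha> j = 0}.
          continuous_on (cball \<tau>0 \<epsilon>) (\<lambda>\<tau>. \<Sum>\<alpha>\<in>X. f \<alpha> \<tau>) \<and>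
          (\<lambda>\<tau>. \<Sum>\<alpha>\<in>X. f \<alpha> \<tau>) holomorphic_on ball \<tau>0 \<epsilon>"
      proof (intro always_eventually allI conjI)
        fix X
        have *: "(\<lambda>\<tau>. \<Sum>\<alpha>\<in>X. f \<alpha> \<tau>) holomorphic_on U"
          by (intro holomorphic_intros f_hol)
        show "continuous_on (cball \<tau>0 \<epsilon>) (\<lambda>\<tau>. \<Sum>\<alpha>\<in>X. f \<alpha> \<tau>)"
          using * \<epsilon>(2) continuous_on_subset holomorphic_on_imp_continuous_on by blast
        show "(\<lambda>\<tau>. \<Sum>\<alpha>\<in>X. f \<alpha> \<tau>) holomorphic_on ball \<tau>0 \<epsilon>"
          using * by (rule holomorphic_on_subset) (use \<epsilon> ball_subset_cball in blast)
      qed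
      from holomorphic_uniform_limit [OF this ul] show ?thesis by auto
    qed
    then show ?thesis using \<epsilon>(1)
      by (meson centre_in_ball holomorphic_on_imp_differentiable_at open_ball)
  qed
  then show "(\<lambda>\<tau>. g (c \<tau>) k) holomorphic_on U"
    using field_differentiable_at_within holomorphic_on_def by blast
qed

text \<open>On a line the power series can be differentiated term by term, and at the base point
  only multi-indices of degree 1 survive. This ties the coordinatewise \<open>partial_deriv\<close>
  of the Newton step to a genuine directional derivative.\<close>

lemma analytic_directional_derivative:
  assumes g: "field_analytic_on D g S" and S: "S \<subseteq> cspace D" and z: "z \<in> S"
    and k: "k < D" and d: "d \<in> cspace D"
  shows "((\<lambda>\<tau>. g (\<lambda>j. z j + \<tau> * d j) k) has_field_derivative
           (\<Sum>l<D. partial_deriv g z k l * d l)) (at 0)"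
proof -
  obtain \<rho> C where "0 < \<rho>" and C: "\<And>w. w \<in> vball D z \<rho> \<Longrightarrow>
        ((\<lambda>\<alpha>. C \<alpha> * (\<Prod>j<D. (w j - z j) ^ \<alpha> j)) has_sum g w k) {\<alpha>. \<forall>j\<ge>D. \<alpha> j = 0}"
    using bspec [OF g [unfolded field_analytic_on_def] z] k by blast
  define unit :: "nat \<Rightarrow> nat \<Rightarrow> nat" where "unit = (\<lambda>l j. if j = l then 1 else 0)"
  let ?A = "{\<alpha>. \<forall>j\<ge>D. \<alpha> j = (0::nat)}"
  have main: "((\<lambda>\<tau>. g (\<lambda>j. z j + \<tau> * d j) k) has_field_derivative (\<Sum>l<D. C (unit l) * d l)) (at 0)"
    if d: "d \<in> cspace D" for d
  proof -
    have lin: "holo_curve UNIV (\<lambda>\<tau> j. z j + \<tau> * d j)"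
      by (auto simp: holo_curve_def intro!: holomorphic_intros)
    obtain \<epsilon> where \<epsilon>: "0 < \<epsilon>"
      and near: "\<And>\<tau> j. \<tau> \<in> cball 0 \<epsilon> \<Longrightarrow> j < D \<Longrightarrow> cmod ((z j + \<tau> * d j) - (z j + 0 * d j)) \<le> \<rho> / 2"
      using holo_curve_near [OF open_UNIV UNIV_I lin, of "\<rho> / 2" 0 D] \<open>0 < \<rho>\<close> by auto
    have in_ball: "(\<lambda>j. z j + \<tau> * d j) \<in> vball D z \<rho>" if "\<tau> \<in> cball 0 \<epsilon>" for \<tau>
    proof -
      have "z \<in> cspace D" using z S by blast
      then have "(\<lambda>j. z j + \<tau> * d j) \<in> cspace D" using d by (simp add: cspace_def)
      moreover have "cmod (z j + \<tau> * d j - z j) < \<rho>" if "j < D" for j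
        using near [OF \<open>\<tau> \<in> cball 0 \<epsilon>\<close> that] \<open>0 < \<rho>\<close> by simp
      ultimately show ?thesis using \<open>0 < \<rho>\<close> by (simp add: vball_def vnorm_less_iff)
    qed
    define f where "f = (\<lambda>\<alpha> \<tau>. C \<alpha> * (\<Prod>j<D. (\<tau> * d j) ^ \<alpha> j))"
    define f' where "f' = (\<lambda>\<alpha> \<tau>. C \<alpha> * (\<Prod>j<D. d j ^ \<alpha> j) *
        (of_nat (\<Sum>j<D. \<alpha> j) * \<tau> ^ ((\<Sum>j<D. \<alpha> j) - 1)))"
    have f_eq: "f \<alpha> \<tau> = C \<alpha> * (\<Prod>j<D. d j ^ \<alpha> j) * \<tau> ^ (\<Sum>j<D. \<alpha> j)" for \<alpha> \<tau>
      by (simp add: f_def power_mult_distrib prod.distrib power_sum)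
    have f': "(f \<alpha> has_field_derivative f' \<alpha> \<tau>) (at \<tau>)" for \<alpha> \<tau>
      unfolding f_eq [abs_def] f'_def by (auto intro!: derivative_eq_intros)
    have ul: "uniform_limit (cball 0 \<epsilon>) (\<lambda>X \<tau>. \<Sum>\<alpha>\<in>X. f \<alpha> \<tau>) (\<lambda>\<tau>. g (\<lambda>j. z j + \<tau> * d j) k)
        (finite_subsets_at_top ?A)"
    proof (rule Weierstrass_m_test_general')
      show "(\<lambda>\<alpha>. cmod (C \<alpha> * (\<Prod>j<D. of_real (\<rho> / 2) ^ \<alpha> j))) summable_on ?A"
        by (rule power_series_abs_summable [where G = "\<lambda>w. g w k" and z = z and \<rho> = \<rho>])
           (use C \<open>0 < \<rho>\<close> z S in auto)
      show "((\<lambda>\<alpha>. f \<alpha> \<tau>) has_sum g (\<lambda>j. z j + \<tau> * d j) k) ?A" if "\<tau> \<in> cball 0 \<epsilon>" for \<tau>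
        using C [OF in_ball [OF that]] by (simp add: f_def)
      show "norm (f \<alpha> \<tau>) \<le> cmod (C \<alpha> * (\<Prod>j<D. of_real (\<rho> / 2) ^ \<alpha> j))"
        if "\<tau> \<in> cball 0 \<epsilon>" for \<alpha> \<tau>
        using power_series_term_bound [of D "\<lambda>j. z j + \<tau> * d j" z "\<rho> / 2" "C \<alpha>" \<alpha>] near that \<open>0 < \<rho>\<close>
        by (auto simp: f_def)
    qed
    have "\<forall>\<^sub>F X in finite_subsets_at_top ?A.
        continuous_on (cball 0 \<epsilon>) (\<lambda>\<tau>. \<Sum>\<alpha>\<in>X. f \<alpha> \<tau>) \<and>
        (\<forall>\<tau>\<in>ball 0 \<epsilon>. ((\<lambda>\<tau>. \<Sum>\<alpha>\<in>X. f \<alpha> \<tau>) has_field_derivative (\<Sum>\<alpha>\<in>X. f' \<alpha> \<tau>)) (at \<tau>))"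
    proof (intro always_eventually allI conjI ballI)
      fix X
      have cont: "continuous_on (cball 0 \<epsilon>) (f \<alpha>)" for \<alpha>
        by (rule DERIV_continuous_on, rule has_field_derivative_at_within, rule f')
      show "continuous_on (cball 0 \<epsilon>) (\<lambda>\<tau>. \<Sum>\<alpha>\<in>X. f \<alpha> \<tau>)"
        by (intro continuous_on_sum cont)
      show "((\<lambda>\<tau>. \<Sum>\<alpha>\<in>X. f \<alpha> \<tau>) has_field_derivative (\<Sum>\<alpha>\<in>X. f' \<alpha> \<tau>)) (at \<tau>)" for \<tau>
        by (intro DERIV_sum f')
    qed
    from has_complex_derivative_uniform_limit [OF this ul _ \<epsilon>]
    obtain g' where
      g': "\<And>\<tau>. \<tau> \<in> ball 0 \<epsilon> \<Longrightarrow> ((\<lambda>\<tau>. g (\<lambda>j. z j + \<tau> * d j) k) has_field_derivative g' \<tau>) (at \<tau>) \<and>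
         ((\<lambda>X. \<Sum>\<alpha>\<in>X. f' \<alpha> \<tau>) \<longlongrightarrow> g' \<tau>) (finite_subsets_at_top ?A)"
      by auto
    have inj: "inj_on unit {..<D}"
      by (rule inj_onI) (metis unit_def zero_neq_one)
    have f'0: "f' (unit l) 0 = C (unit l) * d l" if "l < D" for l
    proof -
      have "(\<Sum>j<D. unit l j) = 1" using that by (simp add: unit_def)
      moreover have "(\<Prod>j<D. d j ^ unit l j) = (\<Prod>j<D. if j = l then d j else 1)"
        by (intro prod.cong) (auto simp: unit_def)
      ultimately show ?thesis using that by (simp add: f'_def flip: of_nat_sum)
    qed
    \<comment> \<open>Degree 0 is killed by the factor \<open>of_nat 0\<close>, although the
      truncated exponent \<open>0 - 1\<close> gives the power 1; degrees above 1 are killed by the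
      power of 0.\<close>
    have f'0_zero: "f' \<alpha> 0 = 0" if "\<alpha> \<in> ?A" "\<alpha> \<notin> unit ` {..<D}" for \<alpha>
    proof (rule ccontr)
      assume "f' \<alpha> 0 \<noteq> 0"
      moreover define n where "n = (\<Sum>j<D. \<alpha> j)"
      ultimately have "n \<noteq> 0" "n - 1 = 0"
        unfolding f'_def n_def [symmetric] by (auto simp: power_0_left split: if_splits)
      then have s1: "(\<Sum>j<D. \<alpha> j) = 1" unfolding n_def by linarith
      then obtain l where l: "l < D" "\<alpha> l = 1" "\<forall>j\<in>{..<D}. l \<noteq> j \<longrightarrow> \<alpha> j = 0"
        using sum_eq_1_iff [of "{..<D}" \<alpha>] by auto
      then have "\<alpha> = unit l"
        using that(1) l by (auto simp: unit_def fun_eq_iff) (metis lessThan_iff not_le)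
      then show False using that(2) l(1) by auto
    qed
    have "\<forall>\<^sub>F X in finite_subsets_at_top ?A. (\<Sum>\<alpha>\<in>X. f' \<alpha> 0) = (\<Sum>l<D. C (unit l) * d l)"
      unfolding eventually_finite_subsets_at_top
    proof (intro exI conjI allI impI)
      show "finite (unit ` {..<D})" by simp
      show "unit ` {..<D} \<subseteq> ?A" by (auto simp: unit_def)
      fix X assume X: "finite X \<and> unit ` {..<D} \<subseteq> X \<and> X \<subseteq> ?A"
      have "(\<Sum>\<alpha>\<in>X. f' \<alpha> 0) = (\<Sum>\<alpha>\<in>unit ` {..<D}. f' \<alpha> 0)"
        by (rule sum.mono_neutral_right) (use X f'0_zero in auto)
      also have "\<dots> = (\<Sum>l<D. C (unit l) * d l)"
        by (subst sum.reindex [OF inj]) (simp add: f'0)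
      finally show "(\<Sum>\<alpha>\<in>X. f' \<alpha> 0) = (\<Sum>l<D. C (unit l) * d l)" .
    qed
    then have "((\<lambda>X. \<Sum>\<alpha>\<in>X. f' \<alpha> 0) \<longlongrightarrow> (\<Sum>l<D. C (unit l) * d l)) (finite_subsets_at_top ?A)"
      by (rule tendsto_eventually)
    then have "g' 0 = (\<Sum>l<D. C (unit l) * d l)"
      using g' [of 0] \<epsilon> tendsto_unique [OF finite_subsets_at_top_neq_bot] by auto
    then show ?thesis using g' [of 0] \<epsilon> by auto
  qed
  \<comment> \<open>The formula just proved, in the direction of the l-th basis vector, identifies
    the coefficient as a partial derivative.\<close>
  have "partial_deriv g z k l = C (unit l)" if l: "l < D" for l
  proof -
    define e :: cvec where "e = (\<lambda>j. if j = l then 1 else 0)"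
    have "e \<in> cspace D" using l by (auto simp: e_def cspace_def)
    from main [OF this]
    have "((\<lambda>\<tau>. g (\<lambda>j. z j + \<tau> * e j) k) has_field_derivative (\<Sum>i<D. C (unit i) * e i)) (at 0)" .
    moreover have "(\<lambda>j. z j + \<tau> * e j) = z(l := \<tau> + z l)" for \<tau>
      by (auto simp: e_def)
    moreover have "(\<Sum>i<D. C (unit i) * e i) = C (unit l)"
      using l by (simp add: e_def if_distrib cong: if_cong)
    ultimately have "((\<lambda>\<tau>. g (z(l := \<tau> + z l)) k) has_field_derivative C (unit l)) (at 0)"
      by simp
    then have "((\<lambda>t. g (z(l := t)) k) has_field_derivative C (unit l)) (at (z l))"
      using DERIV_shift [of "\<lambda>t. g (z(l := t)) k" "C (unit l)" 0 "z l"] by simp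
    then show ?thesis
      unfolding partial_deriv_def by (rule DERIV_imp_deriv)
  qed
  then show ?thesis using main [OF d] by simp
qed

section \<open>Holomorphic maps and contractions\<close>

text \<open>Banach's argument for the sup distance over all indices. The index type is left open
  because it stands for stages in the implicit equations and for times in the integral equation of
  the flow. The rate of the iterates is part of the conclusion so that limits can be shown to be
  uniform in a parameter.\<close>

lemma contraction_fixed_point:
  fixes N :: "('a \<Rightarrow> nat \<Rightarrow> complex) \<Rightarrow> 'a \<Rightarrow> nat \<Rightarrow> complex"
  assumes w0: "w0 \<in> S" and N: "\<And>w. w \<in> S \<Longrightarrow> N w \<in> S"
    and closed: "\<And>X w. (\<And>n. X n \<in> S) \<Longrightarrow> (\<And>i k. (\<lambda>n. X n i k) \<longlonglongrightarrow> w i k) \<Longrightarrow> w \<in> S"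
    and contr: "\<And>w w' B i k. w \<in> S \<Longrightarrow> w' \<in> S \<Longrightarrow> (\<And>i k. cmod (w i k - w' i k) \<le> B)
      \<Longrightarrow> cmod (N w i k - N w' i k) \<le> B / 2"
    and bd: "\<And>w w' i k. w \<in> S \<Longrightarrow> w' \<in> S \<Longrightarrow> cmod (w i k - w' i k) \<le> C"
  obtains w where "w \<in> S" "N w = w" "\<And>n i k. cmod ((N ^^ n) w0 i k - w i k) \<le> C / 2 ^ n"
proof -
  have iter: "(N ^^ n) u \<in> S" if "u \<in> S" for n u
    using that by (induction n) (auto intro: N)
  have step: "cmod ((N ^^ n) u i k - (N ^^ n) v i k) \<le> C / 2 ^ n" if "u \<in> S" "v \<in> S" for n u v i k
  proof (induction n arbitrary: i k)
    case 0
    then show ?case using bd that by simp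
  next
    case (Suc n)
    from contr [OF iter [OF that(1)] iter [OF that(2)] Suc.IH]
    show ?case by (simp add: mult.commute)
  qed
  define X where "X = (\<lambda>n. (N ^^ n) w0)"
  have X: "X n \<in> S" for n using iter w0 by (simp add: X_def)
  have dist: "cmod (X n i k - X (n + j) i k) \<le> C / 2 ^ n" for n j i k
    using step [OF w0 iter [OF w0], of n i k j] by (simp add: X_def funpow_add)
  have C0: "0 \<le> C" using bd [OF w0 w0] by simp
  have lim0: "(\<lambda>n. C / 2 ^ n) \<longlonglongrightarrow> 0"
    using LIMSEQ_divide_realpow_zero [of 2 C] by simp
  have "\<exists>l. (\<lambda>n. X n i k) \<longlonglongrightarrow> l" for i k
  proof -
    have "Cauchy (\<lambda>n. X n i k)"
    proof (rule metric_CauchyI)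
      fix e :: real assume "0 < e"
      then obtain M where M: "C / 2 ^ M < e / 2"
        using order_tendstoD(2) [OF lim0, of "e / 2"] by (auto simp: eventually_sequentially)
      have "dist (X n i k) (X n' i k) < e" if "n \<ge> M" "n' \<ge> M" for n n'
      proof -
        have "dist (X n i k) (X M i k) \<le> C / 2 ^ M" "dist (X n' i k) (X M i k) \<le> C / 2 ^ M"
          using dist [of M i k "n - M"] dist [of M i k "n' - M"] that
          by (simp_all add: dist_norm norm_minus_commute)
        then show ?thesis using M dist_triangle2 [of "X n i k" "X n' i k" "X M i k"] by linarith
      qed
      then show "\<exists>M. \<forall>m\<ge>M. \<forall>n\<ge>M. dist (X m i k) (X n i k) < e" by blast
    qed
    then show ?thesis using Cauchy_convergent convergent_def by blast
  qed
  then obtain w where w: "\<And>i k. (\<lambda>n. X n i k) \<longlonglongrightarrow> w i k" by metis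
  have wS: "w \<in> S" by (rule closed [OF X w])
  have err: "cmod (X n i k - w i k) \<le> C / 2 ^ n" for n i k
  proof (rule tendsto_upperbound)
    show "(\<lambda>j. cmod (X n i k - X (n + j) i k)) \<longlonglongrightarrow> cmod (X n i k - w i k)"
      using LIMSEQ_ignore_initial_segment [OF w [of i k], of n]
      by (auto intro!: tendsto_intros simp: add.commute)
  qed (use dist in auto)
  have "N w i k = w i k" for i k
  proof -
    have "(\<lambda>n. X (Suc n) i k) \<longlonglongrightarrow> N w i k"
    proof (rule LIM_zero_cancel, rule tendsto_norm_zero_cancel,
        rule tendsto_sandwich [where f = "\<lambda>_. 0"])
      show "\<forall>\<^sub>F n in sequentially. cmod (X (Suc n) i k - N w i k) \<le> C / 2 ^ n / 2"
      proof (rule always_eventually, rule allI)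
        fix n
        show "cmod (X (Suc n) i k - N w i k) \<le> C / 2 ^ n / 2"
          using contr [OF X wS err, of n i k] by (simp add: X_def)
      qed
      show "(\<lambda>n. C / 2 ^ n / 2) \<longlonglongrightarrow> 0"
        using tendsto_divide [OF lim0 tendsto_const [of 2]] by simp
    qed auto
    moreover have "(\<lambda>n. X (Suc n) i k) \<longlonglongrightarrow> w i k"
      by (rule LIMSEQ_Suc [OF w])
    ultimately show ?thesis by (rule LIMSEQ_unique)
  qed
  then have "N w = w" by blast
  then show thesis by (rule that [OF wS _ err [unfolded X_def]])
qed

text \<open>Holomorphy of a map is tested on holomorphic curves only. The notion composes trivially
  and reduces each estimate to one complex variable, whatever the dimension.\<close>

definition holo_map :: "cvec set \<Rightarrow> (cvec \<Rightarrow> cvec) \<Rightarrow> bool" where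
  "holo_map S G \<longleftrightarrow> (\<forall>U c. open U \<longrightarrow> (\<forall>\<tau>\<in>U. c \<tau> \<in> S) \<longrightarrow> holo_curve U c
     \<longrightarrow> holo_curve U (\<lambda>\<tau>. G (c \<tau>)))"

lemma holo_mapD:
  "holo_map S G \<Longrightarrow> open U \<Longrightarrow> (\<And>\<tau>. \<tau> \<in> U \<Longrightarrow> c \<tau> \<in> S) \<Longrightarrow> holo_curve U c
    \<Longrightarrow> holo_curve U (\<lambda>\<tau>. G (c \<tau>))"
  unfolding holo_map_def by blast

lemma holo_map_subset: "holo_map S G \<Longrightarrow> T \<subseteq> S \<Longrightarrow> holo_map T G"
  unfolding holo_map_def by blast

lemma holo_curve_uniform_limit:
  assumes "open U" "\<And>n. holo_curve U (c n)" "e \<longlonglongrightarrow> 0"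
    and "\<And>n \<tau> k. \<tau> \<in> U \<Longrightarrow> cmod (c n \<tau> k - c' \<tau> k) \<le> e n"
  shows "holo_curve U c'"
  unfolding holo_curve_def
proof
  fix k
  show "(\<lambda>\<tau>. c' \<tau> k) holomorphic_on U"
  proof (rule holomorphic_uniform_sequence [OF assms(1)])
    show "(\<lambda>\<tau>. c n \<tau> k) holomorphic_on U" for n
      using assms(2) by (simp add: holo_curve_def)
    fix \<tau>0 assume "\<tau>0 \<in> U"
    then obtain d where d: "0 < d" "cball \<tau>0 d \<subseteq> U"
      using assms(1) open_contains_cball by blast
    have "uniform_limit (cball \<tau>0 d) (\<lambda>n \<tau>. c n \<tau> k) (\<lambda>\<tau>. c' \<tau> k) sequentially"
    proof (rule uniform_limitI)
      fix \<epsilon> :: real assume "0 < \<epsilon>"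
      then have "\<forall>\<^sub>F n in sequentially. e n < \<epsilon>"
        using order_tendstoD(2) [OF assms(3)] by blast
      then show "\<forall>\<^sub>F n in sequentially. \<forall>\<tau>\<in>cball \<tau>0 d. dist (c n \<tau> k) (c' \<tau> k) < \<epsilon>"
      proof eventually_elim
        case (elim n)
        have "dist (c n \<tau> k) (c' \<tau> k) < \<epsilon>" if "\<tau> \<in> cball \<tau>0 d" for \<tau>
          using assms(4) [of \<tau> n k] elim d(2) that by (auto simp: dist_norm)
        then show ?case by blast
      qed
    qed
    then show "\<exists>d>0. cball \<tau>0 d \<subseteq> U \<and> uniform_limit (cball \<tau>0 d) (\<lambda>n \<tau>. c n \<tau> k) (\<lambda>\<tau>. c' \<tau> k) sequentially"
      using d by blast
  qed
qed

text \<open>The points with room t inside \<open>S\<close>. Every construction spends some of this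
  room: a displacement by u lowers it from t + u to t (\<open>inset_shift\<close>).\<close>

definition inset :: "nat \<Rightarrow> cvec set \<Rightarrow> real \<Rightarrow> cvec set" where
  "inset D S t = {z \<in> cspace D. vball D z t \<subseteq> S}"

lemma inset_cspace: "z \<in> inset D S t \<Longrightarrow> z \<in> cspace D"
  by (simp add: inset_def)

lemma inset_memD: "z \<in> inset D S t \<Longrightarrow> w \<in> cspace D \<Longrightarrow> vdist D w z < t \<Longrightarrow> w \<in> S"
  by (auto simp: inset_def vball_iff)

lemma inset_subset: "0 < t \<Longrightarrow> inset D S t \<subseteq> S"
  using inset_memD inset_cspace by fastforce

lemma inset_shift:
  assumes "z \<in> inset D S t'" "w \<in> cspace D" "vdist D w z \<le> u" "t + u \<le> t'"
  shows "w \<in> inset D S t"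
  unfolding inset_def
proof (clarify, intro conjI subsetI)
  fix v assume v: "v \<in> vball D w t"
  have "vdist D v z \<le> vdist D v w + vdist D w z" by (rule vdist_triangle)
  also have "\<dots> < t'" using v assms(3,4) by (auto simp: vball_iff)
  finally show "v \<in> S" using inset_memD [OF assms(1)] v by (auto simp: vball_iff)
qed (use assms in auto)

lemma inset_vball: "z \<in> vball D x r \<Longrightarrow> z \<in> inset D (vball D x (r + t)) t"
  unfolding inset_def
proof (clarify, intro conjI subsetI)
  assume z: "z \<in> vball D x r"
  then show "z \<in> cspace D" by (simp add: vball_iff)
  fix v assume v: "v \<in> vball D z t"
  then show "v \<in> vball D x (r + t)"
    using z vdist_triangle [of D v x z] by (auto simp: vball_iff)
qed

lemma inset_vball_center: "x \<in> cspace D \<Longrightarrow> x \<in> inset D (vball D x r) r"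
  by (auto simp: inset_def)

lemma cspace_eqI:
  assumes "x \<in> cspace D" "y \<in> cspace D" "vdist D x y \<le> 0"
  shows "x = y"
proof
  fix k
  show "x k = y k"
  proof (cases "k < D")
    case True
    have "cmod (x k - y k) \<le> 0" using assms(3) cmod_le_vdist [OF True, of x y] by linarith
    then show ?thesis by simp
  qed (use assms in \<open>simp add: cspace_def\<close>)
qed

lemma vdist_limit_le:
  assumes u: "\<And>k. (\<lambda>n. u n k) \<longlonglongrightarrow> u' k" and v: "\<And>k. (\<lambda>n. v n k) \<longlonglongrightarrow> v' k"
    and le: "\<And>n. vdist D (u n) (v n) \<le> c"
  shows "vdist D u' v' \<le> c"
proof (rule vdist_leI)
  show "0 \<le> c" using le vdist_nonneg order_trans by blast
  fix k assume k: "k < D"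
  show "cmod (u' k - v' k) \<le> c"
  proof (rule tendsto_upperbound)
    show "(\<lambda>n. cmod (u n k - v n k)) \<longlonglongrightarrow> cmod (u' k - v' k)"
      by (intro tendsto_intros u v)
    show "\<forall>\<^sub>F n in sequentially. cmod (u n k - v n k) \<le> c"
      by (intro always_eventually allI order_trans [OF cmod_le_vdist [OF k] le])
  qed simp
qed

lemma cspace_limit:
  assumes u: "\<And>k. (\<lambda>n. u n k) \<longlonglongrightarrow> u' k" and "\<And>n. u n \<in> cspace D"
  shows "u' \<in> cspace D"
proof -
  have "u' k = 0" if "D \<le> k" for k
  proof (rule LIMSEQ_unique [OF u])
    show "(\<lambda>n. u n k) \<longlonglongrightarrow> 0" using assms(2) that by (simp add: cspace_def)
  qed
  then show ?thesis by (simp add: cspace_def)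
qed

lemma vdist_line: "vdist D (\<lambda>k. y k + \<tau> * d k) y = cmod \<tau> * vnorm D d"
proof (rule antisym)
  show "vdist D (\<lambda>k. y k + \<tau> * d k) y \<le> cmod \<tau> * vnorm D d"
    by (rule vdist_leI) (auto simp: norm_mult intro!: mult_left_mono cmod_le_vnorm)
  show "cmod \<tau> * vnorm D d \<le> vdist D (\<lambda>k. y k + \<tau> * d k) y"
  proof (cases "\<tau> = 0")
    case False
    have "vnorm D d \<le> vdist D (\<lambda>k. y k + \<tau> * d k) y / cmod \<tau>"
    proof (rule vnorm_leI)
      fix k assume "k < D"
      then have "cmod \<tau> * cmod (d k) \<le> vdist D (\<lambda>k. y k + \<tau> * d k) y"
        using cmod_le_vdist [of k D "\<lambda>k. y k + \<tau> * d k" y] by (simp add: norm_mult)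
      then show "cmod (d k) \<le> vdist D (\<lambda>k. y k + \<tau> * d k) y / cmod \<tau>"
        using False by (simp add: field_simps)
    qed simp
    then show ?thesis using False by (simp add: field_simps)
  qed simp
qed

lemma holo_curve_line: "holo_curve U (\<lambda>\<tau> k. y k + \<tau> * d k)"
  by (auto simp: holo_curve_def intro!: holomorphic_intros)

lemma cspace_line: "y \<in> cspace D \<Longrightarrow> d \<in> cspace D \<Longrightarrow> (\<lambda>k. y k + \<tau> * d k) \<in> cspace D"
  by (simp add: cspace_def)

lemma cspace_diff: "y \<in> cspace D \<Longrightarrow> d \<in> cspace D \<Longrightarrow> (\<lambda>k. y k - d k) \<in> cspace D"
  by (simp add: cspace_def)

text \<open>The Schwarz lemma on the complex line through two points turns a bound on a holomorphic map
  into a Lipschitz constant that does not depend on the dimension.\<close>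

lemma holo_map_lipschitz:
  assumes G: "holo_map S G" and bd: "\<And>z. z \<in> S \<Longrightarrow> vnorm D (G z) \<le> M"
    and y: "y \<in> inset D S r" and r: "0 < r" and y': "y' \<in> S" "y' \<in> cspace D"
  shows "vdist D (G y') (G y) \<le> 2 * M * vdist D y' y / r"
proof -
  have yS: "y \<in> S" "y \<in> cspace D" using y r inset_subset inset_cspace by auto
  have M: "0 \<le> M" using bd [OF yS(1)] vnorm_nonneg order_trans by blast
  define d where "d = (\<lambda>k. y' k - y k)"
  have d: "vnorm D d = vdist D y' y" "d \<in> cspace D"
    using y' yS by (simp_all add: d_def vdist_def cspace_diff)
  have diff: "cmod (G u k - G y k) \<le> 2 * M" if "u \<in> S" "k < D" for u k
  proof -
    have "cmod (G u k - G y k) \<le> cmod (G u k) + cmod (G y k)" by (rule norm_triangle_ineq4)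
    also have "\<dots> \<le> M + M"
      by (intro add_mono order_trans [OF cmod_le_vnorm bd] that yS)
    finally show ?thesis by simp
  qed
  \<comment> \<open>From distance r on the trivial bound 2M suffices. Closer, y' is the parameter 1
    on the complex line through y, which stays in S for all parameters of modulus below
    \<open>r / vdist D y' y\<close>.\<close>
  consider "vdist D y' y = 0" | "r \<le> vdist D y' y" | "0 < vdist D y' y" "vdist D y' y < r"
    using vdist_nonneg [of D y' y] by linarith
  then show ?thesis
  proof cases
    case 1
    then have "y' = y" using cspace_eqI y' yS by simp
    then show ?thesis by simp
  next
    case 2
    have "vdist D (G y') (G y) \<le> 2 * M" using diff y' M by (auto intro!: vdist_leI)
    also have "2 * M \<le> 2 * M * vdist D y' y / r"
      using 2 r M by (simp add: field_simps mult_left_mono)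
    finally show ?thesis .
  next
    case 3
    define R where "R = r / vdist D y' y"
    have R: "1 < R" using 3 r by (simp add: R_def field_simps)
    have in_S: "(\<lambda>k. y k + \<tau> * d k) \<in> S" if "\<tau> \<in> ball 0 R" for \<tau>
    proof (rule inset_memD [OF y cspace_line [OF yS(2) d(2)]])
      show "vdist D (\<lambda>k. y k + \<tau> * d k) y < r"
        using that 3 unfolding vdist_line d R_def by (simp add: field_simps)
    qed
    have hol: "holo_curve (ball 0 R) (\<lambda>\<tau>. G (\<lambda>k. y k + \<tau> * d k))"
      by (rule holo_mapD [OF G _ in_S holo_curve_line]) auto
    show ?thesis
    proof (rule vdist_leI)
      fix k assume k: "k < D"
      have "cmod (G (\<lambda>k. y k + 1 * d k) k - G y k) \<le> 2 * M * (cmod 1 / R)"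
      proof (rule schwarz_first_order [where F = "\<lambda>\<tau>. G (\<lambda>k. y k + \<tau> * d k) k - G y k"])
        show "(\<lambda>\<tau>. G (\<lambda>k. y k + \<tau> * d k) k - G y k) holomorphic_on ball 0 R"
          using hol by (auto simp: holo_curve_def intro!: holomorphic_intros)
      qed (use diff in_S k R in auto)
      moreover have "(\<lambda>k. y k + 1 * d k) = y'" by (simp add: d_def)
      ultimately show "cmod (G y' k - G y k) \<le> 2 * M * vdist D y' y / r"
        using 3 by (simp add: R_def)
    qed (use M r in auto)
  qed
qed

text \<open>\<open>\<rho>\<close> is the room required around a point at which the Schwarz lemma is
  applied to \<open>g\<close>.\<close>

locale bounded_field =
  fixes D :: nat and g :: "cvec \<Rightarrow> cvec" and S :: "cvec set" and m \<rho> :: real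
  assumes analytic: "field_analytic_on D g S"
    and S_cspace: "S \<subseteq> cspace D"
    and g_le: "\<And>z. z \<in> S \<Longrightarrow> vnorm D (g z) \<le> m"
    and m_nonneg: "0 \<le> m" and \<rho>_pos: "0 < \<rho>"
begin

lemma g_cspace: "z \<in> S \<Longrightarrow> g z \<in> cspace D"
proof -
  assume z: "z \<in> S"
  then obtain r where "0 < r" "\<And>w. w \<in> vball D z r \<Longrightarrow> g w \<in> cspace D"
    using bspec [OF analytic [unfolded field_analytic_on_def] z] by blast
  moreover have "z \<in> vball D z r" using z S_cspace \<open>0 < r\<close> by (auto simp: vball_iff)
  ultimately show ?thesis by blast
qed

lemma inner_S: "inset D S \<rho> \<subseteq> S"
  by (rule inset_subset [OF \<rho>_pos])

lemma cmod_g_le: "z \<in> S \<Longrightarrow> cmod (g z k) \<le> m"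
  using g_le [of z] cmod_le_vnorm [of k D "g z"] g_cspace [of z] m_nonneg
  by (cases "k < D") (auto simp: cspace_def)

lemma holo_map_g: "holo_map S g"
  unfolding holo_map_def using analytic_holo_curve [OF analytic S_cspace] by blast

lemma g_lipschitz:
  "y \<in> inset D S \<rho> \<Longrightarrow> y' \<in> S \<Longrightarrow> vdist D (g y') (g y) \<le> 2 * m * vdist D y' y / \<rho>"
  using holo_map_lipschitz [OF holo_map_g g_le _ \<rho>_pos] S_cspace by blast

lemma cmod_g_diff_le:
  "y \<in> inset D S \<rho> \<Longrightarrow> y' \<in> S \<Longrightarrow> cmod (g y' k - g y k) \<le> 2 * m * vdist D y' y / \<rho>"
  using g_lipschitz [of y y'] cmod_le_vdist [of k D "g y'" "g y"] g_cspace [of y] g_cspace [of y']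
    m_nonneg \<rho>_pos inner_S
  by (cases "k < D") (auto simp: cspace_def)

text \<open>The Jacobian applied to a vector. The cut-off at D keeps the value in
  \<open>cspace D\<close>, where equality of vectors is equality of functions.\<close>

definition dg :: "cvec \<Rightarrow> cvec \<Rightarrow> cvec" where
  "dg v d = (\<lambda>k. if k < D then \<Sum>l<D. partial_deriv g v k l * d l else 0)"

lemma dg_diff: "dg v (\<lambda>k. d k - d' k) = (\<lambda>k. dg v d k - dg v d' k)"
  by (auto simp: dg_def sum_subtractf right_diff_distrib)

lemma dg_scale: "dg v (\<lambda>k. c * d k) = (\<lambda>k. c * dg v d k)"
  by (auto simp: dg_def sum_distrib_left mult.left_commute intro!: sum.cong)

lemma dg_derivative:
  assumes "v \<in> S" "d \<in> cspace D"
  shows "((\<lambda>\<tau>. g (\<lambda>j. v j + \<tau> * d j) k) has_field_derivative dg v d k) (at 0)"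
proof (cases "k < D")
  case True
  then show ?thesis
    using analytic_directional_derivative [OF analytic S_cspace assms(1) True assms(2)]
    by (simp add: dg_def)
next
  \<comment> \<open>Beyond the dimension the derivative is that of the zero function, since the
    values of g near v lie in \<open>cspace D\<close>.\<close>
  case False
  obtain r where r: "0 < r" "\<And>w. w \<in> vball D v r \<Longrightarrow> g w \<in> cspace D"
    using bspec [OF analytic [unfolded field_analytic_on_def] assms(1)] by blast
  obtain \<epsilon> where \<epsilon>: "0 < \<epsilon>" and
    near: "\<And>\<tau> j. \<tau> \<in> cball 0 \<epsilon> \<Longrightarrow> j < D \<Longrightarrow> cmod ((v j + \<tau> * d j) - (v j + 0 * d j)) \<le> r / 2"
    using holo_curve_near [OF open_UNIV UNIV_I holo_curve_line, of "r / 2" 0 D v d] \<open>0 < r\<close> by auto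
  have "g (\<lambda>j. v j + \<tau> * d j) k = 0" if \<tau>: "\<tau> \<in> ball 0 \<epsilon>" for \<tau>
  proof -
    have "vdist D (\<lambda>j. v j + \<tau> * d j) v \<le> r / 2"
    proof (rule vdist_leI)
      show "cmod (v j + \<tau> * d j - v j) \<le> r / 2" if "j < D" for j
        using near [of \<tau> j] \<tau> that by simp
    qed (use r in simp)
    then have "(\<lambda>j. v j + \<tau> * d j) \<in> vball D v r"
      using assms S_cspace r by (auto simp: vball_iff cspace_line subset_iff)
    then show ?thesis using r False by (auto simp: cspace_def)
  qed
  have "((\<lambda>\<tau>. g (\<lambda>j. v j + \<tau> * d j) k) has_field_derivative 0) (at 0)"
  proof (rule has_field_derivative_transform_within_open [where S = "ball 0 \<epsilon>", OF DERIV_const])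
    show "0 = g (\<lambda>j. v j + \<tau> * d j) k" if "\<tau> \<in> ball 0 \<epsilon>" for \<tau>
      using \<open>\<And>\<tau>. \<tau> \<in> ball 0 \<epsilon> \<Longrightarrow> g (\<lambda>j. v j + \<tau> * d j) k = 0\<close> [OF that] by simp
  qed (use \<epsilon> in simp_all)
  then show ?thesis using False by (simp add: dg_def)
qed

text \<open>Difference quotients obey the Lipschitz bound of g, which passes to the limit.
  Estimating the partial derivatives one by one and adding up would bring in D.\<close>

lemma dg_le:
  assumes v: "v \<in> inset D S \<rho>" and d: "d \<in> cspace D"
  shows "cmod (dg v d k) \<le> 2 * m * vnorm D d / \<rho>"
proof -
  have vS: "v \<in> S" using v inner_S by blast
  have lim: "((\<lambda>\<tau>. (g (\<lambda>j. v j + \<tau> * d j) k - g (\<lambda>j. v j + 0 * d j) k) / \<tau>) \<longlongrightarrow> dg v d k) (at 0)"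
    using dg_derivative [OF vS d, of k] unfolding DERIV_def by simp
  have "\<forall>\<^sub>F \<tau> in at 0. cmod ((g (\<lambda>j. v j + \<tau> * d j) k - g (\<lambda>j. v j + 0 * d j) k) / \<tau>)
      \<le> 2 * m * vnorm D d / \<rho>"
    unfolding eventually_at
  \<comment> \<open>The summand 1 in the radius covers d = 0.\<close>
  proof (intro exI [of _ "\<rho> / (vnorm D d + 1)"] conjI ballI impI)
    have nd: "0 < vnorm D d + 1" by (simp add: add_nonneg_pos)
    then show "0 < \<rho> / (vnorm D d + 1)" using \<rho>_pos by simp
    fix \<tau> :: complex
    assume \<tau>: "\<tau> \<noteq> 0 \<and> dist \<tau> 0 < \<rho> / (vnorm D d + 1)"
    then have "cmod \<tau> * (vnorm D d + 1) < \<rho>" using nd by (simp add: field_simps)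
    then have "cmod \<tau> * vnorm D d < \<rho>" using norm_ge_zero [of \<tau>] unfolding distrib_left by linarith
    then have "(\<lambda>j. v j + \<tau> * d j) \<in> S"
      using inset_memD [OF v cspace_line [OF inset_cspace [OF v] d]] by (simp add: vdist_line)
    from cmod_g_diff_le [OF v this, of k]
    show "cmod ((g (\<lambda>j. v j + \<tau> * d j) k - g (\<lambda>j. v j + 0 * d j) k) / \<tau>) \<le> 2 * m * vnorm D d / \<rho>"
      using \<tau> by (simp add: vdist_line norm_divide field_simps)
  qed
  then show ?thesis
    by (rule tendsto_upperbound [OF tendsto_norm [OF lim]]) simp
qed

text \<open>The source of Newton's quadratic convergence. On the complex line through v in direction
  d the remainder vanishes to order 2, and inside the margin it is at most 4m: 2m from the increment
  of g and 2m from the linear term.\<close>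

lemma g_second_order:
  assumes v: "v \<in> inset D S \<rho>" and d: "d \<in> cspace D" and vd: "(\<lambda>k. v k + d k) \<in> S"
  shows "cmod (g (\<lambda>k. v k + d k) k - g v k - dg v d k) \<le> 4 * m * (vnorm D d / \<rho>)\<^sup>2"
proof -
  have vS: "v \<in> S" "v \<in> cspace D" using v inner_S S_cspace by auto
  have tri: "cmod (g (\<lambda>k. v k + \<tau> * d k) k - g v k - \<tau> * dg v d k) \<le> 4 * m * (cmod \<tau> * vnorm D d / \<rho>)"
    if "(\<lambda>k. v k + \<tau> * d k) \<in> S" for \<tau>
  proof -
    have "cmod (g (\<lambda>k. v k + \<tau> * d k) k - g v k - \<tau> * dg v d k)
        \<le> cmod (g (\<lambda>k. v k + \<tau> * d k) k - g v k) + cmod (\<tau> * dg v d k)"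
      by (rule norm_triangle_ineq4)
    also have "\<dots> \<le> 2 * m * (cmod \<tau> * vnorm D d) / \<rho> + cmod \<tau> * (2 * m * vnorm D d / \<rho>)"
    proof (rule add_mono)
      show "cmod (g (\<lambda>k. v k + \<tau> * d k) k - g v k) \<le> 2 * m * (cmod \<tau> * vnorm D d) / \<rho>"
        using cmod_g_diff_le [OF v that, of k] by (simp add: vdist_line)
      show "cmod (\<tau> * dg v d k) \<le> cmod \<tau> * (2 * m * vnorm D d / \<rho>)"
        unfolding norm_mult by (intro mult_left_mono dg_le v d) simp
    qed
    also have "\<dots> = 4 * m * (cmod \<tau> * vnorm D d / \<rho>)" by (simp add: field_simps)
    finally show ?thesis .
  qed
  consider "vnorm D d = 0" | "\<rho> \<le> vnorm D d" | "0 < vnorm D d" "vnorm D d < \<rho>"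
    using vnorm_nonneg [of D d] by linarith
  then show ?thesis
  proof cases
    case 1
    then show ?thesis using tri [of 1] vd by simp
  next
    case 2
    \<comment> \<open>From distance \<rho> on, the linear bound \<open>tri\<close> lies below the
      quadratic one.\<close>
    have "4 * m * (vnorm D d / \<rho>) \<le> 4 * m * (vnorm D d / \<rho>)\<^sup>2"
      using 2 \<rho>_pos m_nonneg unfolding power2_eq_square
      by (intro mult_left_mono) (auto simp: field_simps mult_left_mono)
    then show ?thesis using tri [of 1] vd by simp
  next
    case 3
    define R where "R = \<rho> / vnorm D d"
    have R: "1 < R" using 3 by (simp add: R_def)
    have small: "cmod \<tau> * vnorm D d < \<rho>" if "\<tau> \<in> ball 0 R" for \<tau>
      using that 3 by (simp add: R_def field_simps)
    have in_S: "(\<lambda>k. v k + \<tau> * d k) \<in> S" if "\<tau> \<in> ball 0 R" for \<tau>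
      using inset_memD [OF v cspace_line [OF vS(2) d]] small [OF that] by (simp add: vdist_line)
    have hol: "holo_curve (ball 0 R) (\<lambda>\<tau>. g (\<lambda>k. v k + \<tau> * d k))"
      by (rule holo_mapD [OF holo_map_g _ in_S holo_curve_line]) auto
    have "cmod (g (\<lambda>k. v k + 1 * d k) k - g v k - 1 * dg v d k) \<le> 4 * m * (cmod 1 / R)\<^sup>2"
    proof (rule schwarz_second_order
        [where F = "\<lambda>\<tau>. g (\<lambda>k. v k + \<tau> * d k) k - g v k - \<tau> * dg v d k"])
      show "(\<lambda>\<tau>. g (\<lambda>k. v k + \<tau> * d k) k - g v k - \<tau> * dg v d k) holomorphic_on ball 0 R"
        using hol by (auto simp: holo_curve_def intro!: holomorphic_intros)
      fix \<tau> :: complex assume "cmod \<tau> < R"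
      then have \<tau>: "\<tau> \<in> ball 0 R" by simp
      have "4 * m * (cmod \<tau> * vnorm D d / \<rho>) \<le> 4 * m * 1"
        using small [OF \<tau>] \<rho>_pos m_nonneg by (intro mult_left_mono) auto
      then show "cmod (g (\<lambda>k. v k + \<tau> * d k) k - g v k - \<tau> * dg v d k) \<le> 4 * m"
        using tri [OF in_S [OF \<tau>]] by simp
    next
      show "((\<lambda>\<tau>. g (\<lambda>k. v k + \<tau> * d k) k - g v k - \<tau> * dg v d k) has_field_derivative 0) (at 0)"
        by (auto intro!: derivative_eq_intros dg_derivative [OF vS(1) d])
    qed (use R in auto)
    then show ?thesis by (simp add: R_def)
  qed
qed

text \<open>The derivative is the uniform limit of the quotients N (g(v + d/N) - g(v)), which are
  holomorphic in the parameter; by \<open>g_second_order\<close> the error is O(1/N). Newton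
  iterates contain g' along a curve and need this.\<close>

lemma holo_curve_dg:
  assumes U: "open U" and v: "holo_curve U v" "\<And>\<tau>. \<tau> \<in> U \<Longrightarrow> v \<tau> \<in> inset D S \<rho>"
    and d: "holo_curve U d" "\<And>\<tau>. \<tau> \<in> U \<Longrightarrow> d \<tau> \<in> cspace D" "\<And>\<tau>. \<tau> \<in> U \<Longrightarrow> vnorm D (d \<tau>) \<le> B"
  shows "holo_curve U (\<lambda>\<tau>. dg (v \<tau>) (d \<tau>))"
proof (cases "U = {}")
  case False
  then have B: "0 \<le> B" using d(3) vnorm_nonneg order_trans by blast
  \<comment> \<open>Shifting the sequence by n0 keeps v + d/N within the room \<rho> for all its
    members.\<close>
  obtain n0 :: nat where n0: "B / \<rho> < real n0" "0 < n0"
  proof -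
    obtain n :: nat where "B / \<rho> < real n" using reals_Archimedean2 by blast
    then have "B / \<rho> < real (Suc n)" by simp
    then show thesis using that by blast
  qed
  define N where "N = (\<lambda>n. of_nat (n + n0) :: complex)"
  have N: "cmod (N n) = real (n + n0)" "N n \<noteq> 0" for n
    unfolding N_def using n0 by (simp_all only: norm_of_nat of_nat_eq_0_iff)
  define c where "c = (\<lambda>n \<tau> k. N n * (g (\<lambda>j. v \<tau> j + 1 / N n * d \<tau> j) k - g (v \<tau>) k))"
  have in_S: "(\<lambda>j. v \<tau> j + 1 / N n * d \<tau> j) \<in> S" if "\<tau> \<in> U" for \<tau> n
  proof (rule inset_memD [OF v(2) [OF that]])
    show "(\<lambda>j. v \<tau> j + 1 / N n * d \<tau> j) \<in> cspace D"
      by (rule cspace_line [OF inset_cspace [OF v(2)] d(2)]) (use that in auto)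
    have "vnorm D (d \<tau>) < \<rho> * real (n + n0)"
    proof -
      have "vnorm D (d \<tau>) \<le> B" by (rule d(3) [OF that])
      also have "\<dots> < \<rho> * real n0" using n0 \<rho>_pos by (simp add: field_simps)
      also have "\<dots> \<le> \<rho> * real (n + n0)" using \<rho>_pos by simp
      finally show ?thesis .
    qed
    moreover have "0 < real (n + n0)" using n0 by simp
    ultimately show "vdist D (\<lambda>j. v \<tau> j + 1 / N n * d \<tau> j) (v \<tau>) < \<rho>"
      unfolding vdist_line norm_divide N by (simp add: divide_simps mult.commute)
  qed
  show ?thesis
  proof (rule holo_curve_uniform_limit [OF U])
    show "holo_curve U (c n)" for n
    proof -
      have 1: "holo_curve U (\<lambda>\<tau> j. v \<tau> j + 1 / N n * d \<tau> j)"
        using v(1) d(1) by (auto simp: holo_curve_def intro!: holomorphic_intros)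
      have "holo_curve U (\<lambda>\<tau>. g (\<lambda>j. v \<tau> j + 1 / N n * d \<tau> j))"
        by (rule holo_mapD [OF holo_map_g U in_S 1])
      moreover have "holo_curve U (\<lambda>\<tau>. g (v \<tau>))"
        by (rule holo_mapD [OF holo_map_g U _ v(1)]) (use v(2) inner_S in blast)
      ultimately show ?thesis
        by (auto simp: holo_curve_def c_def intro!: holomorphic_intros)
    qed
    show "(\<lambda>n. 4 * m * (B / \<rho>)\<^sup>2 * inverse (real (n + n0))) \<longlonglongrightarrow> 0"
      using tendsto_mult [OF tendsto_const LIMSEQ_ignore_initial_segment [OF lim_inverse_n, of n0]]
      by fastforce
    fix n \<tau> k assume \<tau>: "\<tau> \<in> U"
    have pos: "0 < real (n + n0)" using n0 by simp
    have cs: "(\<lambda>j. 1 / N n * d \<tau> j) \<in> cspace D" using d(2) [OF \<tau>] by (simp add: cspace_def)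
    have nrm: "vnorm D (\<lambda>j. 1 / N n * d \<tau> j) = vnorm D (d \<tau>) / real (n + n0)"
      using vdist_line [of D "\<lambda>_. 0" "1 / N n" "d \<tau>"] N by (simp add: vdist_def norm_divide)
    have "c n \<tau> k - dg (v \<tau>) (d \<tau>) k =
        N n * (g (\<lambda>j. v \<tau> j + 1 / N n * d \<tau> j) k - g (v \<tau>) k - dg (v \<tau>) (\<lambda>j. 1 / N n * d \<tau> j) k)"
      unfolding dg_scale c_def using N(2) [of n] by (simp add: algebra_simps)
    also have "cmod \<dots> \<le> real (n + n0) * (4 * m * (vnorm D (d \<tau>) / real (n + n0) / \<rho>)\<^sup>2)"
      unfolding norm_mult N nrm [symmetric]
      by (intro mult_left_mono g_second_order v(2) \<tau> cs in_S) simp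
    also have "\<dots> = 4 * m * (vnorm D (d \<tau>) / \<rho>)\<^sup>2 * inverse (real (n + n0))"
    proof -
      have "K * (4 * m * (y / K / \<rho>)\<^sup>2) = 4 * m * (y / \<rho>)\<^sup>2 * inverse K" if "0 < K" for K y :: real
        using that by (simp add: power2_eq_square field_simps)
      then show ?thesis using pos by blast
    qed
    also have "\<dots> \<le> 4 * m * (B / \<rho>)\<^sup>2 * inverse (real (n + n0))"
      using d(3) [OF \<tau>] m_nonneg \<rho>_pos
      by (intro mult_right_mono mult_left_mono power_mono divide_right_mono) auto
    finally show "cmod (c n \<tau> k - dg (v \<tau>) (d \<tau>) k) \<le> 4 * m * (B / \<rho>)\<^sup>2 * inverse (real (n + n0))" .
  qed
qed (simp add: holo_curve_def holomorphic_on_def)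

end

section \<open>Runge--Kutta stages\<close>

lemma weighted_sum_le:
  fixes q :: "nat \<Rightarrow> complex" and c :: "nat \<Rightarrow> real"
  assumes "\<And>j. j < I \<Longrightarrow> cmod (q j) \<le> M" "0 \<le> M" "(\<Sum>j<I. \<bar>c j\<bar>) \<le> A"
  shows "cmod (h * (\<Sum>j<I. of_real (c j) * q j)) \<le> cmod h * A * M"
proof -
  have "cmod (\<Sum>j<I. of_real (c j) * q j) \<le> (\<Sum>j<I. \<bar>c j\<bar> * M)"
    by (rule sum_norm_le) (use assms(1) in \<open>auto simp: norm_mult intro!: mult_left_mono\<close>)
  also have "\<dots> = (\<Sum>j<I. \<bar>c j\<bar>) * M" by (simp add: sum_distrib_right)
  also have "\<dots> \<le> A * M" using assms(2,3) by (rule mult_right_mono [rotated])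
  finally show ?thesis by (simp add: norm_mult mult_left_mono mult.assoc)
qed

text \<open>\<open>H\<close> bounds the modulus of all step sizes, complex ones included. A single
  \<open>A\<close> bounds the row sums and the weights; being at least 1, it also covers the flow,
  which carries the weight 1. The factor 16 is generous: it gives contraction factors of at most 1/2
  and absorbs the constant in the Newton estimate.\<close>

locale rk_field = bounded_field +
  fixes I :: nat and a :: "nat \<Rightarrow> nat \<Rightarrow> real" and b :: "nat \<Rightarrow> real" and A H :: real
  assumes row_le: "\<And>i. i < I \<Longrightarrow> (\<Sum>j<I. \<bar>a i j\<bar>) \<le> A"
    and col_le: "(\<Sum>i<I. \<bar>b i\<bar>) \<le> A"
    and A_ge: "1 \<le> A" and H_pos: "0 < H" and H_small: "16 * H * A * m \<le> \<rho>"
begin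

lemma step_small: "h \<le> H \<Longrightarrow> 16 * (h * A * m) \<le> \<rho>"
proof -
  assume "h \<le> H"
  then have "h * (A * m) \<le> H * (A * m)" using A_ge m_nonneg by (intro mult_right_mono) auto
  then show ?thesis using H_small by (simp add: mult.assoc)
qed

lemma step_ratio: "0 \<le> h \<Longrightarrow> 16 * (h * A * m / \<rho>) \<le> h / H"
proof -
  assume h: "0 \<le> h"
  have "h * (16 * H * A * m) \<le> h * \<rho>" using H_small h by (rule mult_left_mono)
  then show ?thesis using H_pos \<rho>_pos by (simp add: field_simps)
qed

text \<open>Indices from I on carry the constant z, so that the contraction acts on all indices and
  fixed points are equalities of functions.\<close>

definition rk_map :: "complex \<Rightarrow> cvec \<Rightarrow> (nat \<Rightarrow> cvec \<Rightarrow> cvec) \<Rightarrow> (nat \<Rightarrow> cvec) \<Rightarrow> nat \<Rightarrow> cvec" where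
  "rk_map h z P w = (\<lambda>i. if i < I then (\<lambda>k. z k + h * (\<Sum>j<I. of_real (a i j) * P j (w j) k)) else z)"

definition stage_ball :: "cvec \<Rightarrow> (nat \<Rightarrow> cvec) set" where
  "stage_ball z = {w. \<forall>i. w i \<in> cspace D \<and> vdist D (w i) z \<le> \<rho> \<and> (I \<le> i \<longrightarrow> w i = z)}"

text \<open>The stage equations and each Newton step are fixed points of the same map: P is the field \<open>g\<close>
  for the former and its linearisations at the previous stages for the latter.\<close>

definition rk_ok :: "complex \<Rightarrow> cvec \<Rightarrow> (nat \<Rightarrow> cvec \<Rightarrow> cvec) \<Rightarrow> bool" where
  "rk_ok h z P \<longleftrightarrow> z \<in> cspace D \<and>
     (\<forall>j<I. \<forall>u. u \<in> cspace D \<and> vdist D u z \<le> \<rho> \<longrightarrow>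
        P j u \<in> cspace D \<and> (\<forall>k. cmod h * A * cmod (P j u k) \<le> \<rho>) \<and>
        (\<forall>u' k. u' \<in> cspace D \<and> vdist D u' z \<le> \<rho> \<longrightarrow>
           cmod h * A * cmod (P j u k - P j u' k) \<le> vdist D u u' / 2))"

lemma rk_okD:
  assumes "rk_ok h z P" "j < I" "u \<in> cspace D" "vdist D u z \<le> \<rho>"
  shows "P j u \<in> cspace D" "cmod h * A * cmod (P j u k) \<le> \<rho>"
    "u' \<in> cspace D \<Longrightarrow> vdist D u' z \<le> \<rho> \<Longrightarrow> cmod h * A * cmod (P j u k - P j u' k) \<le> vdist D u u' / 2"
  using assms unfolding rk_ok_def by blast+

lemma weighted_sum_le':
  assumes "\<And>j. j < I \<Longrightarrow> cmod h * A * cmod (q j) \<le> M" "0 \<le> M" "(\<Sum>j<I. \<bar>c j\<bar>) \<le> A"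
  shows "cmod (h * (\<Sum>j<I. of_real (c j) * q j)) \<le> M"
proof (cases "h = 0")
  case False
  then have pos: "0 < cmod h * A" using A_ge by simp
  have "cmod (q j) \<le> M / (cmod h * A)" if "j < I" for j
    using assms(1) [OF that] pos by (simp add: field_simps)
  then have "cmod (h * (\<Sum>j<I. of_real (c j) * q j)) \<le> cmod h * A * (M / (cmod h * A))"
    by (rule weighted_sum_le) (use assms pos in auto)
  also have "\<dots> = M"
  proof -
    have "K * (M / K) = M" if "0 < K" for K :: real using that by simp
    then show ?thesis using pos by blast
  qed
  finally show ?thesis .
qed (use assms in simp)

lemma rk_map_stage_ball:
  assumes ok: "rk_ok h z P" and w: "w \<in> stage_ball z"
  shows "rk_map h z P w \<in> stage_ball z"
proof -
  have z: "z \<in> cspace D" using ok by (simp add: rk_ok_def)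
  have "rk_map h z P w i \<in> cspace D \<and> vdist D (rk_map h z P w i) z \<le> \<rho>" if i: "i < I" for i
  proof
    have P: "P j (w j) \<in> cspace D" "cmod h * A * cmod (P j (w j) k) \<le> \<rho>" if "j < I" for j k
      using rk_okD(1,2) [OF ok that] w by (auto simp: stage_ball_def)
    show "rk_map h z P w i \<in> cspace D"
      using i z P(1) by (auto simp: rk_map_def cspace_def)
    show "vdist D (rk_map h z P w i) z \<le> \<rho>"
    proof (rule vdist_leI)
      show "cmod (rk_map h z P w i k - z k) \<le> \<rho>" for k
        using weighted_sum_le' [of h "\<lambda>j. P j (w j) k" \<rho> "a i"] P(2) row_le [OF i] i \<rho>_pos
        by (simp add: rk_map_def)
    qed (use \<rho>_pos in simp)
  qed
  then show ?thesis using z \<rho>_pos by (auto simp: stage_ball_def rk_map_def)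
qed

lemma const_stage_ball: "z \<in> cspace D \<Longrightarrow> (\<lambda>i. z) \<in> stage_ball z"
  using \<rho>_pos by (simp add: stage_ball_def)

text \<open>The rate of the iterates from the constant family belongs to the choice, because
  holomorphic dependence on the data is derived from it.\<close>

definition rk_limit :: "complex \<Rightarrow> cvec \<Rightarrow> (nat \<Rightarrow> cvec \<Rightarrow> cvec) \<Rightarrow> nat \<Rightarrow> cvec" where
  "rk_limit h z P = (SOME w. w \<in> stage_ball z \<and> rk_map h z P w = w \<and>
     (\<forall>n i k. cmod ((rk_map h z P ^^ n) (\<lambda>i. z) i k - w i k) \<le> 2 * \<rho> / 2 ^ n))"

lemma rk_limit:
  assumes ok: "rk_ok h z P"
  shows "rk_limit h z P \<in> stage_ball z" "rk_map h z P (rk_limit h z P) = rk_limit h z P"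
    "cmod ((rk_map h z P ^^ n) (\<lambda>i. z) i k - rk_limit h z P i k) \<le> 2 * \<rho> / 2 ^ n"
proof -
  have z: "z \<in> cspace D" using ok by (simp add: rk_ok_def)
  obtain w where w: "w \<in> stage_ball z" "rk_map h z P w = w"
    "\<And>n i k. cmod ((rk_map h z P ^^ n) (\<lambda>i. z) i k - w i k) \<le> 2 * \<rho> / 2 ^ n"
  proof (rule contraction_fixed_point [OF const_stage_ball [OF z] rk_map_stage_ball [OF ok]])
    fix X :: "nat \<Rightarrow> nat \<Rightarrow> cvec" and w
    assume X: "\<And>n. X n \<in> stage_ball z" and lim: "\<And>i k. (\<lambda>n. X n i k) \<longlonglongrightarrow> w i k"
    have XD: "X n i \<in> cspace D" "vdist D (X n i) z \<le> \<rho>" for n i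
      using X [of n] by (auto simp: stage_ball_def)
    have "w i \<in> cspace D" for i
      by (rule cspace_limit [OF lim XD(1)])
    moreover have "vdist D (w i) z \<le> \<rho>" for i
      by (rule vdist_limit_le [OF lim tendsto_const XD(2)])
    moreover have "w i = z" if "I \<le> i" for i
    proof
      fix k
      have "X n i = z" for n using X [of n] that by (auto simp: stage_ball_def)
      then have "(\<lambda>n. X n i k) \<longlonglongrightarrow> z k" by simp
      then show "w i k = z k" by (rule LIMSEQ_unique [OF lim])
    qed
    ultimately show "w \<in> stage_ball z" by (simp add: stage_ball_def)
  next
    fix w w' :: "nat \<Rightarrow> cvec" and B i k
    assume w: "w \<in> stage_ball z" "w' \<in> stage_ball z" and d: "\<And>i k. cmod (w i k - w' i k) \<le> B"
    have B: "0 \<le> B" using d norm_ge_zero order_trans by blast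
    show "cmod (rk_map h z P w i k - rk_map h z P w' i k) \<le> B / 2"
    proof (cases "i < I")
      case True
      have "cmod h * A * cmod (P j (w j) k - P j (w' j) k) \<le> B / 2" if "j < I" for j
      proof -
        have "cmod h * A * cmod (P j (w j) k - P j (w' j) k) \<le> vdist D (w j) (w' j) / 2"
          by (rule rk_okD(3) [OF ok that]) (use w in \<open>auto simp: stage_ball_def\<close>)
        also have "\<dots> \<le> B / 2" using vdist_leI [OF B] d by (simp add: divide_right_mono)
        finally show ?thesis .
      qed
      from weighted_sum_le' [OF this _ row_le [OF True]] B
      have "cmod (h * (\<Sum>j<I. of_real (a i j) * (P j (w j) k - P j (w' j) k))) \<le> B / 2" by simp
      then show ?thesis using True
        by (simp add: rk_map_def right_diff_distrib sum_subtractf)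
    qed (use B in \<open>simp add: rk_map_def\<close>)
  next
    fix w w' :: "nat \<Rightarrow> cvec" and i k
    assume w: "w \<in> stage_ball z" "w' \<in> stage_ball z"
    show "cmod (w i k - w' i k) \<le> 2 * \<rho>"
    proof (cases "k < D")
      case True
      have "cmod (w i k - w' i k) \<le> vdist D (w i) (w' i)" by (rule cmod_le_vdist [OF True])
      also have "\<dots> \<le> vdist D (w i) z + vdist D z (w' i)" by (rule vdist_triangle)
      also have "\<dots> \<le> \<rho> + \<rho>" using w by (intro add_mono) (auto simp: stage_ball_def vdist_commute)
      finally show ?thesis by simp
    next
      case False
      then show ?thesis using w \<rho>_pos by (auto simp: stage_ball_def cspace_def)
    qed
  next
    fix w assume "w \<in> stage_ball z" "rk_map h z P w = w"
      "\<And>n i k. cmod ((rk_map h z P ^^ n) (\<lambda>i. z) i k - w i k) \<le> 2 * \<rho> / 2 ^ n"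
    then show thesis by (rule that)
  qed
  have "\<exists>w. w \<in> stage_ball z \<and> rk_map h z P w = w \<and>
     (\<forall>n i k. cmod ((rk_map h z P ^^ n) (\<lambda>i. z) i k - w i k) \<le> 2 * \<rho> / 2 ^ n)"
    by (intro exI [of _ w] conjI allI w)
  from someI_ex [OF this, folded rk_limit_def]
  show "rk_limit h z P \<in> stage_ball z" "rk_map h z P (rk_limit h z P) = rk_limit h z P"
    "cmod ((rk_map h z P ^^ n) (\<lambda>i. z) i k - rk_limit h z P i k) \<le> 2 * \<rho> / 2 ^ n"
    by simp_all
qed

text \<open>Each iterate arises from finitely many holomorphic operations, and the rate
  \<open>2 * \<rho> / 2 ^ n\<close> is the same for all parameters, so the limit is uniform.\<close>

lemma rk_limit_holo:
  assumes U: "open U" and z: "holo_curve U z" and h: "h holomorphic_on U"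
    and ok: "\<And>\<tau>. \<tau> \<in> U \<Longrightarrow> rk_ok (h \<tau>) (z \<tau>) (P \<tau>)"
    and P: "\<And>j w. j < I \<Longrightarrow> holo_curve U w \<Longrightarrow>
      (\<And>\<tau>. \<tau> \<in> U \<Longrightarrow> w \<tau> \<in> cspace D \<and> vdist D (w \<tau>) (z \<tau>) \<le> \<rho>) \<Longrightarrow> holo_curve U (\<lambda>\<tau>. P \<tau> j (w \<tau>))"
  shows "holo_curve U (\<lambda>\<tau>. rk_limit (h \<tau>) (z \<tau>) (P \<tau>) i)"
proof -
  define X where "X = (\<lambda>n \<tau>. (rk_map (h \<tau>) (z \<tau>) (P \<tau>) ^^ n) (\<lambda>i. z \<tau>))"
  have X_ball: "X n \<tau> \<in> stage_ball (z \<tau>)" if "\<tau> \<in> U" for n \<tau>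
  proof (induction n)
    case 0
    then show ?case using ok [OF that] by (simp add: X_def rk_ok_def const_stage_ball)
  next
    case (Suc n)
    then show ?case using rk_map_stage_ball [OF ok [OF that]] by (simp add: X_def)
  qed
  have X_holo: "holo_curve U (\<lambda>\<tau>. X n \<tau> i)" for n i
  proof (induction n arbitrary: i)
    case 0
    then show ?case using z by (simp add: X_def)
  next
    case (Suc n)
    have "holo_curve U (\<lambda>\<tau>. P \<tau> j (X n \<tau> j))" if "j < I" for j
      by (rule P [OF that Suc]) (use X_ball in \<open>auto simp: stage_ball_def\<close>)
    then have "holo_curve U (\<lambda>\<tau> k. z \<tau> k + h \<tau> * (\<Sum>j<I. of_real (a i j) * P \<tau> j (X n \<tau> j) k))"
      using z h by (auto simp: holo_curve_def intro!: holomorphic_intros)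
    then show ?case using z by (cases "i < I") (simp_all add: X_def rk_map_def)
  qed
  show ?thesis
  proof (rule holo_curve_uniform_limit [OF U X_holo])
    show "(\<lambda>n. 2 * \<rho> / 2 ^ n) \<longlonglongrightarrow> 0"
      using LIMSEQ_divide_realpow_zero [of 2 "2 * \<rho>"] by simp
    show "cmod (X n \<tau> i k - rk_limit (h \<tau>) (z \<tau>) (P \<tau>) i k) \<le> 2 * \<rho> / 2 ^ n" if "\<tau> \<in> U" for n \<tau> k
      unfolding X_def by (rule rk_limit(3) [OF ok [OF that]])
  qed
qed

lemma near_inner:
  "z \<in> inset D S (2 * \<rho>) \<Longrightarrow> u \<in> cspace D \<Longrightarrow> vdist D u z \<le> \<rho> \<Longrightarrow> u \<in> inset D S \<rho>"
  by (erule inset_shift) auto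

lemma near_S:
  "z \<in> inset D S (2 * \<rho>) \<Longrightarrow> u \<in> cspace D \<Longrightarrow> vdist D u z \<le> \<rho> \<Longrightarrow> u \<in> S"
  using near_inner inner_S by blast

text \<open>The step size times the Lipschitz constant \<open>2 * m / \<rho>\<close> of g: the
  common contraction factor of stages, Newton systems and Picard iteration.\<close>

lemma scaled_lipschitz:
  assumes "cmod h \<le> H" "0 \<le> y"
  shows "cmod h * A * (2 * m * y / \<rho>) \<le> y / 2"
proof -
  have "16 * (cmod h * A * m) * y \<le> \<rho> * y"
    using step_small [OF assms(1)] assms(2) by (rule mult_right_mono)
  moreover define t where "t = cmod h * A * m * y"
  moreover have "0 \<le> t" using A_ge m_nonneg assms(2) by (simp add: t_def)
  ultimately have "4 * t \<le> \<rho> * y" by (simp add: mult.assoc)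
  then have "2 * t / \<rho> \<le> y / 2" using \<rho>_pos by (simp add: field_simps)
  then show ?thesis by (simp add: t_def mult_ac)
qed

lemma rk_ok_exact:
  assumes z: "z \<in> inset D S (2 * \<rho>)" and h: "cmod h \<le> H"
  shows "rk_ok h z (\<lambda>_. g)"
  unfolding rk_ok_def
proof (intro conjI allI impI)
  have A: "0 \<le> cmod h * A" using A_ge by simp
  fix u assume u: "u \<in> cspace D \<and> vdist D u z \<le> \<rho>"
  show "g u \<in> cspace D" by (rule g_cspace [OF near_S [OF z]]) (use u in auto)
  show "cmod h * A * cmod (g u k) \<le> \<rho>" for k
  proof -
    have "cmod h * A * cmod (g u k) \<le> cmod h * A * m"
      by (intro mult_left_mono cmod_g_le near_S [OF z]) (use u A in auto)
    then show ?thesis using step_small [OF h] \<rho>_pos by linarith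
  qed
  show "cmod h * A * cmod (g u k - g u' k) \<le> vdist D u u' / 2"
    if u': "u' \<in> cspace D \<and> vdist D u' z \<le> \<rho>" for u' k
  proof -
    have "cmod h * A * cmod (g u k - g u' k) \<le> cmod h * A * (2 * m * vdist D u u' / \<rho>)"
      by (intro mult_left_mono cmod_g_diff_le near_S [OF z] near_inner [OF z]) (use u u' A in auto)
    also have "\<dots> \<le> vdist D u u' / 2" by (rule scaled_lipschitz [OF h]) simp
    finally show ?thesis .
  qed
qed (use z inset_cspace in blast)

definition stg :: "complex \<Rightarrow> cvec \<Rightarrow> nat \<Rightarrow> cvec" where
  "stg h z = rk_limit h z (\<lambda>_. g)"

lemma stg:
  assumes z: "z \<in> inset D S (2 * \<rho>)" and h: "cmod h \<le> H"
  shows "stg h z i \<in> cspace D" "vdist D (stg h z i) z \<le> \<rho>" "stg h z i \<in> inset D S \<rho>"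
    "i < I \<Longrightarrow> stg h z i k = z k + h * (\<Sum>j<I. of_real (a i j) * g (stg h z j) k)"
    "i < I \<Longrightarrow> vdist D (stg h z i) z \<le> cmod h * A * m"
proof -
  note lim = rk_limit [OF rk_ok_exact [OF assms], folded stg_def]
  show 1: "stg h z i \<in> cspace D" "vdist D (stg h z i) z \<le> \<rho>" for i
    using lim(1) by (auto simp: stage_ball_def)
  then show "stg h z i \<in> inset D S \<rho>" using near_inner [OF z] by blast
  show 2: "stg h z i k = z k + h * (\<Sum>j<I. of_real (a i j) * g (stg h z j) k)" if "i < I" for i k
    using fun_cong [OF fun_cong [OF lim(2)], of i k] that by (simp add: rk_map_def)
  show "vdist D (stg h z i) z \<le> cmod h * A * m" if i: "i < I"
  proof (rule vdist_leI)
    show "cmod (stg h z i k - z k) \<le> cmod h * A * m" for k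
      unfolding 2 [OF i]
      using weighted_sum_le [OF cmod_g_le [OF near_S [OF z 1]] m_nonneg row_le [OF i]] by simp
  qed (use A_ge m_nonneg in simp)
qed

lemma stg_holo:
  assumes U: "open U" and z: "holo_curve U z" "\<And>\<tau>. \<tau> \<in> U \<Longrightarrow> z \<tau> \<in> inset D S (2 * \<rho>)"
    and h: "h holomorphic_on U" "\<And>\<tau>. \<tau> \<in> U \<Longrightarrow> cmod (h \<tau>) \<le> H"
  shows "holo_curve U (\<lambda>\<tau>. stg (h \<tau>) (z \<tau>) i)"
  unfolding stg_def
proof (rule rk_limit_holo [OF U z(1) h(1) rk_ok_exact])
  fix w assume "holo_curve U w" "\<And>\<tau>. \<tau> \<in> U \<Longrightarrow> w \<tau> \<in> cspace D \<and> vdist D (w \<tau>) (z \<tau>) \<le> \<rho>"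
  then show "holo_curve U (\<lambda>\<tau>. g (w \<tau>))"
    using holo_mapD [OF holo_map_g U] near_S z(2) by blast
qed (use z h in auto)

definition newton_field :: "(nat \<Rightarrow> cvec) \<Rightarrow> nat \<Rightarrow> cvec \<Rightarrow> cvec" where
  "newton_field v j u = (\<lambda>k. g (v j) k + dg (v j) (\<lambda>k. u k - v j k) k)"

lemma newton_field_diff:
  "newton_field v j u k - newton_field v j u' k = dg (v j) (\<lambda>k. u k - u' k) k"
  unfolding newton_field_def dg_diff by simp

text \<open>The linearised field is affine with slope bounded by \<open>dg_le\<close>, hence
  contracts like \<open>g\<close> itself. Near z its argument is within 2\<rho> of the previous
  stage, so its values are at most 5m, which the slack in \<open>H_small\<close> covers.\<close>

lemma rk_ok_newton:
  assumes z: "z \<in> inset D S (2 * \<rho>)" and h: "cmod h \<le> H"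
    and v: "\<And>j. j < I \<Longrightarrow> v j \<in> cspace D" "\<And>j. j < I \<Longrightarrow> vdist D (v j) z \<le> \<rho>"
  shows "rk_ok h z (newton_field v)"
  unfolding rk_ok_def
proof (intro conjI allI impI)
  have A: "0 \<le> cmod h * A" using A_ge by simp
  fix j u assume j: "j < I" and u: "u \<in> cspace D \<and> vdist D u z \<le> \<rho>"
  have vj: "v j \<in> inset D S \<rho>" "v j \<in> S"
    using near_inner [OF z v [OF j]] near_S [OF z v [OF j]] by auto
  have d: "vdist D u (v j) \<le> 2 * \<rho>"
    using vdist_triangle [of D u "v j" z] u v(2) [OF j] vdist_commute [of D z "v j"] by linarith
  show "newton_field v j u \<in> cspace D"
    using g_cspace [OF vj(2)] by (simp add: newton_field_def cspace_def dg_def)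
  show "cmod h * A * cmod (newton_field v j u k) \<le> \<rho>" for k
  proof -
    have "cmod (newton_field v j u k) \<le> cmod (g (v j) k) + cmod (dg (v j) (\<lambda>k. u k - v j k) k)"
      unfolding newton_field_def by (rule norm_triangle_ineq)
    also have "\<dots> \<le> m + 2 * m * vdist D u (v j) / \<rho>"
      unfolding vdist_def using u v(1) [OF j]
      by (intro add_mono cmod_g_le vj dg_le cspace_diff) auto
    finally have "cmod h * A * cmod (newton_field v j u k)
        \<le> cmod h * A * (m + 2 * m * vdist D u (v j) / \<rho>)" by (rule mult_left_mono [OF _ A])
    also have "\<dots> = cmod h * A * m + cmod h * A * (2 * m * vdist D u (v j) / \<rho>)"
      by (rule distrib_left)
    also have "\<dots> \<le> \<rho> / 16 + vdist D u (v j) / 4"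
    proof (rule add_mono)
      show "cmod h * A * m \<le> \<rho> / 16" using step_small [OF h] by simp
      have "16 * (cmod h * A * m) * vdist D u (v j) \<le> \<rho> * vdist D u (v j)"
        using step_small [OF h] by (rule mult_right_mono) simp
      moreover define t where "t = cmod h * A * m * vdist D u (v j)"
      moreover have "0 \<le> t" using A m_nonneg by (simp add: t_def)
      ultimately have "8 * t \<le> \<rho> * vdist D u (v j)" by (simp add: mult.assoc)
      then have "2 * t / \<rho> \<le> vdist D u (v j) / 4" using \<rho>_pos by (simp add: field_simps)
      then show "cmod h * A * (2 * m * vdist D u (v j) / \<rho>) \<le> vdist D u (v j) / 4"
        by (simp add: t_def mult_ac)
    qed
    also have "\<dots> \<le> \<rho>" using d \<rho>_pos by simp
    finally show ?thesis .
  qed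
  show "cmod h * A * cmod (newton_field v j u k - newton_field v j u' k) \<le> vdist D u u' / 2"
    if u': "u' \<in> cspace D \<and> vdist D u' z \<le> \<rho>" for u' k
  proof -
    have "cmod h * A * cmod (newton_field v j u k - newton_field v j u' k)
        \<le> cmod h * A * (2 * m * vdist D u u' / \<rho>)"
      unfolding newton_field_diff vdist_def
      by (intro mult_left_mono dg_le vj cspace_diff) (use u u' A in auto)
    also have "\<dots> \<le> vdist D u u' / 2" by (rule scaled_lipschitz [OF h]) simp
    finally show ?thesis .
  qed
qed (use z inset_cspace in blast)

text \<open>Discharges the definite description. Uniqueness has to hold in all of
  \<open>cspace D\<close> and not only near z, where the contraction lives; it does, because the
  system is affine and the bound on its slope holds for arguments of any size.\<close>

lemma newton_next_eq:
  fixes h :: real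
  assumes z: "z \<in> inset D S (2 * \<rho>)" and h: "0 \<le> h" "h \<le> H"
    and v: "\<And>j. j < I \<Longrightarrow> v j \<in> cspace D" "\<And>j. j < I \<Longrightarrow> vdist D (v j) z \<le> \<rho>"
  shows "newton_next I a D h g z v = restrict (rk_limit (of_real h) z (newton_field v)) {..<I}"
proof -
  define w where "w = rk_limit (of_real h) z (newton_field v)"
  have h': "cmod (of_real h) \<le> H" using h by simp
  have zc: "z \<in> cspace D" using z by (rule inset_cspace)
  note lim = rk_limit [OF rk_ok_newton [of z "of_real h" v, OF z h' v], folded w_def]
  have w: "w i \<in> cspace D" for i using lim(1) by (auto simp: stage_ball_def)
  have w_eq: "w i k = z k + of_real h * (\<Sum>j<I. of_real (a i j) * newton_field v j (w j) k)" if "i < I" for i k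
    using fun_cong [OF fun_cong [OF lim(2)], of i k] that by (simp add: rk_map_def)
  have expand: "newton_field v j u k =
      g (v j) k + (\<Sum>l<D. partial_deriv g (v j) k l * (u l - v j l))" if "k < D" for j u k
    using that by (simp add: newton_field_def dg_def)
  show ?thesis
    unfolding newton_next_def w_def [symmetric]
  proof (rule the_equality)
    show "restrict w {..<I} \<in> {..<I} \<rightarrow>\<^sub>E cspace D \<and>
      (\<forall>i<I. \<forall>k<D. restrict w {..<I} i k = z k + of_real h * (\<Sum>j<I. of_real (a i j) *
         (g (v j) k + (\<Sum>l<D. partial_deriv g (v j) k l * (restrict w {..<I} j l - v j l)))))"
      using w w_eq by (auto simp: expand)
  next
    fix u assume u: "u \<in> {..<I} \<rightarrow>\<^sub>E cspace D \<and>
      (\<forall>i<I. \<forall>k<D. u i k = z k + of_real h * (\<Sum>j<I. of_real (a i j) *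
         (g (v j) k + (\<Sum>l<D. partial_deriv g (v j) k l * (u j l - v j l)))))"
    have uc: "u i \<in> cspace D" if "i < I" for i using u that by auto
    have u_eq: "u i k = z k + of_real h * (\<Sum>j<I. of_real (a i j) * newton_field v j (u j) k)"
      if "i < I" "k < D" for i k
      using u that by (simp add: expand)
    \<comment> \<open>The largest distance over the stages; the inserted 0 covers I = 0. The system
      gives \<open>B <= B / 2\<close>.\<close>
    define B where "B = Max (insert 0 ((\<lambda>i. vdist D (u i) (w i)) ` {..<I}))"
    have B: "0 \<le> B" "\<And>j. j < I \<Longrightarrow> vdist D (u j) (w j) \<le> B"
      by (auto simp: B_def intro!: Max_ge)
    have "vdist D (u i) (w i) \<le> B / 2" if i: "i < I" for i
    proof (rule vdist_leI)
      fix k assume k: "k < D"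
      have "u i k - w i k =
          of_real h * (\<Sum>j<I. of_real (a i j) * dg (v j) (\<lambda>k. u j k - w j k) k)"
        unfolding u_eq [OF i k] w_eq [OF i] newton_field_diff [symmetric]
        by (simp add: right_diff_distrib sum_subtractf)
      also have "cmod \<dots> \<le> B / 2"
      proof (rule weighted_sum_le' [OF _ _ row_le [OF i]])
        fix j assume j: "j < I"
        have vj: "v j \<in> inset D S \<rho>" using near_inner [OF z v [OF j]] .
        have "cmod (of_real h) * A * cmod (dg (v j) (\<lambda>k. u j k - w j k) k)
            \<le> cmod (of_real h) * A * (2 * m * vdist D (u j) (w j) / \<rho>)"
          unfolding vdist_def using A_ge
          by (intro mult_left_mono dg_le vj cspace_diff uc j w) auto
        also have "\<dots> \<le> vdist D (u j) (w j) / 2" by (rule scaled_lipschitz [OF h']) simp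
        also have "\<dots> \<le> B / 2" using B(2) [OF j] by simp
        finally show "cmod (of_real h) * A * cmod (dg (v j) (\<lambda>k. u j k - w j k) k) \<le> B / 2" .
      qed (use B in simp)
      finally show "cmod (u i k - w i k) \<le> B / 2" .
    qed (use B in simp)
    then have "Max (insert 0 ((\<lambda>i. vdist D (u i) (w i)) ` {..<I})) \<le> B / 2"
      using B(1) by (subst Max_le_iff) auto
    then have "B \<le> B / 2" unfolding B_def [symmetric] .
    then have "vdist D (u i) (w i) \<le> 0" if "i < I" for i using B(2) [OF that] by linarith
    then have "u i = w i" if "i < I" for i using cspace_eqI [OF uc w] that by blast
    then show "u = restrict w {..<I}" using u by (auto simp: PiE_iff extensional_def)
  qed
qed

text \<open>With c = h/H, a fixed-point step multiplies the error by at most c. A Newton step turns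
  the exponent q into 2q + 2: squaring the error doubles q, and the squared ratio of
  \<open>h * A * m\<close> to \<rho> supplies the 2. Starting from 0 this recursion has the solution
  2 ^ (L + 1) - 2, which is where the Newton value of \<open>Lstar\<close> comes from.\<close>

lemma unrolled_stages_close:
  fixes h :: real
  assumes z: "z \<in> inset D S (2 * \<rho>)" and h: "0 < h" "h \<le> H"
  shows "i < I \<Longrightarrow> unrolled_stages sol I a D h g z l i \<in> cspace D \<and>
    vdist D (unrolled_stages sol I a D h g z l i) (stg (of_real h) z i)
      \<le> h * A * m * (h / H) ^ Lstar sol l"
proof (induction l arbitrary: i)
  case 0
  have "Lstar sol 0 = 0" by (cases sol) (auto simp: Lstar_def)
  then show ?case
    using stg(5) [OF z, of "of_real h" i] h 0 inset_cspace [OF z] by (simp add: vdist_commute)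
next
  case (Suc l)
  define c where "c = h / H"
  have c: "0 < c" "c \<le> 1" using h H_pos by (simp_all add: c_def)
  have h': "cmod (of_real h) \<le> H" using h by simp
  define \<mu> where "\<mu> = h * A * m"
  have \<mu>0: "0 \<le> \<mu>" using h A_ge m_nonneg by (simp add: \<mu>_def)
  have \<mu>: "16 * \<mu> \<le> \<rho>" using step_small [OF h(2)] by (simp add: \<mu>_def)
  have \<mu>c: "16 * (\<mu> / \<rho>) \<le> c" using step_ratio [of h] h by (simp add: \<mu>_def c_def)
  define v where "v = unrolled_stages sol I a D h g z l"
  define e where "e = \<mu> * c ^ Lstar sol l"
  have e: "0 \<le> e" "e \<le> \<mu>" using \<mu>0 c by (auto simp: e_def power_le_one mult_left_le)
  have v: "v j \<in> cspace D" "vdist D (v j) (stg (of_real h) z j) \<le> e" if "j < I" for j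
    using Suc.IH [OF that] by (simp_all add: v_def e_def \<mu>_def c_def)
  have vz: "vdist D (v j) z \<le> \<rho>" if "j < I" for j
  proof -
    have "vdist D (v j) z \<le> vdist D (v j) (stg (of_real h) z j) + vdist D (stg (of_real h) z j) z"
      by (rule vdist_triangle)
    also have "\<dots> \<le> \<mu> + \<mu>"
    proof (rule add_mono)
      show "vdist D (v j) (stg (of_real h) z j) \<le> \<mu>" using v(2) [OF that] e by linarith
      show "vdist D (stg (of_real h) z j) z \<le> \<mu>" using stg(5) [OF z h' that] h by (simp add: \<mu>_def)
    qed
    finally show ?thesis using \<mu> \<mu>0 by linarith
  qed
  have vS: "v j \<in> S" "v j \<in> inset D S \<rho>" if "j < I" for j
    using near_S [OF z v(1) vz] near_inner [OF z v(1) vz] that by auto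
  note st = stg [OF z h']
  have st_S: "stg (of_real h) z j \<in> S" for j using st(3) inner_S by blast
  have zc: "z \<in> cspace D" using z by (rule inset_cspace)
  show ?case
  proof (cases sol)
    case Fixed_Point
    have u: "unrolled_stages sol I a D h g z (Suc l) i =
        (\<lambda>k. z k + of_real h * (\<Sum>j<I. of_real (a i j) * g (v j) k))"
      by (simp add: Fixed_Point v_def)
    show ?thesis
    proof
      show "unrolled_stages sol I a D h g z (Suc l) i \<in> cspace D"
        unfolding u using zc g_cspace [OF vS(1)] by (simp add: cspace_def)
      have "vdist D (unrolled_stages sol I a D h g z (Suc l) i) (stg (of_real h) z i)
          \<le> h * A * (2 * m * e / \<rho>)"
      proof (rule vdist_leI)
        fix k
        have "unrolled_stages sol I a D h g z (Suc l) i k - stg (of_real h) z i k =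
            of_real h * (\<Sum>j<I. of_real (a i j) * (g (v j) k - g (stg (of_real h) z j) k))"
          unfolding u st(4) [OF Suc.prems] by (simp add: right_diff_distrib sum_subtractf)
        also have "cmod \<dots> \<le> cmod (of_real h) * A * (2 * m * e / \<rho>)"
        proof (rule weighted_sum_le [OF _ _ row_le [OF Suc.prems]])
          fix j assume j: "j < I"
          have "cmod (g (v j) k - g (stg (of_real h) z j) k)
              \<le> 2 * m * vdist D (v j) (stg (of_real h) z j) / \<rho>"
            by (rule cmod_g_diff_le [OF st(3) vS(1) [OF j]])
          also have "\<dots> \<le> 2 * m * e / \<rho>"
            using v(2) [OF j] m_nonneg \<rho>_pos by (intro divide_right_mono mult_left_mono) auto
          finally show "cmod (g (v j) k - g (stg (of_real h) z j) k) \<le> 2 * m * e / \<rho>" .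
        qed (use e m_nonneg \<rho>_pos in simp)
        finally show "cmod (unrolled_stages sol I a D h g z (Suc l) i k - stg (of_real h) z i k)
          \<le> h * A * (2 * m * e / \<rho>)" using h by simp
      qed (use h A_ge e m_nonneg \<rho>_pos in simp)
      also have "\<dots> = 2 * (\<mu> / \<rho>) * e" by (simp add: \<mu>_def)
      also have "\<dots> \<le> c * e"
        using \<mu>c e(1) divide_nonneg_pos [OF \<mu>0 \<rho>_pos] by (intro mult_right_mono) linarith+
      also have "\<dots> = \<mu> * c ^ Lstar sol (Suc l)"
        by (simp add: e_def Lstar_def Fixed_Point)
      finally show "vdist D (unrolled_stages sol I a D h g z (Suc l) i) (stg (of_real h) z i)
          \<le> h * A * m * (h / H) ^ Lstar sol (Suc l)" by (simp add: \<mu>_def c_def)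
    qed
  next
    case Newton_Raphson
    define w where "w = rk_limit (of_real h) z (newton_field v)"
    note lim = rk_limit [OF rk_ok_newton [of z "of_real h" v, OF z h' v(1) vz], folded w_def]
    have w: "w j \<in> cspace D" for j using lim(1) by (auto simp: stage_ball_def)
    have w_eq: "w j k = z k + of_real h * (\<Sum>i<I. of_real (a j i) * newton_field v i (w i) k)"
      if "j < I" for j k
      using fun_cong [OF fun_cong [OF lim(2)], of j k] that by (simp add: rk_map_def)
    have u: "unrolled_stages sol I a D h g z (Suc l) j = w j" if "j < I" for j
      using that newton_next_eq [OF z _ h(2) v(1) vz] h(1)
      by (simp add: Newton_Raphson v_def w_def)
    define B where "B = Max (insert 0 ((\<lambda>i. vdist D (w i) (stg (of_real h) z i)) ` {..<I}))"
    have B: "0 \<le> B" "\<And>j. j < I \<Longrightarrow> vdist D (w j) (stg (of_real h) z j) \<le> B"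
      by (auto simp: B_def intro!: Max_ge)
    define Q where "Q = 4 * m * (e / \<rho>)\<^sup>2"
    have Q: "0 \<le> Q" using m_nonneg by (simp add: Q_def)
    have "vdist D (w j) (stg (of_real h) z j) \<le> h * A * (Q + 2 * m * B / \<rho>)" if j: "j < I" for j
    proof (rule vdist_leI)
      fix k
      let ?s = "\<lambda>i. stg (of_real h) z i"
      have "w j k - ?s j k =
          of_real h * (\<Sum>i<I. of_real (a j i) * (newton_field v i (w i) k - g (?s i) k))"
        unfolding w_eq [OF j] st(4) [OF j] by (simp add: right_diff_distrib sum_subtractf)
      also have "cmod \<dots> \<le> cmod (of_real h) * A * (Q + 2 * m * B / \<rho>)"
      proof (rule weighted_sum_le [OF _ _ row_le [OF j]])
        fix i assume i: "i < I"
        have shift_eq: "(\<lambda>k. v i k + (?s i k - v i k)) = ?s i" by simp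
        \<comment> \<open>The difference is the linearisation applied to w - s, minus the
          second-order remainder of g between the old stage v and the exact stage s.\<close>
        have "cmod (newton_field v i (w i) k - g (?s i) k)
            = cmod ((newton_field v i (w i) k - newton_field v i (?s i) k)
               - (g (?s i) k - g (v i) k - dg (v i) (\<lambda>k. ?s i k - v i k) k))"
          by (rule arg_cong [of _ _ cmod]) (simp add: newton_field_def)
        also have "\<dots> \<le> cmod (newton_field v i (w i) k - newton_field v i (?s i) k)
            + cmod (g (?s i) k - g (v i) k - dg (v i) (\<lambda>k. ?s i k - v i k) k)"
          by (rule norm_triangle_ineq4)
        also have "\<dots> \<le> 2 * m * vdist D (w i) (?s i) / \<rho> + 4 * m * (vdist D (?s i) (v i) / \<rho>)\<^sup>2"
        proof (rule add_mono)
          show "cmod (newton_field v i (w i) k - newton_field v i (?s i) k)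
              \<le> 2 * m * vdist D (w i) (?s i) / \<rho>"
            unfolding newton_field_diff vdist_def
            by (rule dg_le [OF vS(2) [OF i] cspace_diff [OF w st(1)]])
          show "cmod (g (?s i) k - g (v i) k - dg (v i) (\<lambda>k. ?s i k - v i k) k)
              \<le> 4 * m * (vdist D (?s i) (v i) / \<rho>)\<^sup>2"
            using g_second_order [OF vS(2) [OF i] cspace_diff [OF st(1) [of i] v(1) [OF i]], of k] st_S
            unfolding shift_eq vdist_def by blast
        qed
        also have "\<dots> \<le> 2 * m * B / \<rho> + Q"
          unfolding Q_def using B(2) [OF i] v(2) [OF i] m_nonneg \<rho>_pos vdist_nonneg
          by (intro add_mono divide_right_mono mult_left_mono power_mono)
             (auto simp: vdist_commute)
        finally show "cmod (newton_field v i (w i) k - g (?s i) k) \<le> Q + 2 * m * B / \<rho>"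
          by simp
      qed (use B Q m_nonneg \<rho>_pos in simp)
      finally show "cmod (w j k - ?s j k) \<le> h * A * (Q + 2 * m * B / \<rho>)" using h by simp
    qed (use h A_ge B Q m_nonneg \<rho>_pos in simp)
    moreover have "0 \<le> h * A * (Q + 2 * m * B / \<rho>)"
      using h A_ge B(1) Q m_nonneg \<rho>_pos by simp
    ultimately have "Max (insert 0 ((\<lambda>i. vdist D (w i) (stg (of_real h) z i)) ` {..<I}))
        \<le> h * A * (Q + 2 * m * B / \<rho>)"
      by (subst Max_le_iff) auto
    \<comment> \<open>B stands on the right as well because a Newton step is implicit in the new
      stages; its coefficient is at most 1/2 and can be moved to the left.\<close>
    then have "B \<le> h * A * (Q + 2 * m * B / \<rho>)" unfolding B_def [symmetric] .
    also have "\<dots> = h * A * Q + 2 * (\<mu> / \<rho>) * B" by (simp add: \<mu>_def field_simps)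
    also have "\<dots> \<le> h * A * Q + 1 / 2 * B"
    proof -
      have "2 * (\<mu> / \<rho>) \<le> 1 / 2" using \<mu> \<mu>0 \<rho>_pos by (simp add: field_simps)
      then have "2 * (\<mu> / \<rho>) * B \<le> 1 / 2 * B" using B(1) by (rule mult_right_mono)
      then show ?thesis by simp
    qed
    finally have "B \<le> 2 * (h * A * Q)" by simp
    also have "\<dots> = 8 * \<mu> * (\<mu> / \<rho>)\<^sup>2 * (c ^ Lstar sol l)\<^sup>2"
      by (simp add: Q_def e_def \<mu>_def power_mult_distrib power_divide)
    also have "\<dots> \<le> 8 * \<mu> * (c / 16)\<^sup>2 * (c ^ Lstar sol l)\<^sup>2"
    proof -
      have "\<mu> / \<rho> \<le> c / 16" "0 \<le> \<mu> / \<rho>" using \<mu>c \<mu>0 \<rho>_pos by (simp_all add: mult.commute)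
      then show ?thesis using \<mu>0 by (intro mult_right_mono mult_left_mono power_mono) simp_all
    qed
    also have "\<dots> \<le> \<mu> * c\<^sup>2 * (c ^ Lstar sol l)\<^sup>2"
      using \<mu>0 by (intro mult_right_mono) (auto simp: power_divide mult_left_mono)
    also have "\<dots> = \<mu> * c ^ (2 + 2 * Lstar sol l)"
      by (simp add: power_add power_mult power2_eq_square power_mult_distrib)
    \<comment> \<open>The truncated subtraction in \<open>Lstar\<close> is exact because 2 ^ (l + 1)
      is at least 2.\<close>
    also have "2 + 2 * Lstar sol l = Lstar sol (Suc l)"
    proof -
      have "2 + 2 * (q - 2) = 2 * q - 2" if "2 \<le> q" for q :: nat using that by arith
      from this [of "2 ^ (l + 1)"] show ?thesis by (simp add: Lstar_def Newton_Raphson)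
    qed
    finally have "B \<le> \<mu> * c ^ Lstar sol (Suc l)" .
    then show ?thesis
      using B(2) [OF Suc.prems] w unfolding u [OF Suc.prems] by (force simp: \<mu>_def c_def)
  qed
qed

lemma unrolled_stages_near:
  fixes h :: real
  assumes z: "z \<in> inset D S (2 * \<rho>)" and h: "0 < h" "h \<le> H" and i: "i < I"
  shows "unrolled_stages sol I a D h g z l i \<in> cspace D"
    "vdist D (unrolled_stages sol I a D h g z l i) z \<le> \<rho>"
proof -
  note close = unrolled_stages_close [OF z h i, of sol l]
  show "unrolled_stages sol I a D h g z l i \<in> cspace D" using close by blast
  have h': "cmod (of_real h) \<le> H" using h by simp
  have \<mu>0: "0 \<le> h * A * m" using h A_ge m_nonneg by simp
  have "vdist D (unrolled_stages sol I a D h g z l i) z \<le>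
      vdist D (unrolled_stages sol I a D h g z l i) (stg (of_real h) z i) + vdist D (stg (of_real h) z i) z"
    by (rule vdist_triangle)
  also have "\<dots> \<le> h * A * m * 1 + h * A * m"
  proof (rule add_mono)
    have "(h / H) ^ Lstar sol l \<le> 1" using h H_pos by (simp add: power_le_one)
    then show "vdist D (unrolled_stages sol I a D h g z l i) (stg (of_real h) z i) \<le> h * A * m * 1"
      using close \<mu>0 mult_left_mono order_trans by blast
    show "vdist D (stg (of_real h) z i) z \<le> h * A * m"
      using stg(5) [OF z h' i] h by simp
  qed
  finally show "vdist D (unrolled_stages sol I a D h g z l i) z \<le> \<rho>"
    using step_small [OF h(2)] \<mu>0 by linarith
qed

text \<open>Here h stays real and only the base point varies: the Schwarz lemma is later applied to
  the unrolled step as a map of z.\<close>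

lemma unrolled_stages_holo:
  fixes h :: real
  assumes U: "open U" and z: "holo_curve U z" "\<And>\<tau>. \<tau> \<in> U \<Longrightarrow> z \<tau> \<in> inset D S (2 * \<rho>)"
    and h: "0 < h" "h \<le> H"
  shows "i < I \<Longrightarrow> holo_curve U (\<lambda>\<tau>. unrolled_stages sol I a D h g (z \<tau>) l i)"
proof (induction l arbitrary: i)
  case 0
  then show ?case using z by simp
next
  case (Suc l)
  define v where "v = (\<lambda>\<tau>. unrolled_stages sol I a D h g (z \<tau>) l)"
  have v: "v \<tau> j \<in> cspace D" "vdist D (v \<tau> j) (z \<tau>) \<le> \<rho>" if "\<tau> \<in> U" "j < I" for \<tau> j
    using unrolled_stages_near [OF z(2) h] that by (simp_all add: v_def)
  have vS: "v \<tau> j \<in> S" "v \<tau> j \<in> inset D S \<rho>" if "\<tau> \<in> U" "j < I" for \<tau> j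
    using near_S [OF z(2)] near_inner [OF z(2)] v that by auto
  have v_holo: "holo_curve U (\<lambda>\<tau>. v \<tau> j)" if "j < I" for j
    using Suc.IH [OF that] by (simp add: v_def)
  have gv_holo: "holo_curve U (\<lambda>\<tau>. g (v \<tau> j))" if "j < I" for j
    by (rule holo_mapD [OF holo_map_g U vS(1) v_holo]) (use that in auto)
  show ?case
  proof (cases sol)
    case Fixed_Point
    have "holo_curve U (\<lambda>\<tau> k. z \<tau> k + of_real h * (\<Sum>j<I. of_real (a i j) * g (v \<tau> j) k))"
      using z(1) gv_holo by (auto simp: holo_curve_def intro!: holomorphic_intros)
    then show ?thesis by (simp add: Fixed_Point v_def)
  next
    case Newton_Raphson
    define w where "w = (\<lambda>\<tau>. rk_limit (of_real h) (z \<tau>) (newton_field (v \<tau>)))"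
    have u: "unrolled_stages sol I a D h g (z \<tau>) (Suc l) i = w \<tau> i" if "\<tau> \<in> U" for \<tau>
      using Suc.prems newton_next_eq [OF z(2) [OF that] _ h(2) v [OF that]] h(1)
      by (simp add: Newton_Raphson v_def w_def)
    have "holo_curve U (\<lambda>\<tau>. w \<tau> i)"
      unfolding w_def
    proof (rule rk_limit_holo [OF U z(1)])
      show "rk_ok (of_real h) (z \<tau>) (newton_field (v \<tau>))" if "\<tau> \<in> U" for \<tau>
        by (rule rk_ok_newton [OF z(2) [OF that] _ v [OF that]]) (use h in auto)
      fix j y assume j: "j < I" and y: "holo_curve U y"
        "\<And>\<tau>. \<tau> \<in> U \<Longrightarrow> y \<tau> \<in> cspace D \<and> vdist D (y \<tau>) (z \<tau>) \<le> \<rho>"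
      have "holo_curve U (\<lambda>\<tau>. dg (v \<tau> j) (\<lambda>k. y \<tau> k - v \<tau> j k))"
      proof (rule holo_curve_dg [OF U v_holo [OF j] vS(2)])
        show "holo_curve U (\<lambda>\<tau> k. y \<tau> k - v \<tau> j k)"
          using y(1) v_holo [OF j] by (auto simp: holo_curve_def intro!: holomorphic_intros)
        fix \<tau> assume \<tau>: "\<tau> \<in> U"
        show "(\<lambda>k. y \<tau> k - v \<tau> j k) \<in> cspace D"
          by (rule cspace_diff) (use y(2) v(1) \<tau> j in auto)
        have "vdist D (y \<tau>) (v \<tau> j) \<le> vdist D (y \<tau>) (z \<tau>) + vdist D (z \<tau>) (v \<tau> j)"
          by (rule vdist_triangle)
        also have "\<dots> \<le> 2 * \<rho>" using y(2) [OF \<tau>] v(2) [OF \<tau> j] by (simp add: vdist_commute)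
        finally show "vnorm D (\<lambda>k. y \<tau> k - v \<tau> j k) \<le> 2 * \<rho>" by (simp add: vdist_def)
      qed (use j in auto)
      then show "holo_curve U (\<lambda>\<tau>. newton_field (v \<tau>) j (y \<tau>))"
        using gv_holo [OF j] by (auto simp: newton_field_def holo_curve_def intro!: holomorphic_intros)
    qed simp
    then show ?thesis
      using u unfolding holo_curve_def by (metis (no_types, lifting) holomorphic_transform)
  qed
qed

text \<open>The true implicit step, for complex step sizes too. The order hypothesis concerns this
  map, the loss the unrolled one.\<close>

definition rk_exact :: "complex \<Rightarrow> cvec \<Rightarrow> cvec" where
  "rk_exact h z = (\<lambda>k. z k + h * (\<Sum>i<I. of_real (b i) * g (stg h z i) k))"

lemma rk_exact_near:
  assumes z: "z \<in> inset D S (2 * \<rho>)" and h: "cmod h \<le> H"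
  shows "cmod (rk_exact h z k - z k) \<le> cmod h * A * m"
proof -
  have "cmod (h * (\<Sum>i<I. of_real (b i) * g (stg h z i) k)) \<le> cmod h * A * m"
    by (rule weighted_sum_le [OF cmod_g_le m_nonneg col_le]) (use stg(3) [OF z h] inner_S in blast)
  then show ?thesis by (simp add: rk_exact_def)
qed

lemma rk_exact_holo:
  assumes U: "open U" and z: "holo_curve U z" "\<And>\<tau>. \<tau> \<in> U \<Longrightarrow> z \<tau> \<in> inset D S (2 * \<rho>)"
    and h: "h holomorphic_on U" "\<And>\<tau>. \<tau> \<in> U \<Longrightarrow> cmod (h \<tau>) \<le> H"
  shows "holo_curve U (\<lambda>\<tau>. rk_exact (h \<tau>) (z \<tau>))"
proof -
  have "holo_curve U (\<lambda>\<tau>. g (stg (h \<tau>) (z \<tau>) i))" for i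
    by (rule holo_mapD [OF holo_map_g U _ stg_holo [OF U z h]]) (use stg(3) [OF z(2) h(2)] inner_S in blast)
  then show ?thesis using z(1) h(1)
    by (auto simp: rk_exact_def holo_curve_def intro!: holomorphic_intros)
qed

context
  fixes h :: real and sol :: implicit_solver and L :: nat
  assumes h: "0 < h" "h \<le> H"
begin

lemma unrolled_step_near:
  assumes z: "z \<in> inset D S (2 * \<rho>)"
  shows "unrolled_step sol I a b L D h g z \<in> cspace D"
    "vdist D (unrolled_step sol I a b L D h g z) z \<le> h * A * m"
proof -
  let ?v = "unrolled_stages sol I a D h g z L"
  have v: "?v i \<in> S" if "i < I" for i
    using near_S [OF z] unrolled_stages_near [OF z h that] by blast
  show "unrolled_step sol I a b L D h g z \<in> cspace D"
    using inset_cspace [OF z] g_cspace [OF v] by (simp add: unrolled_step_def rk_update_def cspace_def)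
  show "vdist D (unrolled_step sol I a b L D h g z) z \<le> h * A * m"
  proof (rule vdist_leI)
    fix k
    have "cmod (of_real h * (\<Sum>i<I. of_real (b i) * g (?v i) k)) \<le> cmod (of_real h) * A * m"
      by (rule weighted_sum_le [OF cmod_g_le m_nonneg col_le]) (rule v)
    then show "cmod (unrolled_step sol I a b L D h g z k - z k) \<le> h * A * m"
      using h by (simp add: unrolled_step_def rk_update_def)
  qed (use h A_ge m_nonneg in simp)
qed

lemma unrolled_step_holo: "holo_map (inset D S (2 * \<rho>)) (unrolled_step sol I a b L D h g)"
  unfolding holo_map_def
proof (intro allI impI)
  fix U z assume U: "open U" and z: "\<forall>\<tau>\<in>U. z \<tau> \<in> inset D S (2 * \<rho>)" "holo_curve U z"
  have "holo_curve U (\<lambda>\<tau>. g (unrolled_stages sol I a D h g (z \<tau>) L i))" if "i < I" for i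
    by (rule holo_mapD [OF holo_map_g U _ unrolled_stages_holo [OF U z(2) _ h that]])
       (use z unrolled_stages_near [OF _ h that] near_S in blast)+
  then show "holo_curve U (\<lambda>\<tau>. unrolled_step sol I a b L D h g (z \<tau>))"
    using z(2) by (auto simp: unrolled_step_def rk_update_def holo_curve_def intro!: holomorphic_intros)
qed

text \<open>The last evaluation of g gains one more power of h/H over the stages. With the factor h
  in front the error is of order Lstar + 2 in h, which is why \<open>Lstar sol L + 1\<close> has to
  reach p.\<close>

lemma unrolled_step_close:
  assumes z: "z \<in> inset D S (2 * \<rho>)"
  shows "cmod (unrolled_step sol I a b L D h g z k - rk_exact (of_real h) z k)
    \<le> h * A * m * (h / H) ^ (Lstar sol L + 1)"
proof -
  let ?v = "unrolled_stages sol I a D h g z L"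
  have h': "cmod (of_real h) \<le> H" using h by simp
  define e where "e = h * A * m * (h / H) ^ Lstar sol L"
  have e: "0 \<le> e" using h A_ge m_nonneg H_pos by (simp add: e_def)
  have "unrolled_step sol I a b L D h g z k - rk_exact (of_real h) z k =
      of_real h * (\<Sum>i<I. of_real (b i) * (g (?v i) k - g (stg (of_real h) z i) k))"
    by (simp add: unrolled_step_def rk_update_def rk_exact_def right_diff_distrib sum_subtractf)
  also have "cmod \<dots> \<le> cmod (of_real h) * A * (2 * m * e / \<rho>)"
  proof (rule weighted_sum_le [OF _ _ col_le])
    fix i assume i: "i < I"
    have "cmod (g (?v i) k - g (stg (of_real h) z i) k) \<le> 2 * m * vdist D (?v i) (stg (of_real h) z i) / \<rho>"
      by (intro cmod_g_diff_le stg(3) [OF z h'] near_S [OF z] unrolled_stages_near [OF z h i])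
    also have "\<dots> \<le> 2 * m * e / \<rho>"
      using unrolled_stages_close [OF z h i, of sol L] m_nonneg \<rho>_pos
      by (intro divide_right_mono mult_left_mono) (auto simp: e_def)
    finally show "cmod (g (?v i) k - g (stg (of_real h) z i) k) \<le> 2 * m * e / \<rho>" .
  qed (use e m_nonneg \<rho>_pos in simp)
  also have "\<dots> = 2 * (h * A * m / \<rho>) * e" using h by simp
  also have "\<dots> \<le> (h / H) * e"
  proof (rule mult_right_mono [OF _ e])
    have *: "2 * t \<le> u" if "0 \<le> t" "16 * t \<le> u" for t u :: real using that by linarith
    have "0 \<le> h * A * m / \<rho>" using h A_ge m_nonneg \<rho>_pos by simp
    then show "2 * (h * A * m / \<rho>) \<le> h / H"
      using step_ratio [OF less_imp_le [OF h(1)]] by (rule *)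
  qed
  finally show ?thesis by (simp add: e_def mult_ac)
qed

end

end

section \<open>The flow\<close>

text \<open>The derivative is bounded on the open interval only, so that the estimate can be used up
  to a first exit time.\<close>

lemma vector_mean_value_bound:
  fixes w :: "real \<Rightarrow> 'a::euclidean_space"
  assumes w: "\<And>t. t \<in> {0..T} \<Longrightarrow> (w has_vector_derivative w' t) (at t within {0..T})"
    and B: "\<And>t. 0 < t \<Longrightarrow> t < s \<Longrightarrow> norm (w' t) \<le> B" and s: "0 \<le> s" "s \<le> T"
  shows "norm (w s - w 0) \<le> B * s"
proof (cases "s = 0")
  case False
  have w_sub: "(w has_vector_derivative w' t) (at t within {0..s})" if "t \<in> {0..s}" for t
    by (rule has_vector_derivative_within_subset [OF w]) (use that s in auto)
  have "norm (w s - w 0) \<le> B * s - B * 0"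
  proof (rule differentiable_bound_general [where f' = w' and \<phi>' = "\<lambda>_. B"])
    show "continuous_on {0..s} w"
      using w_sub by (rule continuous_on_vector_derivative)
    show "(w has_vector_derivative w' t) (at t)" if "0 < t" "t < s" for t
      using w_sub [of t] that by (simp add: at_within_Icc_at)
    show "((\<lambda>t. B * t) has_vector_derivative B) (at t)" for t
      by (auto intro!: derivative_eq_intros)
  qed (use B s False in \<open>auto intro!: continuous_intros\<close>)
  then show ?thesis by simp
qed simp

lemma integral_norm_le:
  fixes q :: "real \<Rightarrow> complex"
  assumes "continuous_on {c..d} q" "c \<le> d" "0 \<le> B" "\<And>t. t \<in> {c..d} \<Longrightarrow> norm (q t) \<le> B"
  shows "norm (integral {c..d} q) \<le> B * (d - c)"
  using has_integral_bound [OF assms(3) integrable_integral [OF integrable_continuous_real [OF assms(1)],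
        folded cbox_interval]] assms(2,4) by simp

text \<open>Extends trajectories from the unit interval to all reals, so that Lipschitz conditions need no
  side condition.\<close>

definition clamp01 :: "real \<Rightarrow> real" where
  "clamp01 \<sigma> = max 0 (min 1 \<sigma>)"

lemma clamp01: "clamp01 \<sigma> \<in> {0..1}" "\<bar>clamp01 \<sigma> - clamp01 \<sigma>'\<bar> \<le> \<bar>\<sigma> - \<sigma>'\<bar>"
  "\<sigma> \<in> {0..1} \<Longrightarrow> clamp01 \<sigma> = \<sigma>"
  by (auto simp: clamp01_def)

text \<open>Euler points are obtained by applying g finitely often, so reality and holomorphic
  dependence on initial value and step size are immediate for them. Both properties pass to the flow
  in the limit.\<close>

primrec euler :: "(cvec \<Rightarrow> cvec) \<Rightarrow> complex \<Rightarrow> cvec \<Rightarrow> nat \<Rightarrow> cvec" where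
  "euler g h z 0 = z"
| "euler g h z (Suc i) = (\<lambda>k. euler g h z i k + h * g (euler g h z i) k)"

lemma rspace_cspace: "rspace D \<subseteq> cspace D"
  by (auto simp: rspace_def)

lemma euler_real:
  fixes h :: real
  assumes g: "real_field D g" and z: "z \<in> rspace D"
  shows "euler g (of_real h) z i \<in> rspace D"
proof (induction i)
  case 0
  then show ?case using z by simp
next
  case (Suc i)
  then have "g (euler g (of_real h) z i) \<in> rspace D" using g by (auto simp: real_field_def)
  with Suc show ?case by (auto simp: rspace_def cspace_def)
qed

section \<open>Trajectories for complex times\<close>

context rk_field
begin

lemma flow_small: "0 \<le> h \<Longrightarrow> h \<le> H \<Longrightarrow> 16 * (h * m) \<le> \<rho>"
proof -
  assume h: "0 \<le> h" "h \<le> H"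
  have "h * m * 1 \<le> h * m * A" using A_ge h m_nonneg by (intro mult_left_mono) auto
  then show ?thesis using step_small [OF h(2)] by (simp add: mult_ac)
qed

text \<open>The Lipschitz condition in time survives pointwise limits, as continuity alone would
  not, and makes the integrands in \<open>picard\<close> continuous.\<close>

definition traj_set :: "complex \<Rightarrow> cvec \<Rightarrow> (real \<Rightarrow> cvec) set" where
  "traj_set h z = {Y. \<forall>\<sigma>. Y \<sigma> \<in> cspace D \<and> vdist D (Y \<sigma>) z \<le> \<rho> \<and>
     (\<forall>\<sigma>'. vdist D (Y \<sigma>) (Y \<sigma>') \<le> cmod h * m * \<bar>\<sigma> - \<sigma>'\<bar>)}"

lemma traj_setD:
  assumes "Y \<in> traj_set h z"
  shows "Y \<sigma> \<in> cspace D" "vdist D (Y \<sigma>) z \<le> \<rho>" "vdist D (Y \<sigma>) (Y \<sigma>') \<le> cmod h * m * \<bar>\<sigma> - \<sigma>'\<bar>"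
  using assms by (auto simp: traj_set_def)

lemma traj_field_continuous:
  assumes z: "z \<in> inset D S (2 * \<rho>)" and Y: "Y \<in> traj_set h z"
  shows "continuous_on X (\<lambda>\<sigma>. g (Y \<sigma>) k)"
proof (rule lipschitz_on_continuous_on, rule lipschitz_onI)
  fix \<sigma> \<sigma>'
  have "dist (g (Y \<sigma>) k) (g (Y \<sigma>') k) \<le> 2 * m * vdist D (Y \<sigma>) (Y \<sigma>') / \<rho>"
    unfolding dist_norm
    by (intro cmod_g_diff_le near_inner [OF z] near_S [OF z] traj_setD [OF Y])
  also have "\<dots> \<le> 2 * m * (cmod h * m * \<bar>\<sigma> - \<sigma>'\<bar>) / \<rho>"
    using m_nonneg \<rho>_pos by (intro divide_right_mono mult_left_mono traj_setD(3) [OF Y]) auto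
  finally show "dist (g (Y \<sigma>) k) (g (Y \<sigma>') k) \<le> 2 * m * (cmod h * m) / \<rho> * dist \<sigma> \<sigma>'"
    by (simp add: dist_real_def mult_ac)
qed (use m_nonneg \<rho>_pos in simp)

text \<open>The integral equation of y' = h g(y) on the unit interval; the time h has become a
  factor.\<close>

definition picard :: "complex \<Rightarrow> cvec \<Rightarrow> (real \<Rightarrow> cvec) \<Rightarrow> real \<Rightarrow> cvec" where
  "picard h z Y = (\<lambda>\<sigma> k. z k + h * integral {0..clamp01 \<sigma>} (\<lambda>s. g (Y s) k))"

lemma picard_lipschitz:
  assumes z: "z \<in> inset D S (2 * \<rho>)" and Y: "Y \<in> traj_set h z"
  shows "cmod (picard h z Y \<sigma> k - picard h z Y \<sigma>' k) \<le> cmod h * m * \<bar>\<sigma> - \<sigma>'\<bar>"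
proof (induction \<sigma> \<sigma>' rule: linorder_wlog)
  case (le \<sigma> \<sigma>')
  let ?c = "clamp01 \<sigma>" and ?d = "clamp01 \<sigma>'" and ?q = "\<lambda>s. g (Y s) k"
  note cont = traj_field_continuous [OF z Y, of _ k]
  have cd: "0 \<le> ?c" "?c \<le> ?d" using le by (auto simp: clamp01_def)
  have "picard h z Y \<sigma> k - picard h z Y \<sigma>' k = h * - integral {?c..?d} ?q"
    using Henstock_Kurzweil_Integration.integral_combine [OF cd integrable_continuous_real [OF cont]]
    by (simp add: picard_def algebra_simps flip: distrib_left)
  then have "cmod (picard h z Y \<sigma> k - picard h z Y \<sigma>' k) = cmod h * cmod (integral {?c..?d} ?q)"
    by (simp add: norm_mult)
  also have "\<dots> \<le> cmod h * (m * (?d - ?c))"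
    by (intro mult_left_mono integral_norm_le cont cd m_nonneg cmod_g_le near_S [OF z] traj_setD [OF Y])
       simp
  also have "\<dots> \<le> cmod h * (m * \<bar>\<sigma> - \<sigma>'\<bar>)"
    using clamp01(2) [of \<sigma>' \<sigma>] m_nonneg by (intro mult_left_mono) auto
  finally show ?case by (simp add: mult.assoc)
next
  case (sym \<sigma> \<sigma>')
  then show ?case by (simp add: norm_minus_commute abs_minus_commute)
qed

lemma picard_start: "picard h z Y 0 = z"
  by (simp add: picard_def clamp01_def)

lemma picard_traj_set:
  assumes z: "z \<in> inset D S (2 * \<rho>)" and h: "cmod h \<le> H" and Y: "Y \<in> traj_set h z"
  shows "picard h z Y \<in> traj_set h z"
proof -
  have "picard h z Y \<sigma> \<in> cspace D" for \<sigma>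
    using inset_cspace [OF z] g_cspace [OF near_S [OF z traj_setD(1,2) [OF Y]]]
    by (simp add: picard_def cspace_def)
  moreover have "vdist D (picard h z Y \<sigma>) z \<le> \<rho>" for \<sigma>
  proof (rule vdist_leI)
    fix k
    have clamp_eq: "picard h z Y \<sigma> = picard h z Y (clamp01 \<sigma>)"
      using clamp01(3) [OF clamp01(1) [of \<sigma>]] by (simp add: picard_def)
    have "cmod (picard h z Y \<sigma> k - z k) \<le> cmod h * m * \<bar>clamp01 \<sigma>\<bar>"
      using picard_lipschitz [OF z Y, of "clamp01 \<sigma>" k 0] by (simp add: picard_start clamp_eq)
    also have "\<dots> \<le> cmod h * m * 1"
      using clamp01(1) [of \<sigma>] m_nonneg by (intro mult_left_mono) auto
    also have "\<dots> \<le> \<rho>" using flow_small [OF _ h] \<rho>_pos by simp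
    finally show "cmod (picard h z Y \<sigma> k - z k) \<le> \<rho>" .
  qed (use \<rho>_pos in simp)
  moreover have "vdist D (picard h z Y \<sigma>) (picard h z Y \<sigma>') \<le> cmod h * m * \<bar>\<sigma> - \<sigma>'\<bar>" for \<sigma> \<sigma>'
    by (rule vdist_leI) (use m_nonneg picard_lipschitz [OF z Y] in auto)
  ultimately show ?thesis by (simp add: traj_set_def)
qed

lemma picard_fixed_point:
  assumes z: "z \<in> inset D S (2 * \<rho>)" and h: "cmod h \<le> H"
  shows "\<exists>Y. Y \<in> traj_set h z \<and> picard h z Y = Y"
proof -
  have zc: "z \<in> cspace D" using z by (rule inset_cspace)
  have const: "(\<lambda>\<sigma>. z) \<in> traj_set h z"
    using zc \<rho>_pos m_nonneg by (simp add: traj_set_def)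
  obtain Y where "Y \<in> traj_set h z" "picard h z Y = Y"
  proof (rule contraction_fixed_point [OF const picard_traj_set [OF z h]])
    fix X :: "nat \<Rightarrow> real \<Rightarrow> cvec" and w
    assume X: "\<And>n. X n \<in> traj_set h z" and lim: "\<And>i k. (\<lambda>n. X n i k) \<longlonglongrightarrow> w i k"
    show "w \<in> traj_set h z"
      unfolding traj_set_def
      by (auto intro: cspace_limit [OF lim traj_setD(1) [OF X]]
          vdist_limit_le [OF lim tendsto_const traj_setD(2) [OF X]]
          vdist_limit_le [OF lim lim traj_setD(3) [OF X]])
  next
    fix w w' :: "real \<Rightarrow> cvec" and B \<sigma> k
    assume w: "w \<in> traj_set h z" and w': "w' \<in> traj_set h z" and d: "\<And>i k. cmod (w i k - w' i k) \<le> B"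
    have B: "0 \<le> B" using d norm_ge_zero order_trans by blast
    note cont = traj_field_continuous [OF z w, of _ k] traj_field_continuous [OF z w', of _ k]
    note int = integrable_continuous_real [OF cont(1)] integrable_continuous_real [OF cont(2)]
    have "picard h z w \<sigma> k - picard h z w' \<sigma> k = h * integral {0..clamp01 \<sigma>} (\<lambda>s. g (w s) k - g (w' s) k)"
      by (simp add: picard_def right_diff_distrib integral_diff int)
    also have "cmod \<dots> \<le> cmod h * (2 * m * B / \<rho> * (clamp01 \<sigma> - 0))"
      unfolding norm_mult
    proof (intro mult_left_mono integral_norm_le)
      fix s
      have "cmod (g (w s) k - g (w' s) k) \<le> 2 * m * vdist D (w s) (w' s) / \<rho>"
        by (intro cmod_g_diff_le near_inner [OF z] near_S [OF z] traj_setD [OF w] traj_setD [OF w'])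
      also have "\<dots> \<le> 2 * m * B / \<rho>"
        using m_nonneg \<rho>_pos B d by (intro divide_right_mono mult_left_mono vdist_leI) auto
      finally show "cmod (g (w s) k - g (w' s) k) \<le> 2 * m * B / \<rho>" .
    qed (use clamp01(1) [of \<sigma>] m_nonneg \<rho>_pos B cont in \<open>auto intro!: continuous_intros\<close>)
    also have "\<dots> \<le> cmod h * (2 * m * B / \<rho> * 1)"
      using clamp01(1) [of \<sigma>] m_nonneg \<rho>_pos B by (intro mult_left_mono) auto
    also have "\<dots> \<le> cmod h * A * (2 * m * B / \<rho>)"
    proof -
      have "cmod h * 1 * (2 * m * B / \<rho>) \<le> cmod h * A * (2 * m * B / \<rho>)"
        using A_ge m_nonneg \<rho>_pos B by (intro mult_right_mono mult_left_mono) auto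
      then show ?thesis by simp
    qed
    also have "\<dots> \<le> B / 2" by (rule scaled_lipschitz [OF h B])
    finally show "cmod (picard h z w \<sigma> k - picard h z w' \<sigma> k) \<le> B / 2" .
  next
    fix w w' :: "real \<Rightarrow> cvec" and i k
    assume w: "w \<in> traj_set h z" "w' \<in> traj_set h z"
    show "cmod (w i k - w' i k) \<le> 2 * \<rho>"
    proof (cases "k < D")
      case True
      have "cmod (w i k - w' i k) \<le> vdist D (w i) (w' i)" by (rule cmod_le_vdist [OF True])
      also have "\<dots> \<le> vdist D (w i) z + vdist D z (w' i)" by (rule vdist_triangle)
      also have "\<dots> \<le> \<rho> + \<rho>"
        using traj_setD(2) [OF w(1)] traj_setD(2) [OF w(2)]
        by (intro add_mono) (auto simp: vdist_commute)
      finally show ?thesis by simp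
    next
      case False
      then show ?thesis using traj_setD(1) [OF w(1), of i] traj_setD(1) [OF w(2), of i] \<rho>_pos
        by (simp add: cspace_def)
    qed
  next
    fix w assume "w \<in> traj_set h z" "picard h z w = w"
    then show thesis by (rule that)
  qed
  then show ?thesis by blast
qed

text \<open>The flow for time h, reparametrised to the unit interval, so that h may be complex.\<close>

definition traj :: "complex \<Rightarrow> cvec \<Rightarrow> real \<Rightarrow> cvec" where
  "traj h z = (SOME Y. Y \<in> traj_set h z \<and> picard h z Y = Y)"

context
  fixes h z assumes z: "z \<in> inset D S (2 * \<rho>)" and h: "cmod h \<le> H"
begin

lemma traj_mem: "traj h z \<in> traj_set h z" and traj_picard: "picard h z (traj h z) = traj h z"
  using someI_ex [OF picard_fixed_point [OF z h], folded traj_def] by simp_all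

lemma traj_cspace: "traj h z \<sigma> \<in> cspace D"
  by (rule traj_setD(1) [OF traj_mem])

lemma traj_near: "vdist D (traj h z \<sigma>) z \<le> \<rho>"
  by (rule traj_setD(2) [OF traj_mem])

lemma traj_inner: "traj h z \<sigma> \<in> inset D S \<rho>"
  by (rule near_inner [OF z traj_cspace traj_near])

lemma traj_start: "traj h z 0 = z"
  using picard_start [of h z "traj h z"] by (simp add: traj_picard)

lemma traj_derivative:
  assumes "\<sigma> \<in> {0..1}"
  shows "((\<lambda>\<sigma>. traj h z \<sigma> k) has_vector_derivative h * g (traj h z \<sigma>) k) (at \<sigma> within {0..1})"
proof -
  have "((\<lambda>u. integral {0..u} (\<lambda>s. g (traj h z s) k)) has_vector_derivative g (traj h z \<sigma>) k)
      (at \<sigma> within {0..1})"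
    by (rule integral_has_vector_derivative [OF traj_field_continuous [OF z traj_mem] assms])
  then have "((\<lambda>u. z k + h * integral {0..u} (\<lambda>s. g (traj h z s) k)) has_vector_derivative
      0 + h * g (traj h z \<sigma>) k) (at \<sigma> within {0..1})"
    by (intro has_vector_derivative_add has_vector_derivative_const has_vector_derivative_mult_right)
  moreover have "z k + h * integral {0..u} (\<lambda>s. g (traj h z s) k) = traj h z u k" if "u \<in> {0..1}" for u
    using fun_cong [OF fun_cong [OF traj_picard], of u k] clamp01(3) [OF that] by (simp add: picard_def)
  ultimately show ?thesis
    using assms by (simp cong: has_vector_derivative_cong_ev)
      (rule has_vector_derivative_transform [OF assms], auto)
qed

text \<open>Along the trajectory the velocity \<open>h * g\<close> is Lipschitz in \<sigma> with
  constant \<open>2 * (cmod h * m)\<^sup>2 / \<rho>\<close>. This is the truncation error of an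
  Euler step; over the whole interval it is the expansion that gives the derivative of the flow at
  time 0.\<close>

lemma traj_local_error:
  assumes "0 \<le> \<sigma>" "0 \<le> \<delta>" "\<sigma> + \<delta> \<le> 1"
  shows "cmod (traj h z (\<sigma> + \<delta>) k - traj h z \<sigma> k - \<delta> * (h * g (traj h z \<sigma>) k))
    \<le> \<delta>\<^sup>2 * (2 * (cmod h * m)\<^sup>2 / \<rho>)"
proof -
  have "norm (traj h z (\<sigma> + \<delta>) k - traj h z \<sigma> k - (\<sigma> + \<delta> - \<sigma>) *\<^sub>R (h * g (traj h z \<sigma>) k))
      \<le> norm (\<sigma> + \<delta> - \<sigma>) * (cmod h * (2 * m * (cmod h * m * \<delta>) / \<rho>))"
  proof (rule vector_differentiable_bound_linearization [where S = "{\<sigma>..\<sigma> + \<delta>}"])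
    fix s assume s: "s \<in> {\<sigma>..\<sigma> + \<delta>}"
    show "((\<lambda>\<sigma>. traj h z \<sigma> k) has_vector_derivative h * g (traj h z s) k) (at s within {\<sigma>..\<sigma> + \<delta>})"
      by (rule has_vector_derivative_within_subset [OF traj_derivative]) (use s assms in auto)
    have "cmod (g (traj h z s) k - g (traj h z \<sigma>) k) \<le> 2 * m * vdist D (traj h z s) (traj h z \<sigma>) / \<rho>"
      by (intro cmod_g_diff_le traj_inner near_S [OF z] traj_cspace traj_near)
    also have "\<dots> \<le> 2 * m * (cmod h * m * \<delta>) / \<rho>"
    proof (intro divide_right_mono mult_left_mono)
      have "vdist D (traj h z s) (traj h z \<sigma>) \<le> cmod h * m * \<bar>s - \<sigma>\<bar>"
        by (rule traj_setD(3) [OF traj_mem])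
      also have "\<dots> \<le> cmod h * m * \<delta>"
        using s m_nonneg by (intro mult_left_mono) auto
      finally show "vdist D (traj h z s) (traj h z \<sigma>) \<le> cmod h * m * \<delta>" .
    qed (use m_nonneg \<rho>_pos in auto)
    finally have "cmod h * cmod (g (traj h z s) k - g (traj h z \<sigma>) k)
        \<le> cmod h * (2 * m * (cmod h * m * \<delta>) / \<rho>)" by (rule mult_left_mono) simp
    then show "norm (h * g (traj h z s) k - h * g (traj h z \<sigma>) k) \<le> cmod h * (2 * m * (cmod h * m * \<delta>) / \<rho>)"
      by (simp add: norm_mult flip: right_diff_distrib)
  qed (use assms in \<open>auto simp: closed_segment_eq_real_ivl\<close>)
  then show ?thesis using assms(2)
    by (simp add: power2_eq_square scaleR_conv_of_real mult_ac)
qed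

lemma traj_first_order:
  "cmod (traj h z 1 k - z k - h * g z k) \<le> 2 * (cmod h * m)\<^sup>2 / \<rho>"
  using traj_local_error [of 0 1 k] by (simp add: traj_start)

lemma traj_displacement: "cmod (traj h z 1 k - z k) \<le> cmod h * m"
proof -
  have "norm (traj h z 1 k - traj h z 0 k) \<le> cmod h * m * 1"
  proof (rule vector_mean_value_bound [OF traj_derivative])
    show "norm (h * g (traj h z t) k) \<le> cmod h * m" for t
      using cmod_g_le [of "traj h z t" k] traj_inner [of t] inner_S
      by (auto simp: norm_mult intro!: mult_left_mono)
  qed auto
  then show ?thesis by (simp add: traj_start)
qed

context
  fixes N :: nat assumes N: "0 < N"
begin

abbreviation (input) euler_point :: "nat \<Rightarrow> cvec" where
  "euler_point \<equiv> euler g (h / of_nat N) z"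

lemma euler_near:
  "i \<le> N \<Longrightarrow> euler_point i \<in> cspace D \<and> vdist D (euler_point i) z \<le> real i / real N * (cmod h * m)"
proof (induction i)
  case 0
  then show ?case using inset_cspace [OF z] by simp
next
  case (Suc i)
  then have IH: "euler_point i \<in> cspace D" "vdist D (euler_point i) z \<le> real i / real N * (cmod h * m)"
    by auto
  have "real i / real N * (cmod h * m) \<le> 1 * (cmod h * m)"
    using Suc.prems N m_nonneg by (intro mult_right_mono) auto
  then have "vdist D (euler_point i) z \<le> \<rho>" using IH(2) flow_small [OF _ h] \<rho>_pos by simp
  then have iS: "euler_point i \<in> S" by (rule near_S [OF z IH(1)])
  have "vdist D (euler_point (Suc i)) z \<le> vdist D (euler_point (Suc i)) (euler_point i) + vdist D (euler_point i) z"
    by (rule vdist_triangle)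
  also have "\<dots> \<le> cmod h / real N * m + real i / real N * (cmod h * m)"
  proof (rule add_mono [OF vdist_leI IH(2)])
    show "cmod (euler_point (Suc i) k - euler_point i k) \<le> cmod h / real N * m" for k
      using mult_left_mono [OF cmod_g_le [OF iS, of k], of "cmod h / real N"]
      by (simp add: norm_mult norm_divide)
  qed (use m_nonneg in simp)
  also have "\<dots> = real (Suc i) / real N * (cmod h * m)" using N by (simp add: field_simps)
  finally show ?case using IH(1) g_cspace [OF iS] by (simp add: cspace_def)
qed

lemma euler_S: "i \<le> N \<Longrightarrow> euler_point i \<in> S"
proof -
  assume i: "i \<le> N"
  have "real i / real N * (cmod h * m) \<le> 1 * (cmod h * m)"
    using i N m_nonneg by (intro mult_right_mono) auto
  then have "vdist D (euler_point i) z \<le> \<rho>"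
    using euler_near [OF i] flow_small [OF _ h] \<rho>_pos by simp
  then show ?thesis using near_S [OF z] euler_near [OF i] by blast
qed

text \<open>Errors accumulate linearly and no Gronwall exponential appears. The inductive bound is
  at most 2K/N throughout, so a step amplifies the error by at most K/N^2, the size of its
  truncation error; each step thus adds at most 2K/N^2.\<close>

lemma euler_error:
  assumes "i \<le> N"
  shows "vdist D (euler_point i) (traj h z (real i / real N))
    \<le> real i / real N * (2 * (2 * (cmod h * m)\<^sup>2 / \<rho>) / real N)"
  using assms
proof (induction i)
  case 0
  then show ?case by (simp add: traj_start)
next
  case (Suc i)
  define K where "K = 2 * (cmod h * m)\<^sup>2 / \<rho>"
  have K: "0 \<le> K" using \<rho>_pos by (simp add: K_def)
  let ?\<sigma> = "real i / real N"
  have IH: "vdist D (euler_point i) (traj h z ?\<sigma>) \<le> ?\<sigma> * (2 * K / real N)"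
    using Suc by (simp add: K_def)
  have "?\<sigma> * (2 * K / real N) \<le> 1 * (2 * K / real N)"
    using Suc.prems N K by (intro mult_right_mono) auto
  then have dist: "vdist D (euler_point i) (traj h z ?\<sigma>) \<le> 2 * K / real N" using IH by simp
  have iS: "euler_point i \<in> S" using euler_S Suc.prems by simp
  have next_eq: "real (Suc i) / real N = ?\<sigma> + 1 / real N" by (simp add: add_divide_distrib)
  have "vdist D (euler_point (Suc i)) (traj h z (?\<sigma> + 1 / real N))
      \<le> ?\<sigma> * (2 * K / real N) + 1 / real N * (2 * K / real N)"
  proof (rule vdist_leI)
    fix k assume k: "k < D"
    let ?e = "euler_point i" and ?y = "traj h z ?\<sigma>"
    have eq: "euler_point (Suc i) k - traj h z (?\<sigma> + 1 / real N) k =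
        (?e k - ?y k) + h / of_nat N * (g ?e k - g ?y k)
        - (traj h z (?\<sigma> + 1 / real N) k - ?y k - of_real (1 / real N) * (h * g ?y k))"
    proof -
      have "(e + c * p) - y' = (e - y) + c * (p - q) - (y' - y - c * q)" for e c p q y y' :: complex
        by (simp add: algebra_simps)
      moreover have "of_real (1 / real N) * (h * g ?y k) = h / of_nat N * g ?y k" by simp
      ultimately show ?thesis by (simp only: euler.simps)
    qed
    have "cmod (euler_point (Suc i) k - traj h z (?\<sigma> + 1 / real N) k) \<le>
        cmod (?e k - ?y k) + cmod (h / of_nat N * (g ?e k - g ?y k))
        + cmod (traj h z (?\<sigma> + 1 / real N) k - ?y k - of_real (1 / real N) * (h * g ?y k))"
      unfolding eq by (rule order_trans [OF norm_triangle_ineq4 add_right_mono [OF norm_triangle_ineq]])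
    also have "\<dots> \<le> ?\<sigma> * (2 * K / real N) + 1 / real N * (2 * K / real N / 2) + (1 / real N)\<^sup>2 * K"
    proof (intro add_mono)
      show "cmod (?e k - ?y k) \<le> ?\<sigma> * (2 * K / real N)"
        using cmod_le_vdist [OF k] IH by (rule order_trans)
      have "cmod h * cmod (g ?e k - g ?y k) \<le> 2 * K / real N / 2"
      proof -
        have "cmod (g ?e k - g ?y k) \<le> 2 * m * vdist D ?e ?y / \<rho>"
          by (rule cmod_g_diff_le [OF traj_inner iS])
        also have "\<dots> \<le> 2 * m * (2 * K / real N) / \<rho>"
          using m_nonneg \<rho>_pos dist by (intro divide_right_mono mult_left_mono) auto
        finally have "cmod h * cmod (g ?e k - g ?y k) \<le> cmod h * 1 * (2 * m * (2 * K / real N) / \<rho>)"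
          unfolding mult_1_right by (rule mult_left_mono) simp
        also have "\<dots> \<le> cmod h * A * (2 * m * (2 * K / real N) / \<rho>)"
          using A_ge m_nonneg \<rho>_pos K by (intro mult_right_mono mult_left_mono) auto
        also have "\<dots> \<le> 2 * K / real N / 2" by (rule scaled_lipschitz [OF h]) (use K in simp)
        finally show ?thesis .
      qed
      then have "1 / real N * (cmod h * cmod (g ?e k - g ?y k)) \<le> 1 / real N * (2 * K / real N / 2)"
        by (rule mult_left_mono) simp
      then show "cmod (h / of_nat N * (g ?e k - g ?y k)) \<le> 1 / real N * (2 * K / real N / 2)"
        by (simp add: norm_mult norm_divide)
      show "cmod (traj h z (?\<sigma> + 1 / real N) k - ?y k - of_real (1 / real N) * (h * g ?y k))
          \<le> (1 / real N)\<^sup>2 * K"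
        unfolding K_def
      proof (rule traj_local_error)
        show "?\<sigma> + 1 / real N \<le> 1" unfolding next_eq [symmetric] using Suc.prems N by simp
      qed simp_all
    qed
    also have "\<dots> = ?\<sigma> * (2 * K / real N) + 1 / real N * (2 * K / real N)"
    proof -
      have "1 / n * (2 * K / n / 2) + (1 / n)\<^sup>2 * K = 1 / n * (2 * K / n)" for n :: real
        by (simp add: power2_eq_square)
      then show ?thesis by (simp only: add.assoc)
    qed
    finally show "cmod (euler_point (Suc i) k - traj h z (?\<sigma> + 1 / real N) k)
        \<le> ?\<sigma> * (2 * K / real N) + 1 / real N * (2 * K / real N)" .
  qed (use K in simp)
  then show ?case unfolding next_eq K_def [symmetric] by (simp only: distrib_right)
qed

lemma euler_final: "cmod (euler_point N k - traj h z 1 k) \<le> 4 * (H * m)\<^sup>2 / \<rho> * inverse (real N)"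
proof (cases "k < D")
  case True
  have "cmod (euler_point N k - traj h z 1 k) \<le> 1 * (2 * (2 * (cmod h * m)\<^sup>2 / \<rho>) / real N)"
    using order_trans [OF cmod_le_vdist [OF True] euler_error [OF order_refl]] N by simp
  also have "\<dots> \<le> 1 * (2 * (2 * (H * m)\<^sup>2 / \<rho>) / real N)"
    using h m_nonneg \<rho>_pos
    by (intro mult_left_mono divide_right_mono power_mono mult_right_mono) auto
  also have "\<dots> = 4 * (H * m)\<^sup>2 / \<rho> * inverse (real N)" by (simp add: field_simps)
  finally show ?thesis .
next
  case False
  then show ?thesis
    using euler_near [OF order_refl] traj_cspace [of 1] \<rho>_pos by (simp add: cspace_def)
qed

end

lemma euler_tendsto: "(\<lambda>n. euler g (h / of_nat (Suc n)) z (Suc n) k) \<longlonglongrightarrow> traj h z 1 k"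
proof (rule LIM_zero_cancel, rule tendsto_norm_zero_cancel, rule tendsto_sandwich [where f = "\<lambda>_. 0"])
  show "\<forall>\<^sub>F n in sequentially. cmod (euler g (h / of_nat (Suc n)) z (Suc n) k - traj h z 1 k)
      \<le> 4 * (H * m)\<^sup>2 / \<rho> * inverse (real (Suc n))"
    by (intro always_eventually allI euler_final) simp
  show "(\<lambda>n. 4 * (H * m)\<^sup>2 / \<rho> * inverse (real (Suc n))) \<longlonglongrightarrow> 0"
    by (rule tendsto_mult_right_zero [OF LIMSEQ_inverse_real_of_nat])
qed auto

end

lemma traj_real:
  fixes h :: real
  assumes "real_field D g" "z \<in> rspace D" "z \<in> inset D S (2 * \<rho>)" "\<bar>h\<bar> \<le> H"
  shows "traj (of_real h) z 1 \<in> rspace D"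
proof -
  have h: "cmod (of_real h) \<le> H" using assms(4) by simp
  have "traj (of_real h) z 1 k \<in> \<real>" for k
  proof (rule Lim_in_closed_set [OF closed_complex_Reals _ _ euler_tendsto [OF assms(3) h]])
    show "\<forall>\<^sub>F n in sequentially. euler g (of_real h / of_nat (Suc n)) z (Suc n) k \<in> \<real>"
    proof (rule always_eventually, rule allI)
      fix n
      have "of_real h / of_nat (Suc n) = complex_of_real (h / real (Suc n))" by simp
      then show "euler g (of_real h / of_nat (Suc n)) z (Suc n) k \<in> \<real>"
        using euler_real [OF assms(1,2), of "h / real (Suc n)" "Suc n"] by (simp only: rspace_def mem_Collect_eq)
    qed
  qed simp
  then show ?thesis using traj_cspace [OF assms(3) h] by (simp add: rspace_def)
qed

text \<open>The Euler error at time 1 is O(1/N) with a constant made of H, m and \<rho> alone, hence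
  uniform in the parameter.\<close>

lemma traj_holo:
  assumes U: "open U" and z: "holo_curve U z" "\<And>\<tau>. \<tau> \<in> U \<Longrightarrow> z \<tau> \<in> inset D S (2 * \<rho>)"
    and h: "h holomorphic_on U" "\<And>\<tau>. \<tau> \<in> U \<Longrightarrow> cmod (h \<tau>) \<le> H"
  shows "holo_curve U (\<lambda>\<tau>. traj (h \<tau>) (z \<tau>) 1)"
proof (rule holo_curve_uniform_limit [OF U])
  have "i \<le> Suc n \<Longrightarrow> holo_curve U (\<lambda>\<tau>. euler g (h \<tau> / of_nat (Suc n)) (z \<tau>) i)" for n i
  proof (induction i)
    case 0
    then show ?case using z by simp
  next
    case (Suc i)
    have "holo_curve U (\<lambda>\<tau>. g (euler g (h \<tau> / of_nat (Suc n)) (z \<tau>) i))"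
      by (rule holo_mapD [OF holo_map_g U _ Suc.IH])
         (use Suc.prems in \<open>auto intro!: euler_S [OF z(2) h(2)] simp del: of_nat_Suc\<close>)
    then show ?case using Suc h(1)
      by (auto simp: holo_curve_def simp del: of_nat_Suc intro!: holomorphic_intros)
  qed
  then show "holo_curve U (\<lambda>\<tau>. euler g (h \<tau> / of_nat (Suc n)) (z \<tau>) (Suc n))" for n by blast
  show "(\<lambda>n. 4 * (H * m)\<^sup>2 / \<rho> * inverse (real (Suc n))) \<longlonglongrightarrow> 0"
    by (rule tendsto_mult_right_zero [OF LIMSEQ_inverse_real_of_nat])
  show "cmod (euler g (h \<tau> / of_nat (Suc n)) (z \<tau>) (Suc n) k - traj (h \<tau>) (z \<tau>) 1 k)
      \<le> 4 * (H * m)\<^sup>2 / \<rho> * inverse (real (Suc n))" if "\<tau> \<in> U" for \<tau> n k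
    by (rule euler_final [OF z(2) [OF that] h(2) [OF that]]) simp
qed

section \<open>Solutions of the initial value problem and the flow\<close>

context
  fixes T :: real and z :: cvec
  assumes z: "z \<in> inset D S (2 * \<rho>)" and T: "0 \<le> T" "T \<le> H"
begin

text \<open>The definition of \<open>flow\<close> admits every solution, and nothing is known of g
  off S. Until the first time at which some coordinate reaches distance \<rho> the speed is at most
  m, so the displacement at that time is at most m H, which is below \<rho>.\<close>

lemma ode_solution_near:
  assumes u: "ode_solution D g T u" "u 0 = z" and t: "t \<in> {0..T}"
  shows "vdist D (u t) z < \<rho>"
proof (rule ccontr)
  assume far: "\<not> vdist D (u t) z < \<rho>"
  have deriv: "((\<lambda>\<tau>. u \<tau> k) has_vector_derivative g (u t) k) (at t within {0..T})"
    if "k < D" "t \<in> {0..T}" for k t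
    using u(1) that by (simp add: ode_solution_def)
  define B where "B = (\<Union>k<D. {0..T} \<inter> (\<lambda>t. cmod (u t k - z k)) -` {\<rho>..})"
  have "compact B"
    unfolding B_def compact_eq_bounded_closed
  proof
    show "bounded (\<Union>k<D. {0..T} \<inter> (\<lambda>t. cmod (u t k - z k)) -` {\<rho>..})"
      by (rule bounded_subset [of "{0..T}"]) auto
    show "closed (\<Union>k<D. {0..T} \<inter> (\<lambda>t. cmod (u t k - z k)) -` {\<rho>..})"
    proof (intro closed_UN ballI continuous_closed_preimage continuous_intros)
      show "continuous_on {0..T} (\<lambda>t. u t k)" if "k \<in> {..<D}" for k
        by (rule continuous_on_vector_derivative, rule deriv) (use that in auto)
    qed auto
  qed
  moreover have "B \<noteq> {}"
  proof -
    have "\<exists>k<D. \<rho> \<le> cmod (u t k - z k)"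
      using far \<rho>_pos vnorm_less_iff [OF \<rho>_pos, of D "\<lambda>k. u t k - z k"] by (auto simp: vdist_def not_less)
    then have "t \<in> B" using t by (auto simp: B_def)
    then show ?thesis by blast
  qed
  ultimately obtain t0 where t0: "t0 \<in> B" "\<And>s. s \<in> B \<Longrightarrow> t0 \<le> s"
    using compact_attains_inf by metis
  then obtain k where k: "k < D" "t0 \<in> {0..T}" "\<rho> \<le> cmod (u t0 k - z k)"
    by (auto simp: B_def)
  have "norm (u t0 k - u 0 k) \<le> m * t0"
  proof (rule vector_mean_value_bound [OF deriv])
    fix s assume s: "0 < s" "s < t0"
    then have sT: "s \<in> {0..T}" using k by auto
    have "s \<notin> B" using s t0(2) by force
    then have "cmod (u s j - z j) < \<rho>" if "j < D" for j
      using sT that by (auto simp: B_def not_le)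
    then have "vdist D (u s) z < \<rho>" using \<rho>_pos by (simp add: vdist_def vnorm_less_iff)
    moreover have "u s \<in> cspace D" using u(1) sT by (simp add: ode_solution_def)
    ultimately show "cmod (g (u s) k) \<le> m"
      by (intro cmod_g_le near_S [OF z]) auto
  qed (use k in auto)
  also have "\<dots> \<le> m * H" using k T m_nonneg by (intro mult_left_mono) auto
  also have "\<dots> < \<rho>" using flow_small [of H] H_pos \<rho>_pos m_nonneg by (simp add: mult.commute)
  finally show False using k(3) u(2) by simp
qed

lemma ode_solution_S:
  assumes u: "ode_solution D g T u" "u 0 = z" and t: "t \<in> {0..T}"
  shows "u t \<in> S" "u t \<in> inset D S \<rho>"
proof -
  have "u t \<in> cspace D" using u(1) t by (simp add: ode_solution_def)
  then show "u t \<in> S" "u t \<in> inset D S \<rho>"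
    using near_S [OF z] near_inner [OF z] ode_solution_near [OF u t] by auto
qed

lemma ode_solution_displacement:
  assumes u: "ode_solution D g T u" "u 0 = z" and t: "t \<in> {0..T}"
  shows "vdist D (u t) z \<le> t * m"
proof (rule vdist_leI)
  fix k assume k: "k < D"
  have "norm (u t k - u 0 k) \<le> m * t"
  proof (rule vector_mean_value_bound [where w = "\<lambda>t. u t k" and w' = "\<lambda>t. g (u t) k"])
    show "cmod (g (u s) k) \<le> m" if "0 < s" "s < t" for s
      by (rule cmod_g_le, rule ode_solution_S(1) [OF u]) (use t that in auto)
  qed (use u(1) k t in \<open>auto simp: ode_solution_def\<close>)
  then show "cmod (u t k - z k) \<le> t * m" using u(2) by (simp add: mult.commute)
qed (use t m_nonneg in simp)

text \<open>Integrating the Lipschitz bound over a time of at most H halves any bound on the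
  distance of two solutions; iteration from 2\<rho> leaves 0.\<close>

lemma ode_solution_unique:
  assumes u: "ode_solution D g T u" "u 0 = z" and v: "ode_solution D g T v" "v 0 = z"
    and t: "t \<in> {0..T}"
  shows "u t = v t"
proof -
  have "\<forall>t\<in>{0..T}. vdist D (u t) (v t) \<le> 2 * \<rho> / 2 ^ n" for n
  proof (induction n)
    case 0
    show ?case
    proof
      fix t assume t: "t \<in> {0..T}"
      have "vdist D (u t) (v t) \<le> vdist D (u t) z + vdist D z (v t)" by (rule vdist_triangle)
      also have "\<dots> \<le> \<rho> + \<rho>"
        using ode_solution_near [OF u t] ode_solution_near [OF v t] by (simp add: vdist_commute)
      finally show "vdist D (u t) (v t) \<le> 2 * \<rho> / 2 ^ 0" by simp
    qed
  next
    case (Suc n)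
    define B where "B = 2 * \<rho> / 2 ^ n"
    have B: "0 \<le> B" using \<rho>_pos by (simp add: B_def)
    show ?case
    proof
      fix t assume t: "t \<in> {0..T}"
      have "vdist D (u t) (v t) \<le> B / 2"
      proof (rule vdist_leI)
        fix k assume k: "k < D"
        have "norm ((u t k - v t k) - (u 0 k - v 0 k)) \<le> 2 * m * B / \<rho> * t"
        proof (rule vector_mean_value_bound
            [where w = "\<lambda>t. u t k - v t k" and w' = "\<lambda>t. g (u t) k - g (v t) k"])
          show "((\<lambda>t. u t k - v t k) has_vector_derivative g (u s) k - g (v s) k) (at s within {0..T})"
            if "s \<in> {0..T}" for s
            using u(1) v(1) k that by (intro has_vector_derivative_diff) (auto simp: ode_solution_def)
          fix s assume "0 < s" "s < t"
          then have s: "s \<in> {0..T}" using t by auto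
          have "cmod (g (u s) k - g (v s) k) \<le> 2 * m * vdist D (u s) (v s) / \<rho>"
            by (intro cmod_g_diff_le ode_solution_S [OF u s] ode_solution_S [OF v s])
          also have "\<dots> \<le> 2 * m * B / \<rho>"
            using Suc s m_nonneg \<rho>_pos unfolding B_def by (intro divide_right_mono mult_left_mono) auto
          finally show "cmod (g (u s) k - g (v s) k) \<le> 2 * m * B / \<rho>" .
        qed (use t in auto)
        also have "\<dots> \<le> 2 * m * B / \<rho> * (H * A)"
        proof (rule mult_left_mono)
          have "t * 1 \<le> H * A" using t T A_ge H_pos by (intro mult_mono) auto
          then show "t \<le> H * A" by simp
        qed (use m_nonneg \<rho>_pos B in simp)
        also have "\<dots> \<le> B / 2"
          using scaled_lipschitz [of "of_real H" B] H_pos B by (simp add: mult.commute)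
        finally show "cmod (u t k - v t k) \<le> B / 2" using u(2) v(2) by simp
      qed (use B in simp)
      then show "vdist D (u t) (v t) \<le> 2 * \<rho> / 2 ^ Suc n" by (simp add: B_def mult.commute)
    qed
  qed
  then have le: "vdist D (u t) (v t) \<le> 2 * \<rho> / 2 ^ n" for n using t by blast
  have "(\<lambda>n. 2 * \<rho> / 2 ^ n) \<longlonglongrightarrow> 0"
    using LIMSEQ_divide_realpow_zero [of 2 "2 * \<rho>"] by simp
  then have "vdist D (u t) (v t) \<le> 0"
    by (rule tendsto_lowerbound) (use le in auto)
  then show ?thesis
    by (rule cspace_eqI [rotated 2]) (use u(1) v(1) t in \<open>auto simp: ode_solution_def\<close>)
qed

lemma flow_eqI:
  assumes "ode_solution D g T u" "u 0 = z"
  shows "flow D g T z = u T"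
  unfolding flow_def
proof (rule the_equality)
  show "\<exists>v. ode_solution D g T v \<and> v 0 = z \<and> v T = u T" using assms by blast
  show "y = u T" if "\<exists>v. ode_solution D g T v \<and> v 0 = z \<and> v T = y" for y
    using ode_solution_unique [OF assms] that T by (metis atLeastAtMost_iff order_refl)
qed

end

lemma traj_ode_solution:
  assumes z: "z \<in> inset D S (2 * \<rho>)" and T: "0 < T" "T \<le> H"
  shows "ode_solution D g T (\<lambda>t. traj (of_real T) z (t / T))"
proof -
  have h: "cmod (of_real T) \<le> H" using T by simp
  have img: "(\<lambda>t. t / T) ` {0..T} \<subseteq> {0..1}" using T by auto
  have "((\<lambda>t. traj (of_real T) z (t / T) k) has_vector_derivative g (traj (of_real T) z (t / T)) k)
      (at t within {0..T})" if t: "t \<in> {0..T}" for t k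
  proof -
    have 1: "((\<lambda>t. t / T) has_vector_derivative 1 / T) (at t within {0..T})"
      using T by (auto intro!: derivative_eq_intros simp flip: has_real_derivative_iff_has_vector_derivative)
    have 2: "((\<lambda>\<sigma>. traj (of_real T) z \<sigma> k) has_vector_derivative of_real T * g (traj (of_real T) z (t / T)) k)
        (at (t / T) within (\<lambda>t. t / T) ` {0..T})"
      by (rule has_vector_derivative_within_subset [OF traj_derivative [OF z h] img]) (use t T in auto)
    show ?thesis
      using vector_diff_chain_within [OF 1 2] T by (simp add: o_def scaleR_conv_of_real)
  qed
  then show ?thesis using traj_cspace [OF z h] by (simp add: ode_solution_def)
qed

context
  fixes T :: real and z :: cvec
  assumes z: "z \<in> inset D S (2 * \<rho>)" and T: "0 < T" "T \<le> H"
begin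

lemma flow_traj: "flow D g T z = traj (of_real T) z 1"
  using flow_eqI [OF z _ T(2) traj_ode_solution [OF z T]] traj_start [OF z, of "of_real T"] T by simp

lemma flow_cspace: "flow D g T z \<in> cspace D"
  using traj_cspace [OF z, of "of_real T"] T by (simp add: flow_traj)

lemma flow_near: "vdist D (flow D g T z) z \<le> T * m"
  unfolding flow_traj using traj_displacement [OF z, of "of_real T"] T m_nonneg
  by (intro vdist_leI) auto

end

text \<open>A solution over the whole time is cut at t. Its first part and its shifted second part
  are solutions, and uniqueness identifies them with the flow. The third margin at z pays for the
  displacement up to time t.\<close>

lemma flow_add:
  assumes z: "z \<in> inset D S (3 * \<rho>)" and t: "0 < t" "0 < h" "t + h \<le> H"
  shows "flow D g t z \<in> inset D S (2 * \<rho>)" "flow D g (t + h) z = flow D g h (flow D g t z)"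
proof -
  have z2: "z \<in> inset D S (2 * \<rho>)"
    by (rule inset_shift [OF z inset_cspace [OF z], of \<rho>]) (use \<rho>_pos in auto)
  define u where "u = (\<lambda>\<tau>. traj (of_real (t + h)) z (\<tau> / (t + h)))"
  have "cmod (of_real (t + h)) \<le> H" using t by (simp del: of_real_add)
  then have u: "ode_solution D g (t + h) u" "u 0 = z"
    using traj_ode_solution [OF z2, of "t + h"] traj_start [OF z2, of "of_real (t + h)"] t
    by (simp_all add: u_def del: of_real_add)
  have u_t: "ode_solution D g t u"
    unfolding ode_solution_def
  proof (intro ballI conjI allI impI)
    fix s assume s: "s \<in> {0..t}"
    show "u s \<in> cspace D" using u(1) s t by (simp add: ode_solution_def)
    show "((\<lambda>s. u s k) has_vector_derivative g (u s) k) (at s within {0..t})" if "k < D" for k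
      by (rule has_vector_derivative_within_subset [where S = "{0..t + h}"])
         (use u(1) s t that in \<open>auto simp: ode_solution_def\<close>)
  qed
  have ft: "flow D g t z = u t" by (rule flow_eqI [OF z2 _ _ u_t u(2)]) (use t in auto)
  have "t * m \<le> \<rho>" using flow_small [of t] t m_nonneg \<rho>_pos by simp
  then have "vdist D (u t) z \<le> \<rho>"
    using ode_solution_displacement [OF z2 _ _ u_t u(2), of t] t by simp
  then show *: "flow D g t z \<in> inset D S (2 * \<rho>)"
    unfolding ft by (intro inset_shift [OF z]) (use u(1) t in \<open>auto simp: ode_solution_def\<close>)
  have "ode_solution D g h (\<lambda>\<tau>. u (t + \<tau>))"
    unfolding ode_solution_def
  proof (intro ballI conjI allI impI)
    fix \<tau> assume \<tau>: "\<tau> \<in> {0..h}"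
    show "u (t + \<tau>) \<in> cspace D" using u(1) \<tau> t by (simp add: ode_solution_def)
    fix k assume k: "k < D"
    have 1: "((\<lambda>\<tau>. t + \<tau>) has_vector_derivative 1) (at \<tau> within {0..h})"
      by (auto intro!: derivative_eq_intros simp flip: has_real_derivative_iff_has_vector_derivative)
    have 2: "((\<lambda>s. u s k) has_vector_derivative g (u (t + \<tau>)) k) (at (t + \<tau>) within (\<lambda>\<tau>. t + \<tau>) ` {0..h})"
      by (rule has_vector_derivative_within_subset [where S = "{0..t + h}"])
         (use u(1) \<tau> t k in \<open>auto simp: ode_solution_def\<close>)
    show "((\<lambda>\<tau>. u (t + \<tau>) k) has_vector_derivative g (u (t + \<tau>)) k) (at \<tau> within {0..h})"
      using vector_diff_chain_within [OF 1 2] by (simp add: o_def)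
  qed
  from flow_eqI [OF * _ _ this] t show "flow D g (t + h) z = flow D g h (flow D g t z)"
    using flow_eqI [OF z2 _ _ u] by (simp add: ft)
qed

end

section \<open>Numerical differentiation and orders of error\<close>

text \<open>Pascal's rule: an alternating sum of order n + 1 is one of order n over first
  differences.\<close>

lemma alternating_binomial_Suc:
  fixes q :: "nat \<Rightarrow> real"
  shows "(\<Sum>k\<le>Suc n. (- 1) ^ k * real (Suc n choose k) * q k)
    = (\<Sum>k\<le>n. (- 1) ^ k * real (n choose k) * (q k - q (Suc k)))"
proof -
  have "(\<Sum>k\<le>Suc n. (- 1) ^ k * real (Suc n choose k) * q k)
      = q 0 + (\<Sum>k\<le>n. (- 1) ^ Suc k * real (Suc n choose Suc k) * q (Suc k))"
    by (subst sum.atMost_Suc_shift) simp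
  also have "\<dots> = (q 0 + (\<Sum>k\<le>n. (- 1) ^ Suc k * real (n choose Suc k) * q (Suc k)))
      - (\<Sum>k\<le>n. (- 1) ^ k * real (n choose k) * q (Suc k))"
  proof -
    have "(- 1) ^ Suc k * real (Suc n choose Suc k) * q (Suc k) = (- 1) ^ Suc k * real (n choose Suc k) * q (Suc k)
        - (- 1) ^ k * real (n choose k) * q (Suc k)" for k
      by (simp add: algebra_simps)
    then show ?thesis by (simp only: sum_subtractf add_diff_eq)
  qed
  also have "q 0 + (\<Sum>k\<le>n. (- 1) ^ Suc k * real (n choose Suc k) * q (Suc k))
      = (\<Sum>k\<le>Suc n. (- 1) ^ k * real (n choose k) * q k)"
    by (subst sum.atMost_Suc_shift) simp
  also have "\<dots> = (\<Sum>k\<le>n. (- 1) ^ k * real (n choose k) * q k)"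
    by simp
  finally show ?thesis by (simp add: right_diff_distrib sum_subtractf)
qed

text \<open>A first difference lowers the degree of a polynomial, so n of them annihilate every
  degree below n.\<close>

lemma alternating_binomial_power:
  "j < n \<Longrightarrow> (\<Sum>k\<le>n. (- 1) ^ k * real (n choose k) * real k ^ j) = 0"
proof (induction n arbitrary: j)
  case (Suc n)
  have diff: "real k ^ j - real (Suc k) ^ j = - (\<Sum>i<j. real (j choose i) * real k ^ i)" for k
  proof -
    have "real (Suc k) ^ j = (\<Sum>i\<le>j. real (j choose i) * real k ^ i)"
      using binomial_ring [of "real k" 1 j] by (simp add: add.commute)
    then show ?thesis by (simp add: lessThan_Suc_atMost [symmetric])
  qed
  have "(\<Sum>k\<le>Suc n. (- 1) ^ k * real (Suc n choose k) * real k ^ j)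
      = (\<Sum>k\<le>n. \<Sum>i<j. - (real (j choose i) * ((- 1) ^ k * real (n choose k) * real k ^ i)))"
    unfolding alternating_binomial_Suc diff
    by (simp add: sum_distrib_left sum_negf mult_ac)
  also have "\<dots> = (\<Sum>i<j. - (real (j choose i) * (\<Sum>k\<le>n. (- 1) ^ k * real (n choose k) * real k ^ i)))"
    by (subst sum.swap) (simp add: sum_distrib_left sum_negf)
  also have "\<dots> = 0" using Suc by simp
  finally show ?case .
qed simp

text \<open>Weights for numerical differentiation at 0 of functions that vanish at 0, which is why \<open>j = 0\<close>
  imposes no condition.\<close>

lemma differentiation_weights:
  "\<exists>w :: nat \<Rightarrow> real. \<forall>j. 1 \<le> j \<and> j \<le> p \<longrightarrow> (\<Sum>k=1..p. w k * real k ^ j) = (if j = 1 then 1 else 0)"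
proof (intro exI allI impI)
  fix j assume j: "1 \<le> j \<and> j \<le> p"
  \<comment> \<open>The weights are \<open>- ((- 1) ^ k * real (p choose k) / real k)\<close>.
    Dividing by k lowers the exponent to j - 1 < p, where the full alternating sum vanishes; the
    missing term k = 0 is nonzero only for j = 1.\<close>
  let ?f = "\<lambda>k. (- 1) ^ k * real (p choose k) * real k ^ (j - 1)"
  have "(\<Sum>k=1..p. - ((- 1) ^ k * real (p choose k) / real k) * real k ^ j) = - (\<Sum>k=1..p. ?f k)"
    unfolding sum_negf [symmetric]
  proof (rule sum.cong)
    fix k assume k: "k \<in> {1..p}"
    have "real k ^ j = real k * real k ^ (j - 1)" using j by (cases j) auto
    then show "- ((- 1) ^ k * real (p choose k) / real k) * real k ^ j = - ?f k" using k by simp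
  qed simp
  also have "(\<Sum>k=1..p. ?f k) = (\<Sum>k\<le>p. ?f k) - ?f 0"
    by (simp add: atMost_atLeast0 sum.atLeast_Suc_atMost)
  also have "(\<Sum>k\<le>p. ?f k) = 0" using j by (intro alternating_binomial_power) auto
  finally show "(\<Sum>k=1..p. - ((- 1) ^ k * real (p choose k) / real k) * real k ^ j)
      = (if j = 1 then 1 else 0)"
    using j by (auto simp: power_0_left)
qed

text \<open>In the Taylor expansion of W the moment conditions cancel all degrees from 1 to p, so
  the error is t ^ (p + 1) times a holomorphic function. The Schwarz lemma then needs only its size,
  on the disc of radius R/p where all sample points k t remain in the disc of radius R.\<close>

lemma numerical_differentiation:
  fixes w :: "nat \<Rightarrow> real" and t :: complex
  assumes W: "W holomorphic_on ball 0 R" and bd: "\<And>t. cmod t < R \<Longrightarrow> cmod (W t) \<le> M"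
    and W0: "W 0 = 0" and d: "(W has_field_derivative d) (at 0)"
    and p: "1 \<le> p"
    and w: "\<And>j. 1 \<le> j \<Longrightarrow> j \<le> p \<Longrightarrow> (\<Sum>k=1..p. w k * real k ^ j) = (if j = 1 then 1 else 0)"
    and t: "real p * cmod t < R"
  shows "cmod (t * d - (\<Sum>k=1..p. of_real (w k) * W (of_nat k * t)))
    \<le> (R * cmod d + (\<Sum>k=1..p. \<bar>w k\<bar>) * M) * (real p * cmod t / R) ^ Suc p"
proof -
  have R: "0 < R" using t by (meson norm_ge_zero le_less_trans mult_nonneg_nonneg of_nat_0_le_iff)
  have M: "0 \<le> M" using bd [of 0] R W0 by simp
  obtain c H where H: "H holomorphic_on ball 0 R"
    and Wt: "\<And>t. cmod t < R \<Longrightarrow> W t = (\<Sum>j<Suc p. c j * t ^ j) + t ^ Suc p * H t"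
    using taylor_factor [OF W, of "Suc p"] by blast
  have c0: "c 0 = 0"
    using Wt [of 0] R W0 by (simp add: sum.lessThan_Suc_shift del: sum.lessThan_Suc)
  \<comment> \<open>The expansion is differentiated at 0; the remainder contributes nothing because
    its factor \<open>t ^ Suc p\<close> has exponent at least 2.\<close>
  have c1: "c 1 = d"
  proof -
    have "(H has_field_derivative deriv H 0) (at 0)"
      using H R by (intro holomorphic_derivI [of _ "ball 0 R"]) auto
    then have "((\<lambda>t. t ^ Suc p * H t) has_field_derivative 0) (at 0)"
      using p by (auto intro!: derivative_eq_intros simp: power_0_left)
    moreover have "((\<lambda>t. \<Sum>j<Suc p. c j * t ^ j) has_field_derivative
        (\<Sum>j<Suc p. c j * (of_nat j * 0 ^ (j - 1)))) (at 0)"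
      by (intro DERIV_sum) (auto intro!: derivative_eq_intros)
    ultimately have "((\<lambda>t. (\<Sum>j<Suc p. c j * t ^ j) + t ^ Suc p * H t) has_field_derivative
        (\<Sum>j<Suc p. c j * (of_nat j * 0 ^ (j - 1))) + 0) (at 0)"
      by (rule DERIV_add [rotated])
    moreover have "(\<Sum>j<Suc p. c j * (of_nat j * 0 ^ (j - 1))) = (\<Sum>j<Suc p. if j = 1 then c 1 else 0)"
      by (intro sum.cong) (auto simp: power_0_left)
    ultimately have "((\<lambda>t. (\<Sum>j<Suc p. c j * t ^ j) + t ^ Suc p * H t) has_field_derivative c 1) (at 0)"
      using p by (simp del: sum.lessThan_Suc)
    then have "(W has_field_derivative c 1) (at 0)"
      by (rule has_field_derivative_transform_within_open [where S = "ball 0 R"]) (use Wt R in auto)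
    then show ?thesis using d DERIV_unique by blast
  qed
  define R' where "R' = R / real p"
  have in_R: "cmod (of_nat k * u) < R" if "cmod u < R'" "k \<in> {1..p}" for k u
  proof -
    have "cmod (of_nat k * u) \<le> real p * cmod u"
      using that by (simp add: norm_mult mult_right_mono)
    also have "\<dots> < R" using that(1) p by (simp add: R'_def field_simps)
    finally show ?thesis .
  qed
  \<comment> \<open>The cofactor of the error: only the Taylor remainders at the sample points are
    left.\<close>
  define K where "K = (\<lambda>u. - (\<Sum>k=1..p. of_real (w k) * of_nat k ^ Suc p * H (of_nat k * u)))"
  have K_hol: "K holomorphic_on ball 0 R'"
    unfolding K_def
  proof (intro holomorphic_intros)
    fix k assume k: "k \<in> {1..p}"
    show "(\<lambda>u. H (of_nat k * u)) holomorphic_on ball 0 R'"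
    proof (rule holomorphic_on_compose_gen [of "\<lambda>u. of_nat k * u" _ H "ball 0 R", unfolded o_def, OF _ H])
      show "(\<lambda>u::complex. of_nat k * u) ` ball 0 R' \<subseteq> ball 0 R"
        using in_R k by (intro image_subsetI) simp
    qed (intro holomorphic_intros)
  qed
  have w': "(\<Sum>k=1..p. of_real (w k) * of_nat k ^ j) = (if j = 1 then 1 else (0::complex))"
    if "1 \<le> j" "j \<le> p" for j
  proof -
    have "(\<Sum>k=1..p. of_real (w k) * of_nat k ^ j) = complex_of_real (\<Sum>k=1..p. w k * real k ^ j)"
      by simp
    then show ?thesis unfolding w [OF that] by simp
  qed
  have G_eq: "u * d - (\<Sum>k=1..p. of_real (w k) * W (of_nat k * u)) = u ^ Suc p * K u" if u: "cmod u < R'" for u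
  proof -
    have "(\<Sum>k=1..p. of_real (w k) * W (of_nat k * u))
        = (\<Sum>k=1..p. \<Sum>j<Suc p. of_real (w k) * of_nat k ^ j * (c j * u ^ j))
          + (\<Sum>k=1..p. of_real (w k) * of_nat k ^ Suc p * H (of_nat k * u) * u ^ Suc p)"
      unfolding sum.distrib [symmetric]
      by (intro sum.cong refl, subst Wt [OF in_R [OF u]])
         (simp_all add: power_mult_distrib sum_distrib_left distrib_left mult_ac del: sum.lessThan_Suc)
    also have "(\<Sum>k=1..p. \<Sum>j<Suc p. of_real (w k) * of_nat k ^ j * (c j * u ^ j))
        = (\<Sum>j<Suc p. (\<Sum>k=1..p. of_real (w k) * of_nat k ^ j) * (c j * u ^ j))"
      by (subst sum.swap) (simp add: sum_distrib_right del: sum.lessThan_Suc)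
    also have "\<dots> = (\<Sum>j<Suc p. if j = 1 then d * u else 0)"
    proof (intro sum.cong refl)
      fix j assume "j \<in> {..<Suc p}"
      then show "(\<Sum>k=1..p. of_real (w k) * of_nat k ^ j) * (c j * u ^ j) = (if j = 1 then d * u else 0)"
        using w' [of j] c0 c1 by (cases "j = 0") auto
    qed
    also have "\<dots> = d * u" using p by (simp del: sum.lessThan_Suc)
    also have "(\<Sum>k=1..p. of_real (w k) * of_nat k ^ Suc p * H (of_nat k * u) * u ^ Suc p)
        = - (u ^ Suc p * K u)"
      by (simp add: K_def sum_distrib_left mult_ac)
    finally show ?thesis by simp
  qed
  have "cmod (t ^ Suc p * K t) \<le> (R * cmod d + (\<Sum>k=1..p. \<bar>w k\<bar>) * M) * (cmod t / R') ^ Suc p"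
  proof (rule schwarz_factor [OF K_hol])
    fix u assume u: "cmod u < R'"
    have "cmod (u * d - (\<Sum>k=1..p. of_real (w k) * W (of_nat k * u)))
        \<le> cmod (u * d) + cmod (\<Sum>k=1..p. of_real (w k) * W (of_nat k * u))"
      by (rule norm_triangle_ineq4)
    also have "\<dots> \<le> R * cmod d + (\<Sum>k=1..p. \<bar>w k\<bar> * M)"
    proof (intro add_mono sum_norm_le)
      have "R' \<le> R" using p R by (simp add: R'_def field_simps)
      then show "cmod (u * d) \<le> R * cmod d"
        unfolding norm_mult using u by (intro mult_right_mono) auto
      show "cmod (of_real (w k) * W (of_nat k * u)) \<le> \<bar>w k\<bar> * M" if "k \<in> {1..p}" for k
        using bd [OF in_R [OF u that]] by (simp add: norm_mult mult_left_mono)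
    qed
    finally show "cmod (u ^ Suc p * K u) \<le> R * cmod d + (\<Sum>k=1..p. \<bar>w k\<bar>) * M"
      unfolding G_eq [OF u] sum_distrib_right .
  next
    show "cmod t < R'" using t p by (simp add: R'_def field_simps)
  qed
  moreover have "cmod t < R'" using t p by (simp add: R'_def field_simps)
  moreover have "cmod t / R' = real p * cmod t / R" by (simp add: R'_def)
  ultimately show ?thesis by (simp only: G_eq)
qed

section \<open>Iterates of two nearby maps\<close>

lemma holo_map_diff:
  assumes F: "holo_map S F" and G: "holo_map S G"
  shows "holo_map S (\<lambda>z i. F z i - G z i)"
  unfolding holo_map_def
proof (intro allI impI)
  fix U c assume U: "open U" "\<forall>\<tau>\<in>U. c \<tau> \<in> S" "holo_curve U c"
  have "holo_curve U (\<lambda>\<tau>. F (c \<tau>))" "holo_curve U (\<lambda>\<tau>. G (c \<tau>))"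
    using holo_mapD [OF F U(1) _ U(3)] holo_mapD [OF G U(1) _ U(3)] U(2) by auto
  then show "holo_curve U (\<lambda>\<tau> i. F (c \<tau>) i - G (c \<tau>) i)"
    unfolding holo_curve_def by (intro allI holomorphic_on_diff) auto
qed

lemma holo_map_id: "holo_map S (\<lambda>z. z)"
  by (simp add: holo_map_def)

text \<open>By the Schwarz lemma the bounds on \<Psi> - T and on T - id bound their variation, which
  gains the small factor c. Hence each iteration adds nearly the same vector \<Psi> x - T x. The
  powers of 2 solve two recursions: e' = \<epsilon> + 2 e for the distance of the iterates and d' =
  c \<epsilon> + c e + d for the deviation from k equal contributions.\<close>

lemma iterate_difference:
  fixes \<Psi> T :: "cvec \<Rightarrow> cvec"
  assumes x: "x \<in> cspace D" and r: "0 < r"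
    and \<Psi>_hol: "holo_map (vball D x r) \<Psi>" and T_hol: "holo_map (vball D x r) T"
    and E: "\<And>z. z \<in> vball D x r \<Longrightarrow> vdist D (\<Psi> z) (T z) \<le> \<epsilon>"
    and T: "\<And>z. z \<in> vball D x r \<Longrightarrow> vdist D (T z) z \<le> \<mu>"
    and u: "\<And>k. k \<le> n \<Longrightarrow> (\<Psi> ^^ k) x \<in> vball D x r" "\<And>k. k \<le> n \<Longrightarrow> vdist D ((\<Psi> ^^ k) x) x \<le> \<nu>"
    and v: "\<And>k. k \<le> n \<Longrightarrow> (T ^^ k) x \<in> vball D x (r / 2)"
    and c: "4 * \<mu> \<le> c * r" "2 * \<nu> \<le> c * r" "c \<le> 1"
  shows "k \<le> n \<Longrightarrow> vdist D ((\<Psi> ^^ k) x) ((T ^^ k) x) \<le> (2 ^ k - 1) * \<epsilon> \<and>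
    (\<forall>i<D. cmod ((\<Psi> ^^ k) x i - (T ^^ k) x i - of_nat k * (\<Psi> x i - T x i)) \<le> (2 ^ k - 1) * (c * \<epsilon>))"
proof (induction k)
  case 0
  then show ?case by simp
next
  case (Suc k)
  have xB: "x \<in> vball D x r" using x r by (simp add: vball_iff)
  have \<epsilon>: "0 \<le> \<epsilon>" using E [OF xB] vdist_nonneg order_trans by blast
  have \<mu>: "0 \<le> \<mu>" using T [OF xB] vdist_nonneg order_trans by blast
  define u where "u = (\<Psi> ^^ k) x"
  define v where "v = (T ^^ k) x"
  have uB: "u \<in> vball D x r" "u \<in> cspace D" using u(1) [of k] Suc.prems by (auto simp: u_def vball_iff)
  have vB: "v \<in> inset D (vball D x r) (r / 2)"
    using inset_vball [OF v, of k "r / 2"] Suc.prems by (simp add: v_def)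
  have sub_cspace: "vball D x r \<subseteq> cspace D" by (auto simp: vball_iff)
  define e where "e = vdist D u v"
  have e: "0 \<le> e" "e \<le> (2 ^ k - 1) * \<epsilon>" using Suc by (auto simp: e_def u_def v_def)
  \<comment> \<open>The T-iterates stay in the half ball and so have room r/2, whence the 4 in
    \<open>4 * \<mu> \<le> c * r\<close>.\<close>
  have T_lip: "vdist D (\<lambda>i. T u i - u i) (\<lambda>i. T v i - v i) \<le> c * e"
  proof -
    have "vdist D (\<lambda>i. T u i - u i) (\<lambda>i. T v i - v i) \<le> 2 * \<mu> * vdist D u v / (r / 2)"
    proof (rule holo_map_lipschitz [where G = "\<lambda>z i. T z i - z i", OF _ _ vB _ uB])
      show "holo_map (vball D x r) (\<lambda>z i. T z i - z i)"
        by (rule holo_map_diff [OF T_hol holo_map_id])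
      show "vnorm D (\<lambda>i. T z i - z i) \<le> \<mu>" if "z \<in> vball D x r" for z
        using T [OF that] by (simp add: vdist_def)
    qed (use r in simp)
    also have "\<dots> = 4 * \<mu> / r * e" by (simp add: e_def)
    also have "\<dots> \<le> c * e" using c(1) r e(1) by (intro mult_right_mono) (simp_all add: field_simps)
    finally show ?thesis .
  qed
  \<comment> \<open>The comparison point is the centre x with its full room r, so u may lie anywhere
    in the ball.\<close>
  have E_lip: "vdist D (\<lambda>i. \<Psi> u i - T u i) (\<lambda>i. \<Psi> x i - T x i) \<le> c * \<epsilon>"
  proof -
    have "vdist D (\<lambda>i. \<Psi> u i - T u i) (\<lambda>i. \<Psi> x i - T x i) \<le> 2 * \<epsilon> * vdist D u x / r"
    proof (rule holo_map_lipschitz [where G = "\<lambda>z i. \<Psi> z i - T z i", OF _ _ inset_vball_center [OF x] r uB])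
      show "holo_map (vball D x r) (\<lambda>z i. \<Psi> z i - T z i)"
        by (rule holo_map_diff [OF \<Psi>_hol T_hol])
      show "vnorm D (\<lambda>i. \<Psi> z i - T z i) \<le> \<epsilon>" if "z \<in> vball D x r" for z
        using E [OF that] by (simp add: vdist_def)
    qed
    also have "\<dots> \<le> 2 * \<epsilon> * \<nu> / r"
      using u(2) [of k] Suc.prems r \<epsilon> by (intro divide_right_mono mult_left_mono) (auto simp: u_def)
    also have "\<dots> = (2 * \<nu>) / r * \<epsilon>" by simp
    also have "\<dots> \<le> c * \<epsilon>" using c(2) r \<epsilon> by (intro mult_right_mono) (simp_all add: field_simps)
    finally show ?thesis .
  qed
  have split: "(\<Psi> ^^ Suc k) x i - (T ^^ Suc k) x i
      = (\<Psi> u i - T u i) + ((T u i - u i) - (T v i - v i)) + (u i - v i)" for i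
    by (simp add: u_def v_def)
  show ?case
  proof (intro conjI allI impI)
    have "vdist D ((\<Psi> ^^ Suc k) x) ((T ^^ Suc k) x) \<le> \<epsilon> + 1 * e + e"
    proof (rule vdist_leI)
      fix i assume i: "i < D"
      have "cmod ((\<Psi> u i - T u i) + ((T u i - u i) - (T v i - v i)) + (u i - v i))
          \<le> cmod (\<Psi> u i - T u i) + cmod ((T u i - u i) - (T v i - v i)) + cmod (u i - v i)"
        by (rule order_trans [OF norm_triangle_ineq add_right_mono [OF norm_triangle_ineq]])
      also have "\<dots> \<le> \<epsilon> + c * e + e"
        using order_trans [OF cmod_le_vdist [OF i] E [OF uB(1)]]
          order_trans [OF cmod_le_vdist [OF i] T_lip] cmod_le_vdist [OF i, of u v]
        by (intro add_mono) (auto simp: e_def)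
      also have "\<dots> \<le> \<epsilon> + 1 * e + e"
        using c(3) e(1) by (intro add_mono mult_right_mono) auto
      finally show "cmod ((\<Psi> ^^ Suc k) x i - (T ^^ Suc k) x i) \<le> \<epsilon> + 1 * e + e"
        unfolding split .
    qed (use e \<epsilon> in simp)
    also have "\<dots> \<le> (2 ^ Suc k - 1) * \<epsilon>" using e(2) by (simp add: algebra_simps)
    finally show "vdist D ((\<Psi> ^^ Suc k) x) ((T ^^ Suc k) x) \<le> (2 ^ Suc k - 1) * \<epsilon>" .
  next
    fix i assume i: "i < D"
    have IH: "cmod (u i - v i - of_nat k * (\<Psi> x i - T x i)) \<le> (2 ^ k - 1) * (c * \<epsilon>)"
      using Suc i by (simp add: u_def v_def)
    have eq: "(\<Psi> ^^ Suc k) x i - (T ^^ Suc k) x i - of_nat (Suc k) * (\<Psi> x i - T x i)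
        = ((\<Psi> u i - T u i) - (\<Psi> x i - T x i)) + ((T u i - u i) - (T v i - v i))
          + (u i - v i - of_nat k * (\<Psi> x i - T x i))"
      unfolding split by (simp add: algebra_simps)
    have "cmod ((\<Psi> ^^ Suc k) x i - (T ^^ Suc k) x i - of_nat (Suc k) * (\<Psi> x i - T x i))
        \<le> cmod ((\<Psi> u i - T u i) - (\<Psi> x i - T x i)) + cmod ((T u i - u i) - (T v i - v i))
          + cmod (u i - v i - of_nat k * (\<Psi> x i - T x i))"
      unfolding eq by (rule order_trans [OF norm_triangle_ineq add_right_mono [OF norm_triangle_ineq]])
    also have "\<dots> \<le> c * \<epsilon> + c * ((2 ^ k - 1) * \<epsilon>) + (2 ^ k - 1) * (c * \<epsilon>)"
    proof (intro add_mono IH)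
      show "cmod ((\<Psi> u i - T u i) - (\<Psi> x i - T x i)) \<le> c * \<epsilon>"
        by (rule order_trans [OF cmod_le_vdist [OF i] E_lip])
      have "0 \<le> c * r" using c(1) \<mu> by linarith
      then have "0 \<le> c" using r by (simp add: zero_le_mult_iff)
      then have "c * e \<le> c * ((2 ^ k - 1) * \<epsilon>)" using e(2) by (rule mult_left_mono [rotated])
      then show "cmod ((T u i - u i) - (T v i - v i)) \<le> c * ((2 ^ k - 1) * \<epsilon>)"
        using order_trans [OF cmod_le_vdist [OF i] T_lip] by linarith
    qed
    also have "\<dots> = (2 ^ Suc k - 1) * (c * \<epsilon>)" by (simp add: algebra_simps)
    finally show "cmod ((\<Psi> ^^ Suc k) x i - (T ^^ Suc k) x i - of_nat (Suc k) * (\<Psi> x i - T x i))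
        \<le> (2 ^ Suc k - 1) * (c * \<epsilon>)" .
  qed
qed


section \<open>Local and global error of the unrolled scheme\<close>

context rk_field
begin

text \<open>The prefactor bounds the displacement of the scheme plus that of the flow for step sizes
  up to H.\<close>

lemma order_error:
  assumes order: "rk_order I a b p" and g: "real_field D g" and zr: "z \<in> rspace D"
    and z: "z \<in> inset D S (2 * \<rho>)" and h: "cmod h < H" and k: "k < D"
  shows "cmod (rk_exact h z k - traj h z 1 k) \<le> 2 * H * A * m * (cmod h / H) ^ (p + 1)"
proof -
  have zS: "z \<in> S" using inset_subset [of "2 * \<rho>"] \<rho>_pos z by auto
  have an: "field_analytic_on D g {z}"
    using analytic zS unfolding field_analytic_on_def by blast
  have "\<exists>\<delta>>0. \<exists>h0>0. \<exists>C. \<forall>h v.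
      0 < h \<and> h < h0 \<and> rk_stages I a D h g z v \<and> (\<forall>i<I. v i \<in> vball D z \<delta>) \<longrightarrow>
      vnorm D (\<lambda>k. rk_update I b h g z v k - flow D g h z k) \<le> C * h ^ (p + 1)"
    by (rule order [unfolded rk_order_def, THEN spec, THEN spec, THEN spec, THEN mp]) (intro conjI g zr an)
  then obtain \<delta> h0 C where \<delta>: "0 < \<delta>" and h0: "0 < h0" and C: "\<forall>h v.
      0 < h \<and> h < h0 \<and> rk_stages I a D h g z v \<and> (\<forall>i<I. v i \<in> vball D z \<delta>) \<longrightarrow>
      vnorm D (\<lambda>k. rk_update I b h g z v k - flow D g h z k) \<le> C * h ^ (p + 1)"
    by (elim exE conjE)
  define F where "F = (\<lambda>h. rk_exact h z k - traj h z 1 k)"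
  have F_hol: "F holomorphic_on ball 0 H"
  proof -
    have const: "holo_curve (ball 0 H) (\<lambda>_. z)" by (simp add: holo_curve_def)
    have "holo_curve (ball 0 H) (\<lambda>h. rk_exact h z)"
      by (rule rk_exact_holo [OF open_ball const z holomorphic_on_ident]) simp
    moreover have "holo_curve (ball 0 H) (\<lambda>h. traj h z 1)"
      by (rule traj_holo [OF open_ball const z holomorphic_on_ident]) simp
    ultimately show ?thesis by (auto simp: F_def holo_curve_def intro!: holomorphic_intros)
  qed
  have F_le: "cmod (F h) \<le> 2 * H * A * m" if h: "cmod h < H" for h
  proof -
    have "cmod (F h) = cmod ((rk_exact h z k - z k) - (traj h z 1 k - z k))" by (simp add: F_def)
    also have "\<dots> \<le> cmod h * A * m + cmod h * m"
      by (rule order_trans [OF norm_triangle_ineq4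
            add_mono [OF rk_exact_near [OF z less_imp_le [OF h]] traj_displacement [OF z less_imp_le [OF h]]]])
    also have "\<dots> \<le> H * A * m + H * A * m"
    proof (intro add_mono)
      show "cmod h * A * m \<le> H * A * m"
        using h A_ge m_nonneg by (intro mult_right_mono) auto
      have "cmod h * 1 \<le> H * A" using h A_ge H_pos by (intro mult_mono) auto
      then show "cmod h * m \<le> H * A * m" using m_nonneg by (intro mult_right_mono) auto
    qed
    finally show ?thesis by (simp add: mult_ac)
  qed
  \<comment> \<open>The order hypothesis accepts only stages within \<open>\<delta>\<close> of z.
    The exact stages are within \<open>t * A * m\<close>, hence the second bound; its summand 1
    covers m = 0.\<close>
  define \<epsilon> where "\<epsilon> = min (min h0 H) (\<delta> / (A * m + 1))"
  have Am: "0 \<le> A * m" using A_ge m_nonneg by simp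
  have \<epsilon>: "0 < \<epsilon>" using h0 H_pos \<delta> Am by (simp add: \<epsilon>_def)
  have F_small: "cmod (F (of_real t)) \<le> C * t ^ (p + 1)" if t: "0 < t" "t < \<epsilon>" for t :: real
  proof -
    have tH: "t < h0" "t \<le> H" "t < \<delta> / (A * m + 1)" using t by (auto simp: \<epsilon>_def)
    have th: "cmod (of_real t) \<le> H" using tH t by simp
    have "t * (A * m + 1) < \<delta>" using tH(3) Am by (simp add: field_simps)
    then have small: "t * A * m < \<delta>" using t by (simp add: algebra_simps)
    have "rk_stages I a D t g z (stg (of_real t) z)"
      unfolding rk_stages_def using stg(1,4) [OF z th] by simp
    moreover have "stg (of_real t) z i \<in> vball D z \<delta>" if "i < I" for i
      unfolding vball_iff
    proof
      show "stg (of_real t) z i \<in> cspace D" by (rule stg(1) [OF z th])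
      show "vdist D (stg (of_real t) z i) z < \<delta>"
        using stg(5) [OF z th that] small t by simp
    qed
    ultimately have "vnorm D (\<lambda>k. rk_update I b t g z (stg (of_real t) z) k - flow D g t z k) \<le> C * t ^ (p + 1)"
      using C t tH by simp
    moreover have "rk_update I b t g z (stg (of_real t) z) = rk_exact (of_real t) z"
      by (simp add: rk_update_def rk_exact_def)
    moreover have "flow D g t z = traj (of_real t) z 1"
      by (rule flow_traj [OF z]) (use t tH in auto)
    ultimately show ?thesis
      using cmod_le_vnorm [OF k, of "\<lambda>k. rk_exact (of_real t) z k - traj (of_real t) z 1 k"]
      by (simp add: F_def)
  qed
  have "\<exists>G. G holomorphic_on ball 0 H \<and> (\<forall>t. cmod t < H \<longrightarrow> F t = t ^ (p + 1) * G t)"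
    by (rule vanishing_factor [OF F_hol H_pos \<epsilon>]) (rule F_small)
  then obtain G where G: "G holomorphic_on ball 0 H" "\<And>t. cmod t < H \<Longrightarrow> F t = t ^ (p + 1) * G t"
    by blast
  have "cmod (h ^ (p + 1) * G h) \<le> 2 * H * A * m * (cmod h / H) ^ (p + 1)"
    by (rule schwarz_factor [OF G(1) _ h]) (use F_le G(2) in simp)
  then show ?thesis using G(2) [OF h] by (simp add: F_def)
qed

context
  fixes h :: real and sol :: implicit_solver and L p :: nat
  assumes h: "0 < h" "h < H" and order: "rk_order I a b p" and Lp: "p \<le> Lstar sol L + 1"
    and real_g: "real_field D g"
begin

abbreviation (input) step :: "cvec \<Rightarrow> cvec" where
  "step \<equiv> unrolled_step sol I a b L D h g"

text \<open>Real points only, as the order hypothesis demands. The factor h outside the power makes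
  this O(h ^ (p + 1)): one H from the prefactor of \<open>order_error\<close> cancels against one
  power of h/H.\<close>

lemma local_error:
  assumes zr: "z \<in> rspace D" and z: "z \<in> inset D S (2 * \<rho>)"
  shows "vdist D (step z) (flow D g h z) \<le> 3 * (h * A * m) * (h / H) ^ p"
proof (rule vdist_leI)
  fix k assume k: "k < D"
  have hAm: "0 \<le> h * A * m" using h A_ge m_nonneg by simp
  have ratio: "0 \<le> h / H" "h / H \<le> 1" using h by auto
  have hH: "h \<le> H" using h by simp
  have flow: "flow D g h z = traj (of_real h) z 1" by (rule flow_traj [OF z h(1) hH])
  have "cmod (step z k - flow D g h z k)
      \<le> cmod (step z k - rk_exact (of_real h) z k) + cmod (rk_exact (of_real h) z k - traj (of_real h) z 1 k)"
    unfolding flow using norm_triangle_ineq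
      [of "step z k - rk_exact (of_real h) z k" "rk_exact (of_real h) z k - traj (of_real h) z 1 k"] by simp
  also have "\<dots> \<le> h * A * m * (h / H) ^ (Lstar sol L + 1) + 2 * H * A * m * (h / H) ^ (p + 1)"
    using unrolled_step_close [OF h(1) hH z] order_error [OF order real_g zr z _ k, of "of_real h"] h
    by (intro add_mono) auto
  also have "\<dots> \<le> h * A * m * (h / H) ^ p + 2 * H * A * m * (h / H) ^ (p + 1)"
    using hAm ratio Lp by (intro add_right_mono mult_left_mono power_decreasing) auto
  also have "2 * H * A * m * (h / H) ^ (p + 1) = 2 * (h * A * m) * (h / H) ^ p"
    using H_pos by simp
  finally show "cmod (step z k - flow D g h z k) \<le> 3 * (h * A * m) * (h / H) ^ p"
    by (simp add: algebra_simps)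
qed (use h A_ge m_nonneg in simp)

lemma flow_power:
  assumes x: "x \<in> inset D S (3 * \<rho>)"
  shows "real (Suc n) * h \<le> H \<Longrightarrow> (flow D g h ^^ Suc n) x = flow D g (real (Suc n) * h) x"
proof (induction n)
  case (Suc n)
  have eq: "real (Suc (Suc n)) * h = real (Suc n) * h + h" by (simp add: algebra_simps)
  have "flow D g (real (Suc n) * h + h) x = flow D g h (flow D g (real (Suc n) * h) x)"
    by (rule flow_add(2) [OF x]) (use Suc.prems h in \<open>simp_all add: eq del: of_nat_Suc\<close>)
  moreover have "real (Suc n) * h \<le> H" using Suc.prems h unfolding eq by linarith
  ultimately show ?case using Suc.IH by (simp only: eq funpow.simps o_apply)
qed simp

text \<open>All steps together take a time of at most H and move by at most
  \<open>H * A * m\<close>, so a single margin covers the whole orbit instead of one margin per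
  step.\<close>

lemma step_power_near:
  assumes x: "x \<in> inset D S (4 * \<rho>)" and n: "real n * h \<le> H" and k: "k \<le> n"
  shows "vdist D ((step ^^ k) x) x \<le> real k * (h * A * m)" "(step ^^ k) x \<in> inset D S (3 * \<rho>)"
proof -
  have hAm: "0 \<le> h * A * m" using h A_ge m_nonneg by simp
  have hH: "h \<le> H" using h by simp
  have small: "real k * (h * A * m) \<le> \<rho>" if "k \<le> n" for k
  proof -
    have "real k * h \<le> H" using that n h by (meson mult_right_mono of_nat_mono order_trans less_imp_le)
    then have "16 * (real k * h * A * m) \<le> \<rho>" by (rule step_small)
    moreover have "0 \<le> real k * h * A * m" using h A_ge m_nonneg by simp
    ultimately show ?thesis by (simp add: mult.assoc)
  qed
  have all: "k \<le> n \<Longrightarrow> vdist D ((step ^^ k) x) x \<le> real k * (h * A * m) \<and> (step ^^ k) x \<in> inset D S (3 * \<rho>)" for k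
  proof (induction k)
    case 0
    show ?case using inset_shift [OF x inset_cspace [OF x], of \<rho>] \<rho>_pos by auto
  next
    case (Suc k)
    then have IH: "vdist D ((step ^^ k) x) x \<le> real k * (h * A * m)" "(step ^^ k) x \<in> inset D S (3 * \<rho>)"
      by auto
    have in2: "(step ^^ k) x \<in> inset D S (2 * \<rho>)"
      by (rule inset_shift [OF IH(2) inset_cspace [OF IH(2)], of \<rho>]) (use \<rho>_pos in auto)
    note near = unrolled_step_near [OF h(1) hH in2, of sol L]
    have "vdist D ((step ^^ Suc k) x) x \<le> vdist D (step ((step ^^ k) x)) ((step ^^ k) x) + vdist D ((step ^^ k) x) x"
      by (simp add: vdist_triangle)
    also have "\<dots> \<le> h * A * m + real k * (h * A * m)" by (intro add_mono near IH)
    finally have 1: "vdist D ((step ^^ Suc k) x) x \<le> real (Suc k) * (h * A * m)" by (simp add: algebra_simps)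
    have "(step ^^ Suc k) x \<in> inset D S (3 * \<rho>)"
      by (rule inset_shift [OF x _ order_trans [OF 1 small [OF Suc.prems]]]) (use near(1) in auto)
    with 1 show ?case by blast
  qed
  show "vdist D ((step ^^ k) x) x \<le> real k * (h * A * m)" "(step ^^ k) x \<in> inset D S (3 * \<rho>)"
    using all [OF k] by auto
qed

lemma step_power_holo:
  assumes n: "real n * h \<le> H" and k: "k \<le> n"
  shows "holo_map (inset D S (4 * \<rho>)) (step ^^ k)"
  using k
proof (induction k)
  case 0
  then show ?case by (simp add: holo_map_def)
next
  case (Suc k)
  have hH: "h \<le> H" using h by simp
  show ?case
    unfolding holo_map_def
  proof (intro allI impI)
    fix U c assume U: "open U" "\<forall>\<tau>\<in>U. c \<tau> \<in> inset D S (4 * \<rho>)" "holo_curve U c"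
    have "holo_curve U (\<lambda>\<tau>. step ((step ^^ k) (c \<tau>)))"
    proof (rule holo_mapD [OF unrolled_step_holo [OF h(1) hH] U(1)])
      show "holo_curve U (\<lambda>\<tau>. (step ^^ k) (c \<tau>))"
        by (rule holo_mapD [OF Suc.IH U(1)]) (use U Suc.prems in auto)
      fix \<tau> assume "\<tau> \<in> U"
      then have "c \<tau> \<in> inset D S (4 * \<rho>)" using U(2) by blast
      from step_power_near(2) [OF this n, of k] Suc.prems
      have *: "(step ^^ k) (c \<tau>) \<in> inset D S (3 * \<rho>)" by simp
      show "(step ^^ k) (c \<tau>) \<in> inset D S (2 * \<rho>)"
        by (rule inset_shift [OF * inset_cspace [OF *], of \<rho>]) (use \<rho>_pos in auto)
    qed
    then show "holo_curve U (\<lambda>\<tau>. (step ^^ Suc k) (c \<tau>))" by simp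
  qed
qed

lemma flow_power_props:
  assumes x: "x \<in> inset D S (4 * \<rho>)" and xr: "x \<in> rspace D" and n: "real n * h \<le> H"
  shows "(flow D g h ^^ n) x \<in> rspace D" "(flow D g h ^^ n) x \<in> inset D S (3 * \<rho>)"
proof -
  have x3: "x \<in> inset D S (3 * \<rho>)"
    by (rule inset_shift [OF x inset_cspace [OF x], of \<rho>]) (use \<rho>_pos in auto)
  have x2: "x \<in> inset D S (2 * \<rho>)"
    by (rule inset_shift [OF x inset_cspace [OF x], of "2 * \<rho>"]) (use \<rho>_pos in auto)
  have "(flow D g h ^^ n) x \<in> rspace D \<and> (flow D g h ^^ n) x \<in> inset D S (3 * \<rho>)"
  proof (cases n)
    case 0
    then show ?thesis using xr x3 by simp
  next
    case (Suc n')
    define T where "T = real (Suc n') * h"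
    have T: "0 < T" "T \<le> H" using h n by (auto simp: T_def Suc simp del: of_nat_Suc)
    have eq: "(flow D g h ^^ n) x = flow D g T x"
      using flow_power [OF x3, of n'] T by (simp only: Suc T_def)
    have "flow D g T x \<in> rspace D"
      unfolding flow_traj [OF x2 T] by (rule traj_real [OF real_g xr x2]) (use T in auto)
    moreover have "flow D g T x \<in> inset D S (3 * \<rho>)"
    proof (rule inset_shift [OF x flow_cspace [OF x2 T] flow_near [OF x2 T]])
      show "3 * \<rho> + T * m \<le> 4 * \<rho>" using flow_small [of T] T m_nonneg \<rho>_pos by simp
    qed
    ultimately show ?thesis by (simp add: eq)
  qed
  then show "(flow D g h ^^ n) x \<in> rspace D" "(flow D g h ^^ n) x \<in> inset D S (3 * \<rho>)" by auto
qed

text \<open>The constant is 1 for the identity plus at most 1 for the increment of the step, which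
  is bounded by \<open>h * A * m\<close> on a set with room \<rho>.\<close>

lemma step_lipschitz:
  assumes y: "y \<in> inset D S (3 * \<rho>)" and y': "y' \<in> inset D S (2 * \<rho>)"
  shows "vdist D (step y') (step y) \<le> 2 * vdist D y' y"
proof -
  have hH: "h \<le> H" using h by simp
  have y2: "y \<in> inset D (inset D S (2 * \<rho>)) \<rho>"
    unfolding inset_def [of D "inset D S (2 * \<rho>)"]
  proof (clarify, intro conjI subsetI)
    show "y \<in> cspace D" by (rule inset_cspace [OF y])
    show "v \<in> inset D S (2 * \<rho>)" if "v \<in> vball D y \<rho>" for v
      by (rule inset_shift [OF y, of _ \<rho>]) (use that in \<open>auto simp: vball_iff\<close>)
  qed
  have "vdist D (\<lambda>i. step y' i - y' i) (\<lambda>i. step y i - y i) \<le> 2 * (h * A * m) * vdist D y' y / \<rho>"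
  proof (rule holo_map_lipschitz [where G = "\<lambda>z i. step z i - z i", OF _ _ y2 \<rho>_pos y' inset_cspace [OF y']])
    show "holo_map (inset D S (2 * \<rho>)) (\<lambda>z i. step z i - z i)"
      by (rule holo_map_diff [OF unrolled_step_holo [OF h(1) hH] holo_map_id])
    show "vnorm D (\<lambda>i. step z i - z i) \<le> h * A * m" if "z \<in> inset D S (2 * \<rho>)" for z
      using unrolled_step_near(2) [OF h(1) hH that, of sol L] by (simp add: vdist_def)
  qed
  also have "\<dots> = 2 * (h * A * m) / \<rho> * vdist D y' y" by simp
  also have "\<dots> \<le> 1 * vdist D y' y"
  proof (rule mult_right_mono)
    have "0 \<le> h * A * m" using h A_ge m_nonneg by simp
    then show "2 * (h * A * m) / \<rho> \<le> 1" using step_small [OF hH] \<rho>_pos by simp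
  qed simp
  finally have lip: "vdist D (\<lambda>i. step y' i - y' i) (\<lambda>i. step y i - y i) \<le> vdist D y' y" by simp
  show ?thesis
  proof (rule vdist_leI)
    fix i assume i: "i < D"
    have "cmod (step y' i - step y i) \<le> cmod ((step y' i - y' i) - (step y i - y i)) + cmod (y' i - y i)"
      using norm_triangle_ineq [of "(step y' i - y' i) - (step y i - y i)" "y' i - y i"] by simp
    also have "\<dots> \<le> vdist D y' y + vdist D y' y"
      by (intro add_mono order_trans [OF cmod_le_vdist [OF i] lip] cmod_le_vdist [OF i])
    finally show "cmod (step y' i - step y i) \<le> 2 * vdist D y' y" by simp
  qed simp
qed

text \<open>The local error is inserted at the flow iterates, which are real, and the step map
  propagates the accumulated error with factor 2; the bound solves e' = 2 e + B. Growth in n is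
  harmless because n will be at most p s.\<close>

lemma global_error:
  assumes x: "x \<in> inset D S (4 * \<rho>)" and xr: "x \<in> rspace D"
  shows "real n * h \<le> H \<Longrightarrow>
    vdist D ((step ^^ n) x) ((flow D g h ^^ n) x) \<le> (2 ^ n - 1) * (3 * (h * A * m) * (h / H) ^ p)"
proof (induction n)
  case (Suc n)
  let ?B = "3 * (h * A * m) * (h / H) ^ p"
  have n: "real n * h \<le> H" using Suc.prems h by (simp add: algebra_simps)
  note fp = flow_power_props [OF x xr n]
  let ?u = "(step ^^ n) x" and ?y = "(flow D g h ^^ n) x"
  have u3: "?u \<in> inset D S (3 * \<rho>)" by (rule step_power_near(2) [OF x n]) simp
  have u2: "?u \<in> inset D S (2 * \<rho>)"
    by (rule inset_shift [OF u3 inset_cspace [OF u3], of \<rho>]) (use \<rho>_pos in auto)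
  have y2: "?y \<in> inset D S (2 * \<rho>)"
    by (rule inset_shift [OF fp(2) inset_cspace [OF fp(2)], of \<rho>]) (use \<rho>_pos in auto)
  have "vdist D (step ?u) (flow D g h ?y) \<le> vdist D (step ?u) (step ?y) + vdist D (step ?y) (flow D g h ?y)"
    by (rule vdist_triangle)
  also have "\<dots> \<le> 2 * vdist D ?u ?y + ?B"
    by (intro add_mono step_lipschitz fp(2) u2 local_error fp(1) y2)
  also have "\<dots> \<le> 2 * ((2 ^ n - 1) * ?B) + ?B"
    by (intro add_right_mono mult_left_mono Suc.IH [OF n]) simp_all
  also have "\<dots> = (2 ^ Suc n - 1) * ?B" by (simp add: algebra_simps)
  finally show ?case by simp
qed simp

end

end

section \<open>The error of the learned field\<close>

lemma sup_norm_ge: "z \<in> K \<Longrightarrow> ereal (vnorm D (g z)) \<le> sup_norm D K g"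
  unfolding sup_norm_def by (rule SUP_upper)

text \<open>From e <= 3. The excess 1/2 over 1 is the budget for the relative error of the loss
  term.\<close>

lemma exp_ratio_ge: "3 / 2 \<le> exp 1 / (exp 1 - 1 :: real)"
proof -
  have "1 < exp (1::real)" by simp
  then show ?thesis using exp_le by (simp add: field_simps)
qed

lemma derivative_from_quadratic:
  fixes W :: "complex \<Rightarrow> complex"
  assumes R: "0 < R" and W: "\<And>t. cmod t < R \<Longrightarrow> cmod (W t - W 0 - t * d) \<le> K * (cmod t)\<^sup>2"
  shows "(W has_field_derivative d) (at 0)"
  unfolding DERIV_def
proof (rule LIM_zero_cancel, rule tendsto_norm_zero_cancel, rule tendsto_sandwich [where f = "\<lambda>_. 0"])
  show "\<forall>\<^sub>F t in at 0. cmod ((W (0 + t) - W 0) / t - d) \<le> K * cmod t"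
    unfolding eventually_at
  proof (intro exI [of _ R] conjI R ballI impI)
    fix t :: complex assume t: "t \<noteq> 0 \<and> dist t 0 < R"
    have "(W t - W 0) / t - d = (W t - W 0 - t * d) / t" using t by (simp add: diff_divide_distrib)
    then have "cmod ((W t - W 0) / t - d) = cmod (W t - W 0 - t * d) / cmod t" by (simp add: norm_divide)
    also have "\<dots> \<le> K * (cmod t)\<^sup>2 / cmod t" using W t by (intro divide_right_mono) auto
    finally show "cmod ((W (0 + t) - W 0) / t - d) \<le> K * cmod t" using t by (simp add: power2_eq_square)
  qed
  have "((\<lambda>t::complex. K * cmod t) \<longlongrightarrow> K * cmod 0) (at 0)" by (intro tendsto_intros)
  then show "((\<lambda>t::complex. K * cmod t) \<longlongrightarrow> 0) (at 0)" by simp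
qed auto

lemma weighted_sum_bound:
  fixes w :: "nat \<Rightarrow> real" and y :: "nat \<Rightarrow> complex"
  assumes "\<And>k. k \<in> K \<Longrightarrow> cmod (y k) \<le> B"
  shows "cmod (\<Sum>k\<in>K. of_real (w k) * y k) \<le> (\<Sum>k\<in>K. \<bar>w k\<bar>) * B"
  unfolding sum_distrib_right
  by (rule sum_norm_le) (simp add: norm_mult mult_left_mono assms)

context
  fixes D :: nat and f g :: "cvec \<Rightarrow> cvec" and x :: cvec and r1 r2 m A H h :: real
    and I :: nat and a :: "nat \<Rightarrow> nat \<Rightarrow> real" and b :: "nat \<Rightarrow> real"
    and sol :: implicit_solver and L p s :: nat and w :: "nat \<Rightarrow> real"
  assumes f: "field_analytic_on D f (vball D x (r1 + r2))" "real_field D f"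
    and g: "field_analytic_on D g (vball D x (r1 + r2))" "real_field D g"
    and f_bound: "\<And>z. z \<in> vball D x (r1 + r2) \<Longrightarrow> vnorm D (f z) \<le> m"
    and g_bound: "\<And>z. z \<in> vball D x (r1 + r2) \<Longrightarrow> vnorm D (g z) \<le> m"
    and x: "x \<in> rspace D" and r1: "0 < r1" and r2: "0 < r2" and m: "0 \<le> m"
    and row: "\<And>i. i < I \<Longrightarrow> (\<Sum>j<I. \<bar>a i j\<bar>) \<le> A" and col: "(\<Sum>i<I. \<bar>b i\<bar>) \<le> A" and A: "1 \<le> A"
    and H: "0 < H" "16 * H * A * m \<le> r2 / 4" "16 * H * A * m \<le> r1"
    and order: "rk_order I a b p" and Lp: "p \<le> Lstar sol L + 1" and p: "1 \<le> p" and s: "1 \<le> s"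
    and w: "\<And>j. 1 \<le> j \<Longrightarrow> j \<le> p \<Longrightarrow> (\<Sum>k=1..p. w k * real k ^ j) = (if j = 1 then 1 else 0)"
    and h: "0 < h" "real p * (real s * h) < H"
begin

private abbreviation (input) "\<Delta> \<equiv> real s * h"
private abbreviation (input) "\<Psi> \<equiv> unrolled_step sol I a b L D h g ^^ s"
private abbreviation (input) "T \<equiv> flow D f \<Delta>"
private abbreviation (input) "W1 \<equiv> \<Sum>k=1..p. \<bar>w k\<bar>"

text \<open>The terms on the right stem from the loss itself, the deviation of k compositions from k
  times the loss, the scheme error for g, and numerical differentiation of the difference of the two
  flows.\<close>

lemma field_difference_le:
  assumes c: "4 * (\<Delta> * m) \<le> c * r1" "2 * (real p * (\<Delta> * A * m)) \<le> c * r1" "c \<le> 1"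
    and \<epsilon>: "\<And>z. z \<in> vball D x r1 \<Longrightarrow> vdist D (\<Psi> z) (T z) \<le> \<epsilon>"
    and i: "i < D"
  shows "\<Delta> * cmod (g x i - f x i) \<le> \<epsilon> + W1 * (2 ^ p * (c * \<epsilon>))
    + W1 * (2 ^ (p * s) * (3 * (h * A * m) * (h / H) ^ p))
    + 2 * H * m * (1 + W1) * (real p * \<Delta> / H) ^ Suc p"
proof -
  define S where "S = vball D x (r1 + r2)"
  define \<rho> where "\<rho> = r2 / 4"
  interpret F: rk_field D f S m \<rho> I a b A H
    by unfold_locales (use f f_bound m r2 row col A H in \<open>auto simp: S_def \<rho>_def vball_iff\<close>)
  interpret G: rk_field D g S m \<rho> I a b A H
    by unfold_locales (use g g_bound m r2 row col A H in \<open>auto simp: S_def \<rho>_def vball_iff\<close>)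
  have xc: "x \<in> cspace D" using x rspace_cspace by blast
  have \<Delta>: "0 < \<Delta>" using h s by simp
  have \<Delta>_le: "real k * \<Delta> \<le> H" if "k \<le> p" for k
  proof -
    have "real k * \<Delta> \<le> real p * \<Delta>" using that \<Delta> by (intro mult_right_mono) auto
    then show ?thesis using h(2) by simp
  qed
  have ps: "real (k * s) * h \<le> H" if "k \<le> p" for k
    using \<Delta>_le [OF that] by (simp add: mult.assoc)
  have \<Delta>H: "\<Delta> < H"
  proof -
    have "1 * \<Delta> \<le> real p * \<Delta>" using p \<Delta> by (intro mult_right_mono) auto
    then show ?thesis using h(2) by simp
  qed
  have hH: "h < H"
  proof -
    have "1 * h \<le> \<Delta>" using s h(1) by (intro mult_right_mono) auto
    then show ?thesis using \<Delta>H by simp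
  qed
  have Am: "0 \<le> A * m" using A m by simp
  have inset4: "z \<in> inset D S (4 * \<rho>)" if "z \<in> vball D x r1" for z
    using inset_vball [OF that, of r2] by (simp add: S_def \<rho>_def)
  have xB: "x \<in> vball D x r1" using xc r1 by (simp add: vball_iff)
  have x4: "x \<in> inset D S (4 * \<rho>)" by (rule inset4 [OF xB])
  have inset2: "z \<in> inset D S (2 * \<rho>)" if "z \<in> inset D S (4 * \<rho>)" for z
    by (rule inset_shift [OF that inset_cspace [OF that], of 0]) (use G.\<rho>_pos in auto)
  have x3: "x \<in> inset D S (3 * \<rho>)"
    by (rule inset_shift [OF x4 xc, of 0]) (use G.\<rho>_pos in auto)
  have x2: "x \<in> inset D S (2 * \<rho>)" by (rule inset2 [OF x4])
  have \<epsilon>0: "0 \<le> \<epsilon>" using \<epsilon> [OF xB] vdist_nonneg order_trans by blast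
  have c0: "0 \<le> c"
  proof -
    have "0 \<le> 4 * (\<Delta> * m)" using \<Delta> m by simp
    then have "0 \<le> c * r1" using c(1) by linarith
    then show ?thesis using r1 by (simp add: zero_le_mult_iff)
  qed
  have W1: "0 \<le> W1" by (simp add: sum_nonneg)
  define B where "B = 3 * (h * A * m) * (h / H) ^ p"
  have B: "0 \<le> B" using h(1) A m H by (simp add: B_def)

  have \<Psi>_power: "(\<Psi> ^^ k) y = (unrolled_step sol I a b L D h g ^^ (k * s)) y" for k y
    by (simp add: funpow_mult mult.commute)
  \<comment> \<open>The purpose of \<open>16 * H * A * m \<le> r1\<close>: up to p compositions stay
    well inside the ball on which the loss is measured.\<close>
  have displacement: "real k * (\<Delta> * A * m) \<le> r1 / 16" if "k \<le> p" for k
  proof -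
    have "real k * \<Delta> * (A * m) \<le> H * (A * m)" using \<Delta>_le [OF that] Am by (rule mult_right_mono)
    then show ?thesis using H(3) by (simp add: mult.assoc)
  qed
  have \<Psi>_near: "vdist D ((\<Psi> ^^ k) x) x \<le> real k * (\<Delta> * A * m)" "(\<Psi> ^^ k) x \<in> cspace D" if "k \<le> p" for k
    using G.step_power_near [OF h(1) hH order Lp g(2) x4 ps [OF that] order_refl] inset_cspace
    unfolding \<Psi>_power by (simp_all add: mult.assoc)
  have T_power: "(T ^^ k) x = flow D f (real k * \<Delta>) x" if "1 \<le> k" "k \<le> p" for k
    using F.flow_power [OF \<Delta> \<Delta>H order Lp f(2) x3, of "k - 1"] \<Delta>_le [OF that(2)] that(1) by simp
  have g_power: "(flow D g h ^^ (k * s)) x = flow D g (real k * \<Delta>) x" if "1 \<le> k" "k \<le> p" for k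
  proof -
    have "Suc (k * s - 1) = k * s" using that(1) s by simp
    then show ?thesis
      using G.flow_power [OF h(1) hH order Lp g(2) x3, of "k * s - 1"] ps [OF that(2)] by (simp add: mult.assoc)
  qed

  have iter: "\<forall>i<D. cmod ((\<Psi> ^^ k) x i - (T ^^ k) x i - of_nat k * (\<Psi> x i - T x i)) \<le> (2 ^ k - 1) * (c * \<epsilon>)"
    if k: "k \<le> p" for k
  proof -
    have 1: "holo_map (vball D x r1) \<Psi>"
      using G.step_power_holo [OF h(1) hH order Lp g(2) ps [OF p], of s] inset4
      by (auto intro: holo_map_subset)
    have 2: "holo_map (vball D x r1) T"
      unfolding holo_map_def
    proof (intro allI impI)
      fix U y assume U: "open U" "\<forall>\<tau>\<in>U. y \<tau> \<in> vball D x r1" "holo_curve U y"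
      have y2: "y \<tau> \<in> inset D S (2 * \<rho>)" if "\<tau> \<in> U" for \<tau>
        using inset2 [OF inset4] U(2) that by blast
      have "holo_curve U (\<lambda>\<tau>. F.traj (of_real \<Delta>) (y \<tau>) 1)"
        by (rule F.traj_holo [OF U(1,3) y2 holomorphic_on_const]) (use \<Delta> \<Delta>H in \<open>simp_all del: of_real_mult\<close>)
      moreover have "F.traj (of_real \<Delta>) (y \<tau>) 1 = T (y \<tau>)" if "\<tau> \<in> U" for \<tau>
        using F.flow_traj [OF y2 [OF that] \<Delta>] \<Delta>H by simp
      ultimately show "holo_curve U (\<lambda>\<tau>. T (y \<tau>))"
        unfolding holo_curve_def using holomorphic_transform by (metis (no_types, lifting))
    qed
    have 3: "vdist D (T z) z \<le> \<Delta> * m" if "z \<in> vball D x r1" for z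
      by (rule F.flow_near [OF inset2 [OF inset4 [OF that]] \<Delta>]) (use \<Delta>H in simp)
    have 4: "(\<Psi> ^^ k) x \<in> vball D x r1" "vdist D ((\<Psi> ^^ k) x) x \<le> real p * (\<Delta> * A * m)" if "k \<le> p" for k
    proof -
      have "real k * (\<Delta> * A * m) \<le> real p * (\<Delta> * A * m)"
        using that \<Delta> A m by (intro mult_right_mono) auto
      then show "vdist D ((\<Psi> ^^ k) x) x \<le> real p * (\<Delta> * A * m)" using \<Psi>_near(1) [OF that] by linarith
      show "(\<Psi> ^^ k) x \<in> vball D x r1"
        using \<Psi>_near [OF that] displacement [OF that] r1 unfolding vball_iff by linarith
    qed
    have 5: "(T ^^ k) x \<in> vball D x (r1 / 2)" if "k \<le> p" for k
    proof (cases "k = 0")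
      case True
      then show ?thesis using xc r1 by (simp add: vball_iff)
    next
      case False
      then have k1: "1 \<le> k" by simp
      have pos: "0 < real k * \<Delta>" using k1 \<Delta> by simp
      have "real k * (\<Delta> * 1 * m) \<le> real k * (\<Delta> * A * m)"
        using \<Delta> A m by (intro mult_left_mono mult_right_mono) auto
      then have "real k * \<Delta> * m \<le> r1 / 16" using displacement [OF that] by (simp add: mult.assoc)
      moreover have "vdist D ((T ^^ k) x) x \<le> real k * \<Delta> * m"
        unfolding T_power [OF k1 that] by (rule F.flow_near [OF x2 pos \<Delta>_le [OF that]])
      moreover have "(T ^^ k) x \<in> cspace D"
        unfolding T_power [OF k1 that] by (rule F.flow_cspace [OF x2 pos \<Delta>_le [OF that]])
      ultimately show ?thesis using r1 unfolding vball_iff by linarith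
    qed
    show ?thesis
      using iterate_difference [OF xc r1 1 2 \<epsilon> 3 4 5 c k] by blast
  qed

  \<comment> \<open>As a function of complex time, W vanishes at 0 and has the derivative g(x) -
    f(x) there; this is what the weights extract.\<close>
  define W where "W = (\<lambda>t. G.traj t x 1 i - F.traj t x 1 i)"
  define d where "d = g x i - f x i"
  have W_hol: "W holomorphic_on ball 0 H"
  proof -
    have const: "holo_curve (ball 0 H) (\<lambda>_. x)" by (simp add: holo_curve_def)
    have "holo_curve (ball 0 H) (\<lambda>t. G.traj t x 1)" "holo_curve (ball 0 H) (\<lambda>t. F.traj t x 1)"
      by (rule G.traj_holo [OF open_ball const x2 holomorphic_on_ident], simp,
          rule F.traj_holo [OF open_ball const x2 holomorphic_on_ident], simp)
    then show ?thesis unfolding W_def holo_curve_def by (intro holomorphic_on_diff) auto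
  qed
  have W_le: "cmod (W t) \<le> 2 * H * m" and W_le_t: "cmod (W t) \<le> cmod t * m + cmod t * m" if t: "cmod t < H" for t
  proof -
    have "cmod (W t) = cmod ((G.traj t x 1 i - x i) - (F.traj t x 1 i - x i))" by (simp add: W_def)
    also have "\<dots> \<le> cmod t * m + cmod t * m"
      by (rule order_trans [OF norm_triangle_ineq4
            add_mono [OF G.traj_displacement [OF x2] F.traj_displacement [OF x2]]]) (use t in simp_all)
    finally show *: "cmod (W t) \<le> cmod t * m + cmod t * m" .
    have "cmod t * m \<le> H * m" using t m by (intro mult_right_mono) auto
    then show "cmod (W t) \<le> 2 * H * m" using * by linarith
  qed
  have W0: "W 0 = 0" using W_le_t [of 0] H by simp
  have W_deriv: "(W has_field_derivative d) (at 0)"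
  proof (rule derivative_from_quadratic [OF H(1)])
    fix t assume t: "cmod t < H"
    have "W t - W 0 - t * d = (G.traj t x 1 i - x i - t * g x i) - (F.traj t x 1 i - x i - t * f x i)"
      by (simp add: W0) (simp add: W_def d_def algebra_simps)
    also have "cmod \<dots> \<le> 2 * (cmod t * m)\<^sup>2 / \<rho> + 2 * (cmod t * m)\<^sup>2 / \<rho>"
      by (rule order_trans [OF norm_triangle_ineq4
            add_mono [OF G.traj_first_order [OF x2] F.traj_first_order [OF x2]]]) (use t in simp_all)
    also have "\<dots> = 4 * m\<^sup>2 / \<rho> * (cmod t)\<^sup>2" by (simp add: power_mult_distrib)
    finally show "cmod (W t - W 0 - t * d) \<le> 4 * m\<^sup>2 / \<rho> * (cmod t)\<^sup>2" .
  qed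
  have d_le: "cmod d \<le> 2 * m"
  proof -
    have "x \<in> S" using xc r1 r2 by (simp add: S_def vball_iff)
    then have "cmod (g x i) \<le> m" "cmod (f x i) \<le> m" by (rule G.cmod_g_le F.cmod_g_le)+
    then show ?thesis using norm_triangle_ineq4 [of "g x i" "f x i"] by (simp add: d_def)
  qed

  define P where "P = (\<lambda>k. (\<Psi> ^^ k) x i - (T ^^ k) x i)"
  define E where "E = \<Psi> x i - T x i"
  define Wk where "Wk = (\<lambda>k. W (of_nat k * of_real \<Delta>))"
  \<comment> \<open>The contributions of f cancel exactly, since powers of T are flows over
    multiples of \<Delta>. What remains is the error of the scheme for g after k s steps.\<close>
  have WP: "cmod (Wk k - P k) \<le> 2 ^ (p * s) * B" if k: "k \<in> {1..p}" for k
  proof -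
    have k1: "1 \<le> k" "k \<le> p" using k by auto
    have pos: "0 < real k * \<Delta>" using k1 \<Delta> by simp
    have eq: "of_nat k * of_real \<Delta> = complex_of_real (real k * \<Delta>)" by simp
    have "Wk k = flow D g (real k * \<Delta>) x i - flow D f (real k * \<Delta>) x i"
      unfolding Wk_def W_def eq G.flow_traj [OF x2 pos \<Delta>_le [OF k1(2)]] F.flow_traj [OF x2 pos \<Delta>_le [OF k1(2)]] ..
    then have "Wk k - P k = (flow D g h ^^ (k * s)) x i - (unrolled_step sol I a b L D h g ^^ (k * s)) x i"
      unfolding P_def T_power [OF k1] g_power [OF k1] \<Psi>_power by simp
    also have "cmod \<dots> \<le> (2 ^ (k * s) - 1) * B"
      using order_trans [OF cmod_le_vdist [OF i] G.global_error [OF h(1) hH order Lp g(2) x4 x ps [OF k1(2)]]]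
      by (simp add: B_def norm_minus_commute)
    also have "\<dots> \<le> 2 ^ (p * s) * B"
    proof (rule mult_right_mono [OF _ B])
      have "(2::real) ^ (k * s) \<le> 2 ^ (p * s)" using k1 by (intro power_increasing) auto
      then show "(2::real) ^ (k * s) - 1 \<le> 2 ^ (p * s)" by linarith
    qed
    finally show ?thesis .
  qed
  have PE: "cmod (P k - of_nat k * E) \<le> 2 ^ p * (c * \<epsilon>)" if k: "k \<in> {1..p}" for k
  proof -
    have "cmod (P k - of_nat k * E) \<le> (2 ^ k - 1) * (c * \<epsilon>)"
      using iter [of k] i k by (simp add: P_def E_def)
    also have "\<dots> \<le> 2 ^ p * (c * \<epsilon>)"
    proof (rule mult_right_mono)
      have "(2::real) ^ k \<le> 2 ^ p" using k by (intro power_increasing) auto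
      then show "(2::real) ^ k - 1 \<le> 2 ^ p" by linarith
    qed (use c0 \<epsilon>0 in simp)
    finally show ?thesis .
  qed
  have E_le: "cmod E \<le> \<epsilon>" unfolding E_def by (rule order_trans [OF cmod_le_vdist [OF i] \<epsilon> [OF xB]])
  have norm_\<Delta>: "cmod (of_real \<Delta>) = \<Delta>" using \<Delta> by (simp del: of_real_mult)
  define R where "R = of_real \<Delta> * d - (\<Sum>k=1..p. of_real (w k) * Wk k)"
  have R_le: "cmod R \<le> 2 * H * m * (1 + W1) * (real p * \<Delta> / H) ^ Suc p"
  proof -
    have "cmod R \<le> (H * cmod d + W1 * (2 * H * m)) * (real p * cmod (of_real \<Delta>) / H) ^ Suc p"
      unfolding R_def Wk_def
      by (rule numerical_differentiation [OF W_hol W_le W0 W_deriv p w]) (use h \<Delta> in \<open>simp_all del: of_real_mult\<close>)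
    also note norm_\<Delta>
    also have "(H * cmod d + W1 * (2 * H * m)) * (real p * \<Delta> / H) ^ Suc p \<le> (H * (2 * m) + W1 * (2 * H * m)) * (real p * \<Delta> / H) ^ Suc p"
      using d_le H(1) \<Delta> by (intro mult_right_mono add_right_mono mult_left_mono) auto
    finally show ?thesis by (simp add: algebra_simps)
  qed
  have moment: "(\<Sum>k=1..p. of_real (w k) * (of_nat k * E)) = E"
  proof -
    have "(\<Sum>k=1..p. of_real (w k) * (of_nat k * E)) = complex_of_real (\<Sum>k=1..p. w k * real k ^ 1) * E"
      by (simp add: sum_distrib_right mult.assoc)
    then show ?thesis unfolding w [OF order_refl p] by simp
  qed
  \<comment> \<open>Telescoping: the weighted sum of \<open>Wk\<close> is passed to \<open>P\<close>
    and then to multiples of E, which add up to E by \<open>moment\<close>.\<close>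
  have "of_real \<Delta> * d = E + (\<Sum>k=1..p. of_real (w k) * (P k - of_nat k * E))
      + (\<Sum>k=1..p. of_real (w k) * (Wk k - P k)) + R"
    unfolding R_def right_diff_distrib sum_subtractf moment by simp
  also have "cmod \<dots> \<le> cmod E + cmod (\<Sum>k=1..p. of_real (w k) * (P k - of_nat k * E))
      + cmod (\<Sum>k=1..p. of_real (w k) * (Wk k - P k)) + cmod R"
    by (intro norm_triangle_le add_right_mono norm_triangle_ineq order_refl)
  also have "\<dots> \<le> \<epsilon> + W1 * (2 ^ p * (c * \<epsilon>)) + W1 * (2 ^ (p * s) * B)
      + 2 * H * m * (1 + W1) * (real p * \<Delta> / H) ^ Suc p"
    by (intro add_mono E_le R_le weighted_sum_bound PE WP)
  finally show ?thesis unfolding norm_mult norm_\<Delta> B_def d_def .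
qed

end

text \<open>Rescaling space multiplies m, r1 and r2 by a common factor and leaves admissible step
  sizes unchanged. The ratios q1 and q2 are therefore fixed before the two constants, everything
  else after them.\<close>

theorem theorem3p4:
  fixes I :: nat and a :: "nat \<Rightarrow> nat \<Rightarrow> real" and b :: "nat \<Rightarrow> real"
    and sol :: implicit_solver and p s :: nat and q1 q2 :: real
  assumes "rk_consistent I b"
    and "\<not> rk_explicit I a"
    and "rk_order I a b p"
    and "s \<ge> 1"
  shows "\<exists>\<Delta>t0 > 0. \<exists>c2 :: real.
    \<forall>(D :: nat) (L :: nat) (h :: real) (f :: cvec \<Rightarrow> cvec)
      (net :: real list \<Rightarrow> cvec \<Rightarrow> cvec) (\<Theta> :: real list set) (\<theta> :: real list)
      (N :: nat) (M :: nat) (X :: nat \<Rightarrow> cvec)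
      (x :: cvec) (r1 :: real) (r2 :: real) (m :: real).
      p \<le> Lstar sol L + 1 \<longrightarrow>
      real_field D f \<longrightarrow>
      (\<forall>\<theta>'\<in>\<Theta>. real_field D (net \<theta>')) \<longrightarrow>
      (\<forall>n\<in>{1..N}. X n \<in> rspace D) \<longrightarrow>
      is_arg_min (\<lambda>\<theta>'. unrolled_loss sol I a b L D h s f N M X (net \<theta>')) (\<lambda>\<theta>'. \<theta>' \<in> \<Theta>) \<theta> \<longrightarrow>
      x \<in> rspace D \<longrightarrow> r1 > 0 \<longrightarrow> r2 > 0 \<longrightarrow> m / r1 = q1 \<longrightarrow> m / r2 = q2 \<longrightarrow>
      field_analytic_on D f (vball D x (r1 + r2)) \<longrightarrow>
      field_analytic_on D (net \<theta>) (vball D x (r1 + r2)) \<longrightarrow>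
      sup_norm D (vball D x (r1 + r2)) f \<le> ereal m \<longrightarrow>
      sup_norm D (vball D x (r1 + r2)) (net \<theta>) \<le> ereal m \<longrightarrow>
      0 < s * h \<longrightarrow> s * h < \<Delta>t0 \<longrightarrow>
      ereal (vnorm D (\<lambda>k. net \<theta> x k - f x k))
        \<le> ereal (c2 * m * h ^ p)
          + ereal (exp 1 / (exp 1 - 1)) *
            (sup_norm D (vball D x r1)
               (\<lambda>z k. (unrolled_step sol I a b L D h (net \<theta>) ^^ s) z k - flow D f (s * h) z k)
             / ereal (s * h))"
proof -
  \<comment> \<open>The sum of all coefficients bounds every row sum and the weights at once; the 1
    ensures that A is at least 1.\<close>
  define A where "A = 1 + (\<Sum>i<I. \<Sum>j<I. \<bar>a i j\<bar>) + (\<Sum>i<I. \<bar>b i\<bar>)"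
  have nn: "0 \<le> (\<Sum>i<I. \<Sum>j<I. \<bar>a i j\<bar>)" "0 \<le> (\<Sum>i<I. \<bar>b i\<bar>)" by (simp_all add: sum_nonneg)
  have A: "1 \<le> A" "(\<Sum>i<I. \<bar>b i\<bar>) \<le> A" using nn by (simp_all add: A_def)
  have row: "(\<Sum>j<I. \<bar>a i j\<bar>) \<le> A" if "i < I" for i
  proof -
    have "(\<Sum>j<I. \<bar>a i j\<bar>) \<le> (\<Sum>i<I. \<Sum>j<I. \<bar>a i j\<bar>)"
      by (rule member_le_sum [where f = "\<lambda>i. \<Sum>j<I. \<bar>a i j\<bar>"]) (use that in \<open>auto simp: sum_nonneg\<close>)
    then show ?thesis unfolding A_def using nn by linarith
  qed
  obtain w :: "nat \<Rightarrow> real" where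
    w: "\<And>j. 1 \<le> j \<Longrightarrow> j \<le> p \<Longrightarrow> (\<Sum>k=1..p. w k * real k ^ j) = (if j = 1 then 1 else 0)"
    using differentiation_weights [of p] by blast
  define W1 where "W1 = (\<Sum>k=1..p. \<bar>w k\<bar>)"
  have W1: "0 \<le> W1" by (simp add: W1_def sum_nonneg)
  \<comment> \<open>Chosen so that A m is at most \<kappa> r1 and at most \<kappa> r2/4, the latter
    for the margin. The absolute values are there because the signs of q1 and q2 are known only once
    m, r1 and r2 are given.\<close>
  define \<kappa> where "\<kappa> = A * (\<bar>q1\<bar> + 4 * \<bar>q2\<bar>)"
  have \<kappa>: "0 \<le> \<kappa>" using A by (simp add: \<kappa>_def)
  define H where "H = 1 / (16 * \<kappa> + 1)"
  have H: "0 < H" "16 * H * \<kappa> \<le> 1" using \<kappa> by (simp_all add: H_def field_simps)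
  \<comment> \<open>With \<open>c = c0 * \<Delta>\<close>, the product c r1 is exactly the sum of
    the left sides of the two smallness conditions in \<open>field_difference_le\<close>.\<close>
  define c0 where "c0 = (4 + 2 * real p * A) * \<bar>q1\<bar>"
  have c0: "0 \<le> c0" using A by (simp add: c0_def)
  \<comment> \<open>The first bound keeps all p sample times below H; the second makes
    \<open>W1 * 2 ^ p * c\<close> at most 1/2, which is the relative error allowed for the
    loss.\<close>
  define \<Delta>t0 where "\<Delta>t0 = min (H / (real p + 1)) (1 / (2 * (1 + W1 * 2 ^ p) * (c0 + 1)))"
  have pos2: "0 < 2 * (1 + W1 * 2 ^ p) * (c0 + 1)" using W1 c0 by (simp add: add_pos_nonneg add_nonneg_pos)
  have \<Delta>t0: "0 < \<Delta>t0" using H pos2 by (simp add: \<Delta>t0_def)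
  \<comment> \<open>The summand 2 settles p = 0. The others are the scheme error and the
    differentiation error divided by \<Delta> m h ^ p; the divisor s comes from \<Delta> = s
    h.\<close>
  define c2 where "c2 = 2 + W1 * (2 ^ (p * s) * (3 * A * (1 / H) ^ p)) / real s
    + 2 * H * (1 + W1) * (real p * real s / H) ^ Suc p / real s"
  have c2: "2 \<le> c2"
    using W1 A H by (simp add: c2_def)
  show ?thesis
  proof (rule exI [of _ \<Delta>t0], intro conjI \<Delta>t0 exI [of _ c2] allI impI)
    fix D L :: nat and h :: real and f :: "cvec \<Rightarrow> cvec" and net :: "real list \<Rightarrow> cvec \<Rightarrow> cvec"
      and \<Theta> :: "real list set" and \<theta> :: "real list" and N M :: nat and X :: "nat \<Rightarrow> cvec"
      and x :: cvec and r1 r2 m :: real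
    assume Lp: "p \<le> Lstar sol L + 1" and f_real: "real_field D f"
      and net_real: "\<forall>\<theta>'\<in>\<Theta>. real_field D (net \<theta>')"
      and arg_min: "is_arg_min (\<lambda>\<theta>'. unrolled_loss sol I a b L D h s f N M X (net \<theta>')) (\<lambda>\<theta>'. \<theta>' \<in> \<Theta>) \<theta>"
      and x: "x \<in> rspace D" and r: "0 < r1" "0 < r2" and q: "m / r1 = q1" "m / r2 = q2"
      and f: "field_analytic_on D f (vball D x (r1 + r2))"
      and g: "field_analytic_on D (net \<theta>) (vball D x (r1 + r2))"
      and f_sup: "sup_norm D (vball D x (r1 + r2)) f \<le> ereal m"
      and g_sup: "sup_norm D (vball D x (r1 + r2)) (net \<theta>) \<le> ereal m"
      and \<Delta>: "0 < real s * h" "real s * h < \<Delta>t0"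
    let ?g = "net \<theta>"
    let ?loss = "sup_norm D (vball D x r1)
      (\<lambda>z k. (unrolled_step sol I a b L D h ?g ^^ s) z k - flow D f (real s * h) z k)"
    have g_real: "real_field D ?g" using net_real arg_min by (simp add: is_arg_min_def)
    have f_bound: "vnorm D (f z) \<le> m" if "z \<in> vball D x (r1 + r2)" for z
      using order_trans [OF sup_norm_ge [OF that] f_sup] by simp
    have g_bound: "vnorm D (?g z) \<le> m" if "z \<in> vball D x (r1 + r2)" for z
      using order_trans [OF sup_norm_ge [OF that] g_sup] by simp
    have xc: "x \<in> cspace D" using x rspace_cspace by blast
    have xS: "x \<in> vball D x (r1 + r2)" and xB: "x \<in> vball D x r1" using xc r by (simp_all add: vball_iff)
    have m: "0 \<le> m" using f_bound [OF xS] vnorm_nonneg order_trans by blast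
    have h: "0 < h" using \<Delta>(1) assms(4) by (simp add: zero_less_mult_iff)
    have loss_nonneg: "0 \<le> ?loss"
      by (rule order_trans [OF _ sup_norm_ge [OF xB]]) simp
    have e1: "0 < exp 1 / (exp 1 - 1 :: real)" using exp_ratio_ge by linarith
    show "ereal (vnorm D (\<lambda>k. ?g x k - f x k))
        \<le> ereal (c2 * m * h ^ p) + ereal (exp 1 / (exp 1 - 1)) * (?loss / ereal (real s * h))"
    proof (cases "?loss = \<infinity>")
      case True
      then show ?thesis using \<Delta>(1) e1 by simp
    next
      case False
      then obtain \<epsilon> where \<epsilon>: "?loss = ereal \<epsilon>" using loss_nonneg by (cases ?loss) auto
      then have \<epsilon>0: "0 \<le> \<epsilon>" using loss_nonneg by simp
      have \<epsilon>_le: "vdist D ((unrolled_step sol I a b L D h ?g ^^ s) z) (flow D f (real s * h) z) \<le> \<epsilon>"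
        if "z \<in> vball D x r1" for z
        using sup_norm_ge [OF that, of D "\<lambda>z k. (unrolled_step sol I a b L D h ?g ^^ s) z k - flow D f (real s * h) z k"]
        unfolding \<epsilon> by (simp add: vdist_def)
      have rhs: "ereal (c2 * m * h ^ p) + ereal (exp 1 / (exp 1 - 1)) * (?loss / ereal (real s * h))
          = ereal (c2 * m * h ^ p + exp 1 / (exp 1 - 1) * (\<epsilon> / (real s * h)))"
      proof -
        have "real s * h \<noteq> 0" using \<Delta>(1) by linarith
        then show ?thesis unfolding \<epsilon> by (simp only: ereal_divide if_False times_ereal.simps plus_ereal.simps)
      qed
      have rhs_nonneg: "0 \<le> c2 * m * h ^ p + exp 1 / (exp 1 - 1) * (\<epsilon> / (real s * h))"
        using c2 m h e1 \<epsilon>0 \<Delta>(1) by simp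
      have "vnorm D (\<lambda>k. ?g x k - f x k) \<le> c2 * m * h ^ p + exp 1 / (exp 1 - 1) * (\<epsilon> / (real s * h))"
      proof (rule vnorm_leI [OF rhs_nonneg])
        fix i assume i: "i < D"
        show "cmod (?g x i - f x i) \<le> c2 * m * h ^ p + exp 1 / (exp 1 - 1) * (\<epsilon> / (real s * h))"
        \<comment> \<open>For p = 0 there are no sample points, and the bound m on both fields
          already gives the claim.\<close>
        proof (cases "p = 0")
          case True
          have "cmod (?g x i - f x i) \<le> m + m"
            by (intro order_trans [OF norm_triangle_ineq4] add_mono order_trans [OF cmod_le_vnorm [OF i]]
                g_bound [OF xS] f_bound [OF xS])
          also have "\<dots> \<le> c2 * m" using mult_right_mono [OF c2 m] by simp
          finally show ?thesis using True e1 \<epsilon>0 \<Delta>(1) by (simp add: add_increasing2)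
        next
          case False
          then have p: "1 \<le> p" by simp
          let ?\<Delta> = "real s * h"
          have mr1: "m = q1 * r1" and mr2: "m = q2 * r2" using q r by (auto simp: field_simps)
          have q_nn: "0 \<le> q1" "0 \<le> q2" using q m r by auto
          have small: "16 * H * A * m \<le> y" if "A * m \<le> \<kappa> * y" "0 \<le> y" for y
          proof -
            have "16 * H * (A * m) \<le> 16 * H * (\<kappa> * y)" using that(1) H(1) by (intro mult_left_mono) auto
            also have "\<dots> = 16 * H * \<kappa> * y" by simp
            also have "\<dots> \<le> 1 * y" using H(2) that(2) by (rule mult_right_mono)
            finally show ?thesis by (simp add: mult.assoc)
          qed
          have H2: "16 * H * A * m \<le> r2 / 4"
          proof (rule small)
            have "0 \<le> A * (q1 * (r2 / 4))" using A q_nn r by simp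
            then show "A * m \<le> \<kappa> * (r2 / 4)"
              unfolding \<kappa>_def using q_nn by (subst mr2) (simp add: algebra_simps)
          qed (use r in simp)
          have H1: "16 * H * A * m \<le> r1"
          proof (rule small)
            have "0 \<le> A * (4 * q2 * r1)" using A q_nn r by simp
            then show "A * m \<le> \<kappa> * r1"
              unfolding \<kappa>_def using q_nn by (subst mr1) (simp add: algebra_simps)
          qed (use r in simp)
          have p\<Delta>: "real p * ?\<Delta> < H"
          proof -
            have "(real p + 1) * ?\<Delta> < H" using \<Delta>(2) by (simp add: \<Delta>t0_def field_simps)
            then show ?thesis using \<Delta>(1) by (simp add: distrib_right)
          qed
          define c where "c = c0 * ?\<Delta>"
          have c_small: "2 * (1 + W1 * 2 ^ p) * c \<le> 1" "c \<le> 1"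
          proof -
            have "2 * (1 + W1 * 2 ^ p) * (c0 + 1) * ?\<Delta> < 1"
              using \<Delta>(2) pos2 by (simp add: \<Delta>t0_def pos_less_divide_eq mult.commute)
            moreover have "2 * (1 + W1 * 2 ^ p) * c \<le> 2 * (1 + W1 * 2 ^ p) * (c0 + 1) * ?\<Delta>"
            proof -
              have "c \<le> (c0 + 1) * ?\<Delta>" using \<Delta>(1) by (simp add: c_def distrib_right)
              then show ?thesis using W1 by (simp only: mult.assoc) (intro mult_left_mono, auto)
            qed
            ultimately show *: "2 * (1 + W1 * 2 ^ p) * c \<le> 1" by linarith
            have "0 \<le> c" using c0 \<Delta>(1) by (simp add: c_def)
            then have "0 \<le> W1 * 2 ^ p * c" using W1 by simp
            then show "c \<le> 1" using * \<open>0 \<le> c\<close> by (simp add: algebra_simps)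
          qed
          have c1: "4 * (?\<Delta> * m) \<le> c * r1" "2 * (real p * (?\<Delta> * A * m)) \<le> c * r1"
          proof -
            have "c * r1 = 4 * (?\<Delta> * m) + 2 * (real p * (?\<Delta> * A * m))"
              unfolding c_def c0_def mr1 using q_nn by (simp add: algebra_simps)
            moreover have "0 \<le> 4 * (?\<Delta> * m)" "0 \<le> 2 * (real p * (?\<Delta> * A * m))"
              using \<Delta>(1) m A by auto
            ultimately show "4 * (?\<Delta> * m) \<le> c * r1" "2 * (real p * (?\<Delta> * A * m)) \<le> c * r1" by linarith+
          qed
          have main: "?\<Delta> * cmod (?g x i - f x i) \<le> \<epsilon> + W1 * (2 ^ p * (c * \<epsilon>))
            + W1 * (2 ^ (p * s) * (3 * (h * A * m) * (h / H) ^ p))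
            + 2 * H * m * (1 + W1) * (real p * ?\<Delta> / H) ^ Suc p"
            unfolding W1_def
            by (rule field_difference_le [OF f f_real g g_real f_bound g_bound x r m row A(2,1) H(1) H2 H1
                  assms(3) Lp p assms(4) w h p\<Delta> c1 c_small(2) \<epsilon>_le i])
          \<comment> \<open>The loss enters with the factor \<open>1 + W1 * 2 ^ p * c\<close>, at
            most 3/2 by the choice of \<open>\<Delta>t0\<close>.\<close>
          have part1: "\<epsilon> + W1 * (2 ^ p * (c * \<epsilon>)) \<le> exp 1 / (exp 1 - 1) * \<epsilon>"
          proof -
            have "0 \<le> c" using c0 \<Delta>(1) by (simp add: c_def)
            then have "1 + W1 * 2 ^ p * c \<le> 3 / 2" using c_small(1) by (simp add: algebra_simps)
            then have "1 + W1 * 2 ^ p * c \<le> exp 1 / (exp 1 - 1)" using exp_ratio_ge by linarith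
            then have "(1 + W1 * 2 ^ p * c) * \<epsilon> \<le> exp 1 / (exp 1 - 1) * \<epsilon>" using \<epsilon>0 by (rule mult_right_mono)
            then show ?thesis by (simp add: algebra_simps)
          qed
          have part2: "W1 * (2 ^ (p * s) * (3 * (h * A * m) * (h / H) ^ p))
            + 2 * H * m * (1 + W1) * (real p * ?\<Delta> / H) ^ Suc p \<le> ?\<Delta> * (c2 * m * h ^ p)"
          proof -
            have "?\<Delta> * (c2 * m * h ^ p) = ?\<Delta> * (2 * m * h ^ p)
                + W1 * (2 ^ (p * s) * (3 * (h * A * m) * (h / H) ^ p))
                + 2 * H * m * (1 + W1) * (real p * ?\<Delta> / H) ^ Suc p"
            proof -
              have "0 < real s" using assms(4) by simp
              then show ?thesis
                using H(1) by (simp add: c2_def field_simps power_mult_distrib power_divide)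
            qed
            moreover have "0 \<le> ?\<Delta> * (2 * m * h ^ p)" using \<Delta>(1) m h by simp
            ultimately show ?thesis by linarith
          qed
          have "?\<Delta> * cmod (?g x i - f x i)
              \<le> ?\<Delta> * (c2 * m * h ^ p + exp 1 / (exp 1 - 1) * (\<epsilon> / ?\<Delta>))"
          proof -
            have "?\<Delta> * (exp 1 / (exp 1 - 1) * (\<epsilon> / ?\<Delta>)) = exp 1 / (exp 1 - 1) * \<epsilon>"
            proof -
              have "y * (e * (\<epsilon> / y)) = e * \<epsilon>" if "0 < y" for y e :: real using that by simp
              then show ?thesis using \<Delta>(1) by blast
            qed
            then show ?thesis unfolding distrib_left using main part1 part2 by linarith
          qed
          then show ?thesis using \<Delta>(1) by (rule mult_left_le_imp_le)
        qed
      qed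
      then show ?thesis unfolding rhs by simp
    qed
  qed
qed

end
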